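(* Assume the setting described in the context (conditions on nodes, weights and equilibrium measure), with $c=k/N\in(0,1)$ a fixed rational number and $N,k\to\infty$. Let $\Gamma$ be a saturated region. For each compact subset $F$ of $\Gamma$ there is a constant $K_F>0$ such that $$K_{N,k}(x,x)=1+O(e^{-K_FN})\quad\text{as }N\to\infty$$ holds for all nodes $x\in X_N\cap F$. Also, for distinct nodes $x,y\in X_N\cap F$, $$K_{N,k}(x,y)=\frac{O(e^{-K_FN})}{x-y}.$$
   Context: Nodes. $[a,b]$ is a bounded interval and $\rho^0$ is a real analytic function in a complex neighborhood of $[a,b]$ with $\rho^0(x)>0$ for all $x\in[a,b]$ and $\int_a^b\rho^0(x)\,dx=1$. For $N\in\mathbb N$ the nodes $x_{N,0}<\dots<x_{N,N-1}$ in $(a,b)$ are defined by $\int_a^{x_{N,j}}\rho^0(x)\,dx=\frac{2j+1}{2N}$, $j=0,\dots,N-1$; $X_N=\{x_{N,j}\}_{j=0}^{N-1}$. Weights. $w_N(x_{N,j})=w_{N,j}=e^{-NV_N(x_{N,j})}\prod_{n\ne j,\,0\le n\le N-1}|x_{N,j}-x_{N,n}|^{-1}$, where for all sufficiently large $N$ the function $V_N$ is real analytic in a fixed neighborhood $G$ of $[a,b]$ and $V_N(x)=V(x)+\frac{\gamma}{N}+\frac{\eta_N(x)}{N^2}$, with $V$ a fixed real analytic function in $G$, $\gamma$ a constant, and $\limsup_{N\to\infty}\sup_{z\in G}|\eta_N(z)|<\infty$. Polynomials and kernel. $p_{N,k}$, $0\le k\le N-1$, has degree exactly $k$, positive leading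 coefficient, and $\sum_{j=0}^{N-1}p_{N,k}(x_{N,j})p_{N,l}(x_{N,j})w_{N,j}=\delta_{kl}$. The reproducing kernel is $K_{N,k}(x,y)=\sqrt{w_N(x)w_N(y)}\sum_{n=0}^{k-1}p_{N,n}(x)p_{N,n}(y)$ for $x,y\in X_N$. Equilibrium measure. Put $\varphi(x)=V(x)+\int_a^b\log|x-y|\rho^0(y)\,dy$. For $c\in(0,1)$, $\mu^c_{\min}$ is the unique minimizer of $E_c[\mu]=c\int_a^b\int_a^b\log\frac1{|x-y|}\,d\mu(x)\,d\mu(y)+\int_a^b\varphi\,d\mu$ over Borel measures $\mu$ on $[a,b]$ with $\int_a^b d\mu=1$ and $0\le\mu(B)\le\frac1c\int_B\rho^0(x)\,dx$ for all Borel $B\subset[a,b]$. It has a continuous density $d\mu^c_{\min}/dx$ on $(a,b)$. The variational derivative is $\frac{\delta E_c}{\delta\mu}(x)=-2c\int_a^b\log|x-y|\,d\mu(y)+\varphi(x)$, evaluated at $\mu=\mu^c_{\min}$, and $\ell_c\in\mathbb R$ is the Lagrange multiplier for the constraint $\int d\mu=1$. Conditions on the equilibrium measure. Let $\underline{\mathcal F}$ (resp. $\overline{\mathcal F}$) be the closed set of $x\in[a,b]$ where $d\mu^c_{\min}/dx=0$ (resp. $=\rho^0(x)/c$). (1) Each connected component of $\underline{\mathcal F}$ and of $\overline{\mathcal F}$ has nonempty interior, so each of these sets is a (possibly empty) finite union of nondegenerate closed intervals. (2) For each open subinterval $I$ of $(a,b)\setminus(\underline{\mathcal F}\cup\overline{\mathcal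 F})$ and each limit point $z_0\in\underline{\mathcal F}$ of $I$, $\lim_{x\to z_0,x\in I}|x-z_0|^{-1/2}\frac{d\mu^c_{\min}}{dx}(x)\in(0,\infty)$; for each limit point $z_0\in\overline{\mathcal F}$ of $I$, $\lim_{x\to z_0,x\in I}|x-z_0|^{-1/2}\left[\frac1c\rho^0(x)-\frac{d\mu^c_{\min}}{dx}(x)\right]\in(0,\infty)$. (3) $\{a,b\}\subset\underline{\mathcal F}\cup\overline{\mathcal F}$. Voids, bands, saturated regions. A void is a maximal open subinterval of $[a,b]$ on which $\mu^c_{\min}\equiv0$; there $\delta E_c/\delta\mu>\ell_c$ strictly. A band is a maximal open subinterval on which $0<d\mu^c_{\min}/dx<\rho^0/c$ with real analytic density; there $\delta E_c/\delta\mu\equiv\ell_c$. A saturated region is a maximal open subinterval on which $d\mu^c_{\min}/dx\equiv\rho^0/c$; there $\delta E_c/\delta\mu<\ell_c$ strictly. There are finitely many of each. *)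

theory Defs
  imports "HOL-Analysis.Analysis" "HOL-Computational_Algebra.Polynomial"
begin

definition real_analytic_on :: "real set \<Rightarrow> (real \<Rightarrow> real) \<Rightarrow> bool" where
  "real_analytic_on S f \<longleftrightarrow>
     (\<exists>U g. open U \<and> complex_of_real ` S \<subseteq> U \<and> g holomorphic_on U \<and>
            (\<forall>x\<in>S. g (complex_of_real x) = complex_of_real (f x)))"

definition real_analytic_in :: "complex set \<Rightarrow> (complex \<Rightarrow> complex) \<Rightarrow> bool" where
  "real_analytic_in G f \<longleftrightarrow>
     f holomorphic_on G \<and> (\<forall>x::real. complex_of_real x \<in> G \<longrightarrow> f (complex_of_real x) \<in> \<real>)"

definition node_density :: "real \<Rightarrow> real \<Rightarrow> (real \<Rightarrow> real) \<Rightarrow> bool" where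
  "node_density a b \<rho> \<longleftrightarrow>
     a < b \<and> real_analytic_on {a..b} \<rho> \<and> (\<forall>x\<in>{a..b}. 0 < \<rho> x) \<and> (LBINT x:{a..b}. \<rho> x) = 1"

definition nodes :: "real \<Rightarrow> real \<Rightarrow> (real \<Rightarrow> real) \<Rightarrow> (nat \<Rightarrow> nat \<Rightarrow> real) \<Rightarrow> bool" where
  "nodes a b \<rho> x \<longleftrightarrow>
     (\<forall>N. strict_mono_on {..<N} (x N) \<and>
       (\<forall>j<N. x N j \<in> {a<..<b} \<and>
              (LBINT t:{a..x N j}. \<rho> t) = (2 * real j + 1) / (2 * real N)))"

definition node_set :: "(nat \<Rightarrow> nat \<Rightarrow> real) \<Rightarrow> nat \<Rightarrow> real set" where
  "node_set x N = x N ` {..<N}"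

definition potentials ::
  "real \<Rightarrow> real \<Rightarrow> complex set \<Rightarrow> (complex \<Rightarrow> complex) \<Rightarrow> (nat \<Rightarrow> complex \<Rightarrow> complex) \<Rightarrow>
   real \<Rightarrow> (nat \<Rightarrow> complex \<Rightarrow> complex) \<Rightarrow> bool" where
  "potentials a b G V VN \<gamma> \<eta> \<longleftrightarrow>
     open G \<and> complex_of_real ` {a..b} \<subseteq> G \<and> real_analytic_in G V \<and>
     (\<forall>\<^sub>F N in sequentially. real_analytic_in G (VN N) \<and>
        (\<forall>z\<in>G. VN N z = V z + of_real \<gamma> / of_nat N + \<eta> N z / (of_nat N)\<^sup>2)) \<and>
     limsup (\<lambda>N. SUP z\<in>G. ereal (cmod (\<eta> N z))) < \<infinity>"

(* A function of the position y rather than of the index of a node; for y = x N j the product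
   omits exactly n = j, the nodes being distinct. *)
definition weight ::
  "(nat \<Rightarrow> nat \<Rightarrow> real) \<Rightarrow> (nat \<Rightarrow> complex \<Rightarrow> complex) \<Rightarrow> nat \<Rightarrow> real \<Rightarrow> real" where
  "weight x VN N y =
     exp (- real N * Re (VN N (complex_of_real y))) *
     (\<Prod>u\<in>node_set x N - {y}. inverse \<bar>y - u\<bar>)"

definition orthonormal_polys ::
  "(nat \<Rightarrow> nat \<Rightarrow> real) \<Rightarrow> (nat \<Rightarrow> complex \<Rightarrow> complex) \<Rightarrow> (nat \<Rightarrow> nat \<Rightarrow> real poly) \<Rightarrow> bool" where
  "orthonormal_polys x VN p \<longleftrightarrow>
     (\<forall>N. \<forall>k<N. degree (p N k) = k \<and> 0 < lead_coeff (p N k) \<and>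
        (\<forall>l<N. (\<Sum>j<N. poly (p N k) (x N j) * poly (p N l) (x N j) * weight x VN N (x N j))
               = (if k = l then 1 else 0)))"

definition reproducing_kernel ::
  "(nat \<Rightarrow> nat \<Rightarrow> real) \<Rightarrow> (nat \<Rightarrow> complex \<Rightarrow> complex) \<Rightarrow> (nat \<Rightarrow> nat \<Rightarrow> real poly) \<Rightarrow>
   nat \<Rightarrow> nat \<Rightarrow> real \<Rightarrow> real \<Rightarrow> real" where
  "reproducing_kernel x VN p N k y z =
     sqrt (weight x VN N y * weight x VN N z) * (\<Sum>n<k. poly (p N n) y * poly (p N n) z)"

(* In this and the following integrals the integrand is log 0 at a single point only, a null set
   for all the measures involved, so the library value of ln 0 does not matter. *)
definition external_field ::
  "real \<Rightarrow> real \<Rightarrow> (real \<Rightarrow> real) \<Rightarrow> (complex \<Rightarrow> complex) \<Rightarrow> real \<Rightarrow> real" where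
  "external_field a b \<rho> V x =
     Re (V (complex_of_real x)) + (LBINT y:{a..b}. ln \<bar>x - y\<bar> * \<rho> y)"

definition admissible :: "real \<Rightarrow> real \<Rightarrow> (real \<Rightarrow> real) \<Rightarrow> real \<Rightarrow> real measure \<Rightarrow> bool" where
  "admissible a b \<rho> c \<mu> \<longleftrightarrow>
     sets \<mu> = sets (restrict_space borel {a..b}) \<and>
     emeasure \<mu> {a..b} = 1 \<and>
     (\<forall>B\<in>sets \<mu>. measure \<mu> B \<le> (1 / c) * (LBINT x:B. \<rho> x))"

definition energy ::
  "real \<Rightarrow> real \<Rightarrow> (real \<Rightarrow> real) \<Rightarrow> (complex \<Rightarrow> complex) \<Rightarrow> real \<Rightarrow> real measure \<Rightarrow> real" where
  "energy a b \<rho> V c \<mu> =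
     c * (\<integral>x. (\<integral>y. ln (1 / \<bar>x - y\<bar>) \<partial>\<mu>) \<partial>\<mu>) + (\<integral>x. external_field a b \<rho> V x \<partial>\<mu>)"

definition equilibrium_measure ::
  "real \<Rightarrow> real \<Rightarrow> (real \<Rightarrow> real) \<Rightarrow> (complex \<Rightarrow> complex) \<Rightarrow> real \<Rightarrow> real measure \<Rightarrow> bool" where
  "equilibrium_measure a b \<rho> V c \<mu> \<longleftrightarrow>
     admissible a b \<rho> c \<mu> \<and>
     (\<forall>\<nu>. admissible a b \<rho> c \<nu> \<longrightarrow> energy a b \<rho> V c \<mu> \<le> energy a b \<rho> V c \<nu>)"

(* Nonnegativity is stated because ennreal truncates negative numbers to 0; the values of d at
   a and b are irrelevant. *)
definition continuous_density :: "real \<Rightarrow> real \<Rightarrow> real measure \<Rightarrow> (real \<Rightarrow> real) \<Rightarrow> bool" where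
  "continuous_density a b \<mu> d \<longleftrightarrow>
     continuous_on {a<..<b} d \<and> (\<forall>x\<in>{a<..<b}. 0 \<le> d x) \<and>
     \<mu> = density (restrict_space lborel {a..b}) (\<lambda>x. ennreal (d x))"

definition variational_derivative ::
  "real \<Rightarrow> real \<Rightarrow> (real \<Rightarrow> real) \<Rightarrow> (complex \<Rightarrow> complex) \<Rightarrow> real \<Rightarrow> real measure \<Rightarrow> real \<Rightarrow> real" where
  "variational_derivative a b \<rho> V c \<mu> x =
     - 2 * c * (\<integral>y. ln \<bar>x - y\<bar> \<partial>\<mu>) + external_field a b \<rho> V x"

(* The density is only given on the open interval, so the closure decides whether an endpoint
   a or b belongs to one of these sets; in the open interval it adds no points. *)
definition lower_set :: "real \<Rightarrow> real \<Rightarrow> (real \<Rightarrow> real) \<Rightarrow> real set" where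
  "lower_set a b d = closure {x\<in>{a<..<b}. d x = 0}"

definition upper_set ::
  "real \<Rightarrow> real \<Rightarrow> (real \<Rightarrow> real) \<Rightarrow> real \<Rightarrow> (real \<Rightarrow> real) \<Rightarrow> real set" where
  "upper_set a b \<rho> c d = closure {x\<in>{a<..<b}. d x = \<rho> x / c}"

definition open_subinterval :: "real \<Rightarrow> real \<Rightarrow> real set \<Rightarrow> bool" where
  "open_subinterval a b I \<longleftrightarrow> (\<exists>u v. a \<le> u \<and> u < v \<and> v \<le> b \<and> I = {u<..<v})"

definition maximal_open_subinterval ::
  "real \<Rightarrow> real \<Rightarrow> (real set \<Rightarrow> bool) \<Rightarrow> real set \<Rightarrow> bool" where
  "maximal_open_subinterval a b P I \<longleftrightarrow>
     open_subinterval a b I \<and> P I \<and>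
     (\<forall>J. open_subinterval a b J \<and> P J \<and> I \<subseteq> J \<longrightarrow> J = I)"

definition is_void :: "real \<Rightarrow> real \<Rightarrow> real measure \<Rightarrow> real set \<Rightarrow> bool" where
  "is_void a b \<mu> = maximal_open_subinterval a b (\<lambda>I. emeasure \<mu> I = 0)"

definition is_band ::
  "real \<Rightarrow> real \<Rightarrow> (real \<Rightarrow> real) \<Rightarrow> real \<Rightarrow> (real \<Rightarrow> real) \<Rightarrow> real set \<Rightarrow> bool" where
  "is_band a b \<rho> c d =
     maximal_open_subinterval a b
       (\<lambda>I. (\<forall>x\<in>I. 0 < d x \<and> d x < \<rho> x / c) \<and> real_analytic_on I d)"

definition is_saturated_region ::
  "real \<Rightarrow> real \<Rightarrow> (real \<Rightarrow> real) \<Rightarrow> real \<Rightarrow> (real \<Rightarrow> real) \<Rightarrow> real set \<Rightarrow> bool" where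
  "is_saturated_region a b \<rho> c d = maximal_open_subinterval a b (\<lambda>I. \<forall>x\<in>I. d x = \<rho> x / c)"

(* The equality on the bands determines l: a band exists since neither d = 0 nor d = rho / c
   has total mass 1 when 0 < c < 1. *)
definition lagrange_multiplier ::
  "real \<Rightarrow> real \<Rightarrow> (real \<Rightarrow> real) \<Rightarrow> (complex \<Rightarrow> complex) \<Rightarrow> real \<Rightarrow> real measure \<Rightarrow>
   (real \<Rightarrow> real) \<Rightarrow> real \<Rightarrow> bool" where
  "lagrange_multiplier a b \<rho> V c \<mu> d l \<longleftrightarrow>
     (\<forall>I. is_void a b \<mu> I \<longrightarrow> (\<forall>x\<in>I. variational_derivative a b \<rho> V c \<mu> x > l)) \<and>
     (\<forall>I. is_band a b \<rho> c d I \<longrightarrow> (\<forall>x\<in>I. variational_derivative a b \<rho> V c \<mu> x = l)) \<and>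
     (\<forall>I. is_saturated_region a b \<rho> c d I \<longrightarrow>
          (\<forall>x\<in>I. variational_derivative a b \<rho> V c \<mu> x < l))"

definition nondegenerate_components :: "real set \<Rightarrow> bool" where
  "nondegenerate_components S \<longleftrightarrow>
     finite (components S) \<and> (\<forall>C\<in>components S. interior C \<noteq> {})"

definition square_root_vanishing :: "real set \<Rightarrow> real \<Rightarrow> (real \<Rightarrow> real) \<Rightarrow> bool" where
  "square_root_vanishing I z f \<longleftrightarrow>
     (\<exists>L>0. ((\<lambda>x. \<bar>x - z\<bar> powr (-1/2) * f x) \<longlongrightarrow> L) (at z within I))"

definition regular_density ::
  "real \<Rightarrow> real \<Rightarrow> (real \<Rightarrow> real) \<Rightarrow> real \<Rightarrow> (real \<Rightarrow> real) \<Rightarrow> bool" where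
  "regular_density a b \<rho> c d \<longleftrightarrow>
     nondegenerate_components (lower_set a b d) \<and>
     nondegenerate_components (upper_set a b \<rho> c d) \<and>
     (\<forall>I. open_subinterval a b I \<and> I \<inter> (lower_set a b d \<union> upper_set a b \<rho> c d) = {} \<longrightarrow>
        (\<forall>z\<in>lower_set a b d. z islimpt I \<longrightarrow> square_root_vanishing I z d) \<and>
        (\<forall>z\<in>upper_set a b \<rho> c d. z islimpt I \<longrightarrow>
           square_root_vanishing I z (\<lambda>x. \<rho> x / c - d x))) \<and>
     {a, b} \<subseteq> lower_set a b d \<union> upper_set a b \<rho> c d"

end

theory Submission
  imports Defs "HOL-Complex_Analysis.Complex_Analysis" "HOL-Real_Asymp.Real_Asymp"
begin

text \<open>
  The matrix of \<open>K\<^sub>N\<^sub>,\<^sub>k\<close> on the nodes is the orthogonal projection \<open>P\<close> onto the vectors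
  \<open>u\<^sub>i = sqrt (w\<^sub>i) q(x\<^sub>i)\<close> with \<open>deg q < k\<close>. Since \<open>P u = u\<close> and \<open>P\<^sup>2 = P\<close>, any such \<open>u\<close> that is
  concentrated at the node \<open>x\<^sub>j\<close> bounds both \<open>1 - P\<^sub>j\<^sub>j\<close> and the off-diagonal entries \<open>P\<^sub>j\<^sub>i\<close>.
  Cut \<open>[a, b]\<close> into cells of \<open>\<rho>\<close>-mass \<open>1 / N\<close>, one around each node, and choose the nodes in whose cell
  the integer part of \<open>N c \<mu>([a, t])\<close> jumps: this gives exactly \<open>k\<close> nodes, among them all nodes with a
  saturated cell, and they discretise \<open>c \<mu>\<close> with discrepancy at most 1. Let \<open>q\<close> vanish at the chosen
  nodes other than \<open>x\<^sub>j\<close>. By Koksma's inequality \<open>ln (u\<^sub>n\<^sup>2)\<close> is, up to a constant, \<open>- N \<delta>E/\<delta>\<mu> (x\<^sub>n) + o(N)\<close> at \<open>x\<^sub>j\<close> and at the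
  nodes that were not chosen. There \<open>\<delta>E/\<delta>\<mu> \<ge> l - o(1)\<close>, because the cell contains an
  unsaturated point, whereas \<open>\<delta>E/\<delta>\<mu> < l\<close> on \<open>F\<close>.
  The inequality \<open>\<delta>E/\<delta>\<mu> \<ge> l\<close> at unsaturated points follows from minimality of the energy by moving mass
  from a point with \<open>0 < d < \<rho> / c\<close>; that such a point lies in a band, where \<open>\<delta>E/\<delta>\<mu> = l\<close>, requires
  real analyticity of \<open>d\<close>, which Schwarz reflection provides.
\<close>

section \<open>Projections and spans of polynomials\<close>

text \<open>Why \<delta>E/\<delta>\<mu> is the exponent: at a node the product in the weight
  contributes -N times the logarithmic potential of \<rho>, the square of q contributes 2 N c times
  that of \<mu>, and the exponential factor contributes -N V up to a constant. The obstacle is the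
  singularity of the logarithm at the node itself. All densities are bounded, so an inverse square
  root is an integrable majorant; it gives continuity of the potentials and a loss of only O(sqrt N)
  from the cell of the node. On either side of that cell the logarithm is monotone and O(log N),
  which is what Koksma's inequality needs. That exactly k nodes are chosen rests on c N = k: the
  total N c is an integer, so nothing is lost by rounding at b. The equality that fixes l is assumed
  on bands only, and a band must have an analytic density. Hence l cannot be compared with
  \<delta>E/\<delta>\<mu> at unsaturated points before analyticity has been derived from the
  constancy of \<delta>E/\<delta>\<mu>.\<close>

lemma projection_idem:
  fixes v :: "nat \<Rightarrow> nat \<Rightarrow> real"
  assumes on: "\<And>m n. m < k \<Longrightarrow> n < k \<Longrightarrow> (\<Sum>i<N. v m i * v n i) = (if m = n then 1 else 0)"
  shows "(\<Sum>i<N. (\<Sum>n<k. v n j * v n i) * (\<Sum>n<k. c n * v n i)) = (\<Sum>n<k. c n * v n j)"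
proof -
  have "(\<Sum>i<N. (\<Sum>n<k. v n j * v n i) * (\<Sum>n<k. c n * v n i)) =
        (\<Sum>i<N. \<Sum>n<k. \<Sum>m<k. v n j * c m * (v n i * v m i))"
    unfolding sum_product by (intro sum.cong refl) (simp add: mult_ac)
  also have "\<dots> = (\<Sum>n<k. \<Sum>i<N. \<Sum>m<k. v n j * c m * (v n i * v m i))"
    by (rule sum.swap)
  also have "\<dots> = (\<Sum>n<k. \<Sum>m<k. \<Sum>i<N. v n j * c m * (v n i * v m i))"
    by (intro sum.cong refl sum.swap)
  also have "\<dots> = (\<Sum>n<k. \<Sum>m<k. v n j * c m * (if n = m then 1 else 0))"
    by (intro sum.cong refl) (simp add: sum_distrib_left[symmetric] on)
  also have "\<dots> = (\<Sum>n<k. v n j * c n)"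
    by (intro sum.cong refl) (simp add: if_distrib cong: if_cong)
  finally show ?thesis by (simp add: mult.commute)
qed

text \<open>Idempotence gives \<open>P j j\<close> as the sum of the squares of row
  \<open>j\<close>, which forces \<open>0 \<le> P j j \<le> 1\<close> and bounds every entry of the
  row by 1. Row \<open>j\<close> of \<open>P u = u\<close>, divided by \<open>u j\<close>, then
  yields \<open>1 - P j j \<le> e\<close>. The squares off the diagonal add up to
  \<open>P j j - (P j j)\<^sup>2\<close>, which is at most \<open>1 - P j j\<close>; hence the
  square root in the second bound.\<close>

lemma projection_near_identity:
  fixes v :: "nat \<Rightarrow> nat \<Rightarrow> real" and u c :: "nat \<Rightarrow> real" and k :: nat
  defines "P \<equiv> \<lambda>i j. \<Sum>n<k. v n i * v n j"
  assumes on: "\<And>m n. m < k \<Longrightarrow> n < k \<Longrightarrow> (\<Sum>i<N. v m i * v n i) = (if m = n then 1 else 0)"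
    and u: "\<And>i. i < N \<Longrightarrow> u i = (\<Sum>n<k. c n * v n i)"
    and j: "j < N" and uj: "u j \<noteq> 0"
    and e: "(\<Sum>i\<in>{..<N} - {j}. \<bar>u i / u j\<bar>) \<le> e"
  shows "\<bar>P j j - 1\<bar> \<le> e" and "i < N \<Longrightarrow> i \<noteq> j \<Longrightarrow> \<bar>P j i\<bar> \<le> sqrt e"
proof -
  have sym: "P i j = P j i" for i j by (simp add: P_def mult.commute)
  have sq: "(\<Sum>i<N. (P j i)\<^sup>2) = P j j"
  proof -
    have "(\<Sum>i<N. (P j i)\<^sup>2) = (\<Sum>i<N. (\<Sum>n<k. v n j * v n i) * (\<Sum>n<k. v n j * v n i))"
      by (simp add: P_def power2_eq_square)
    also have "\<dots> = P j j" by (subst projection_idem[OF on]) (auto simp: P_def)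
    finally show ?thesis .
  qed
  have split: "(P j j)\<^sup>2 + (\<Sum>i\<in>{..<N} - {j}. (P j i)\<^sup>2) = P j j"
    using sq j by (simp add: sum.remove[of "{..<N}" j])
  have le: "(P j i)\<^sup>2 \<le> P j j - (P j j)\<^sup>2" if "i < N" "i \<noteq> j" for i
  proof -
    have "(P j i)\<^sup>2 \<le> (\<Sum>i\<in>{..<N} - {j}. (P j i)\<^sup>2)"
      using that by (intro member_le_sum) auto
    with split show ?thesis by simp
  qed
  have nn: "(\<Sum>i\<in>{..<N} - {j}. (P j i)\<^sup>2) \<ge> 0" by (intro sum_nonneg) auto
  have Pj: "0 \<le> P j j" using sq by (metis sum_nonneg zero_le_power2)
  have Pj1: "P j j \<le> 1"
  proof (rule ccontr)
    assume "\<not> P j j \<le> 1"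
    then have "P j j * P j j > P j j * 1" by (intro mult_strict_left_mono) auto
    with split nn show False by (simp add: power2_eq_square)
  qed
  have P1: "\<bar>P j i\<bar> \<le> 1" if "i < N" "i \<noteq> j" for i
  proof -
    have "(P j i)\<^sup>2 \<le> 1" using le[OF that] Pj1 zero_le_power2[of "P j j"] by linarith
    then show ?thesis by (simp add: abs_square_le_1)
  qed
  have "u j = (\<Sum>i<N. P j i * u i)"
    using projection_idem[OF on, where c=c and j=j] by (simp add: P_def u j)
  also have "\<dots> = P j j * u j + (\<Sum>i\<in>{..<N} - {j}. P j i * u i)"
    using j by (simp add: sum.remove[of "{..<N}" j])
  finally have "(1 - P j j) * u j = (\<Sum>i\<in>{..<N} - {j}. P j i * u i)" by (simp add: algebra_simps)
  then have "1 - P j j = (\<Sum>i\<in>{..<N} - {j}. P j i * u i) / u j" using uj by (simp add: field_simps)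
  also have "\<dots> = (\<Sum>i\<in>{..<N} - {j}. P j i * (u i / u j))" by (simp add: sum_divide_distrib)
  also have "\<dots> \<le> (\<Sum>i\<in>{..<N} - {j}. \<bar>u i / u j\<bar>)"
  proof (intro sum_mono)
    fix i assume "i \<in> {..<N} - {j}"
    then have "\<bar>P j i\<bar> \<le> 1" using P1 by auto
    then have "\<bar>P j i * (u i / u j)\<bar> \<le> 1 * \<bar>u i / u j\<bar>"
      unfolding abs_mult by (intro mult_right_mono) auto
    then show "P j i * (u i / u j) \<le> \<bar>u i / u j\<bar>" by linarith
  qed
  finally have 1: "1 - P j j \<le> e" using e by linarith
  then show "\<bar>P j j - 1\<bar> \<le> e" using Pj1 by simp
  show "\<bar>P j i\<bar> \<le> sqrt e" if "i < N" "i \<noteq> j"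
  proof -
    have "0 \<le> (1 - P j j) * (1 - P j j)" by (rule zero_le_square)
    also have "\<dots> = (1 - P j j) - (P j j - (P j j)\<^sup>2)" by (simp add: algebra_simps power2_eq_square)
    finally have "P j j - (P j j)\<^sup>2 \<le> e" using 1 by simp
    with le[OF that] have "(P j i)\<^sup>2 \<le> e" by (rule order.trans)
    then show ?thesis by (simp add: real_le_rsqrt flip: real_sqrt_abs)
  qed
qed

text \<open>Subtracting a multiple of \<open>p k\<close> cancels the coefficient of degree
  \<open>k\<close>. The condition is put on coefficients instead of the degree so that
  \<open>k = 0\<close> and the zero polynomial need no separate treatment.\<close>

lemma poly_in_span_of_degrees:
  fixes p :: "nat \<Rightarrow> 'a::field poly"
  assumes "\<And>n. n < k \<Longrightarrow> degree (p n) = n \<and> lead_coeff (p n) \<noteq> 0"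
    and "\<And>i. i \<ge> k \<Longrightarrow> coeff q i = 0"
  shows "\<exists>c. q = (\<Sum>n<k. smult (c n) (p n))"
  using assms
proof (induction k arbitrary: q)
  case 0
  then have "q = 0" by (intro poly_eqI) simp
  then show ?case by simp
next
  case (Suc k)
  define a where "a = coeff q k / lead_coeff (p k)"
  have p: "degree (p k) = k" "coeff (p k) k \<noteq> 0"
    using Suc.prems(1)[of k] by (metis lessI)+
  have "coeff (q - smult a (p k)) i = 0" if "i \<ge> k" for i
    using Suc.prems(2)[of i] that p by (cases "i = k") (auto simp: a_def coeff_eq_0)
  then obtain c where c: "q - smult a (p k) = (\<Sum>n<k. smult (c n) (p n))"
    using Suc.IH[of "q - smult a (p k)"] Suc.prems(1) less_SucI by metis
  have "q = (\<Sum>n<Suc k. smult ((c(k := a)) n) (p n))"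
    using c by (simp add: algebra_simps)
  then show ?case by blast
qed

section \<open>The logarithmic kernel\<close>

text \<open>Since \<open>1 + u \<le> (1 + sqrt u)\<^sup>2\<close>, the logarithm of
  \<open>1 + u\<close> is at most \<open>2 * sqrt u\<close>. A Lipschitz estimate would leave the
  factor \<open>1 / s\<close>, which is not integrable at 0; giving up half of the exponent leaves
  \<open>1 / sqrt s\<close>, which is.\<close>

lemma abs_ln_diff_le:
  fixes s t :: real
  assumes "s > 0" "t > 0"
  shows "\<bar>ln s - ln t\<bar> \<le> 2 * sqrt \<bar>s - t\<bar> * (1 / sqrt s + 1 / sqrt t)"
proof -
  have *: "ln t - ln s \<le> 2 * sqrt \<bar>s - t\<bar> * (1 / sqrt s)" if "0 < s" "s \<le> t" for s t :: real
  proof -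
    define u where "u = (t - s) / s"
    have u: "u \<ge> 0" "t / s = 1 + u" using that by (auto simp: u_def field_simps)
    have "ln t - ln s = ln (1 + u)" using that u(2) ln_div[of t s] by simp
    also have "\<dots> \<le> ln ((1 + sqrt u)\<^sup>2)"
      using u by (subst ln_le_cancel_iff) (auto simp: power2_eq_square algebra_simps add_pos_nonneg)
    also have "\<dots> = 2 * ln (1 + sqrt u)" using u by (simp add: ln_realpow add_pos_nonneg)
    also have "\<dots> \<le> 2 * sqrt u" using ln_add_one_self_le_self[of "sqrt u"] u by simp
    also have "sqrt u = sqrt \<bar>s - t\<bar> * (1 / sqrt s)"
      using that by (simp add: u_def real_sqrt_divide)
    finally show ?thesis by simp
  qed
  have nn: "0 \<le> 2 * sqrt \<bar>s - t\<bar> * (1 / sqrt s)" "0 \<le> 2 * sqrt \<bar>s - t\<bar> * (1 / sqrt t)"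
    using assms by auto
  show ?thesis
  proof (cases "s \<le> t")
    case True
    then have "\<bar>ln s - ln t\<bar> \<le> 2 * sqrt \<bar>s - t\<bar> * (1 / sqrt s)" using assms *[of s t] by simp
    then show ?thesis using nn(2) unfolding distrib_left by (rule add_increasing2[rotated])
  next
    case False
    then have "\<bar>ln s - ln t\<bar> \<le> 2 * sqrt \<bar>s - t\<bar> * (1 / sqrt t)"
      using assms *[of t s] by (simp add: abs_minus_commute)
    then show ?thesis using nn(1) unfolding distrib_left by (rule add_increasing[rotated])
  qed
qed

lemma abs_ln_le:
  fixes t :: real
  assumes "t > 0"
  shows "\<bar>ln t\<bar> \<le> t + 2 / sqrt t"
proof (cases "t \<ge> 1")
  case True
  then have "\<bar>ln t\<bar> \<le> t" using ln_bound[of t] by simp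
  then show ?thesis using assms by (simp add: add_increasing2)
next
  case False
  have "- ln t = 2 * ln (1 / sqrt t)" using assms by (simp add: ln_div ln_sqrt)
  also have "\<dots> \<le> 2 * (1 / sqrt t)" using assms ln_bound[of "1 / sqrt t"] by simp
  finally show ?thesis using assms False ln_le_zero_iff[of t] by simp
qed

lemma inverse_sqrt_integral_half:
  fixes h :: real
  assumes "h > 0"
  shows "has_bochner_integral lborel (\<lambda>y. indicator {0<..<h} y * (1 / sqrt y)) (2 * sqrt h)"
proof -
  have lim: "(((\<lambda>x. 2 * sqrt x) \<circ> real_of_ereal) \<longlongrightarrow> 0) (at_right (ereal 0))"
    "(((\<lambda>x. 2 * sqrt x) \<circ> real_of_ereal) \<longlongrightarrow> 2 * sqrt h) (at_left (ereal h))"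
    unfolding ereal_tendsto_simps1 by (auto intro!: tendsto_eq_intros)
  have D: "((\<lambda>x. 2 * sqrt x) has_real_derivative 1 / sqrt x) (at x)" if "x > 0" for x
    using that by (auto intro!: derivative_eq_intros simp: field_simps)
  have "set_integrable lborel (einterval (ereal 0) (ereal h)) (\<lambda>y. 1 / sqrt y)"
    "(LBINT y=ereal 0..ereal h. 1 / sqrt y) = 2 * sqrt h - 0"
    by (rule interval_integral_FTC_nonneg[OF _ _ _ _ lim]; use assms D in \<open>auto intro!: continuous_intros\<close>)+
  then show ?thesis using assms
    by (simp add: has_bochner_integral_iff set_integrable_def interval_lebesgue_integral_def
        set_lebesgue_integral_def einterval_eq_Icc zero_ereal_def)
qed

lemma inverse_sqrt_integral:
  fixes h x :: real
  assumes "h > 0"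
  shows "has_bochner_integral lborel (\<lambda>y. indicator {x-h<..<x+h} y * (1 / sqrt \<bar>x - y\<bar>)) (4 * sqrt h)"
proof -
  let ?H = "\<lambda>y::real. indicator {0<..<h} y * (1 / sqrt y)"
  have half: "has_bochner_integral lborel ?H (2 * sqrt h)"
    by (rule inverse_sqrt_integral_half[OF assms])
  have 1: "has_bochner_integral lborel (\<lambda>y. ?H ((-x) + 1 * y)) (2 * sqrt h)"
    using lborel_has_bochner_integral_real_affine_iff[THEN iffD1, OF _ half, of 1 "-x"] by simp
  have 2: "has_bochner_integral lborel (\<lambda>y. ?H (x + (-1) * y)) (2 * sqrt h)"
    using lborel_has_bochner_integral_real_affine_iff[THEN iffD1, OF _ half, of "-1" x] by simp
  from has_bochner_integral_add[OF 1 2]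
  show ?thesis
    by (rule has_bochner_integral_cong[THEN iffD1, rotated -1]) (auto simp: indicator_def)
qed

text \<open>The integrand is at most 1 at distance at least 1 from \<open>x\<close>; the rest is the
  singular integral over radius 1, whose value is the 4. The bound does not depend on
  \<open>x\<close>.\<close>

lemma inverse_sqrt_integral_Icc:
  fixes a b x :: real
  assumes "a \<le> b"
  shows "integrable lborel (\<lambda>y. indicator {a..b} y * (1 / sqrt \<bar>x - y\<bar>))"
    "(\<integral>y. indicator {a..b} y * (1 / sqrt \<bar>x - y\<bar>) \<partial>lborel) \<le> b - a + 4"
proof -
  let ?g = "\<lambda>y. indicator {a..b} y + indicator {x-1<..<x+1} y * (1 / sqrt \<bar>x - y\<bar>)"
  have g: "has_bochner_integral lborel ?g (b - a + 4)"
    using has_bochner_integral_add[OF _ inverse_sqrt_integral[of 1 x]]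
      has_bochner_integral_real_indicator[of "{a..b}" lborel] assms by auto
  have le: "indicator {a..b} y * (1 / sqrt \<bar>x - y\<bar>) \<le> ?g y" for y
    by (auto simp: indicator_def real_le_rsqrt split: if_splits)
  show i: "integrable lborel (\<lambda>y. indicator {a..b} y * (1 / sqrt \<bar>x - y\<bar>))"
    by (rule Bochner_Integration.integrable_bound[OF integrable.intros[OF g]])
       (use le in \<open>auto simp: indicator_def\<close>)
  show "(\<integral>y. indicator {a..b} y * (1 / sqrt \<bar>x - y\<bar>) \<partial>lborel) \<le> b - a + 4"
  proof -
    have "(\<integral>y. indicator {a..b} y * (1 / sqrt \<bar>x - y\<bar>) \<partial>lborel) \<le> integral\<^sup>L lborel ?g"
      by (intro integral_mono i integrable.intros[OF g] le)
    then show ?thesis by (simp only: has_bochner_integral_integral_eq[OF g])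
  qed
qed

lemma integrable_indicator_Icc: "integrable lborel (indicat_real {a..b::real})"
  by (rule integrable_real_indicator) (auto simp: emeasure_lborel_Icc_eq)

text \<open>The indicator in the bound encodes the support as well. The sign is left free because
  differences of densities occur, both as perturbations and as the density behind
  \<open>dE\<close>.\<close>

definition bounded_density :: "real \<Rightarrow> real \<Rightarrow> real \<Rightarrow> (real \<Rightarrow> real) \<Rightarrow> bool" where
  "bounded_density a b C e \<longleftrightarrow>
     e \<in> borel_measurable borel \<and> (\<forall>y. \<bar>e y\<bar> \<le> C * indicator {a..b} y)"

lemma bounded_densityD:
  assumes "bounded_density a b C e"
  shows "e \<in> borel_measurable borel" "\<bar>e y\<bar> \<le> C * indicator {a..b} y" "y \<notin> {a..b} \<Longrightarrow> e y = 0"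
proof -
  show "e \<in> borel_measurable borel" "\<bar>e y\<bar> \<le> C * indicator {a..b} y"
    using assms by (auto simp: bounded_density_def)
  then show "y \<notin> {a..b} \<Longrightarrow> e y = 0" by (auto simp: indicator_def)
qed

lemma bounded_density_integrable:
  assumes "bounded_density a b C e"
  shows "integrable lborel e"
  by (rule Bochner_Integration.integrable_bound[of _ "\<lambda>y. C * indicator {a..b} y"])
     (use bounded_densityD[OF assms] integrable_indicator_Icc in \<open>auto simp: order.trans[OF _ abs_ge_self]\<close>)

text \<open>The distance from \<open>z\<close> to a real point is at least the horizontal one, so
  the singularity is dominated uniformly in the imaginary part. The point \<open>y = Re z\<close> is
  excluded since \<open>1 / sqrt 0\<close> is 0 and would give no bound there.\<close>

lemma log_kernel_bound:
  fixes z :: complex and y :: real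
  assumes "y \<noteq> Re z" "y \<in> {a..b}"
  shows "\<bar>ln (cmod (z - of_real y))\<bar> \<le> cmod z + \<bar>a\<bar> + \<bar>b\<bar> + 2 * (1 / sqrt \<bar>Re z - y\<bar>)"
proof -
  have r: "\<bar>Re z - y\<bar> \<le> cmod (z - of_real y)" using abs_Re_le_cmod[of "z - of_real y"] by simp
  then have pos: "cmod (z - of_real y) > 0" using assms(1) by linarith
  have "1 / sqrt (cmod (z - of_real y)) \<le> 1 / sqrt \<bar>Re z - y\<bar>"
    using assms(1) r pos by (intro divide_left_mono mult_pos_pos) auto
  moreover have "cmod (z - of_real y) \<le> cmod z + (\<bar>a\<bar> + \<bar>b\<bar>)"
  proof -
    have "cmod (z - of_real y) \<le> cmod z + cmod (of_real y)" by (rule norm_triangle_ineq4)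
    also have "cmod (of_real y) \<le> \<bar>a\<bar> + \<bar>b\<bar>" using assms(2) by auto
    finally show ?thesis by simp
  qed
  ultimately show ?thesis using abs_ln_le[OF pos] by simp
qed

lemma log_potential_integrable:
  assumes "bounded_density a b C e" "a \<le> b"
  shows "integrable lborel (\<lambda>y. ln (cmod (z - of_real y)) * e y)"
proof -
  note e = bounded_densityD[OF assms(1)]
  note [measurable] = e(1)
  let ?K = "cmod z + \<bar>a\<bar> + \<bar>b\<bar>"
  let ?g = "\<lambda>y. C * (?K * indicator {a..b} y + 2 * (indicator {a..b} y * (1 / sqrt \<bar>Re z - y\<bar>)))"
  have "integrable lborel ?g"
    by (intro integrable_mult_right Bochner_Integration.integrable_add integrable_indicator_Icc
        inverse_sqrt_integral_Icc(1)[OF assms(2), of "Re z"])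
  then show ?thesis
  proof (rule Bochner_Integration.integrable_bound)
    show "AE y in lborel. norm (ln (cmod (z - of_real y)) * e y) \<le> norm (?g y)"
      using AE_lborel_singleton[of "Re z"]
    proof eventually_elim
      case (elim y)
      show ?case
      proof (cases "y \<in> {a..b}")
        case True
        have "\<bar>ln (cmod (z - of_real y))\<bar> * \<bar>e y\<bar> \<le> (?K + 2 * (1 / sqrt \<bar>Re z - y\<bar>)) * C"
          using log_kernel_bound[OF elim True] e(2)[of y] True by (intro mult_mono) auto
        then show ?thesis using True by (simp add: abs_mult mult.commute order.trans[OF _ abs_ge_self] flip: abs_mult)
      qed (simp add: e(3))
    qed
  qed measurable
qed

text \<open>The pointwise estimate of \<open>abs_ln_diff_le\<close> is integrated; the two
  singularities, at \<open>Re z\<close> and at \<open>Re w\<close>, each cost at most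
  \<open>b - a + 4\<close>. Complex arguments are allowed because the same estimate serves the
  potentials on the real line and the boundary behaviour from the upper half-plane.\<close>

lemma log_potential_holder:
  assumes "bounded_density a b C e" "a \<le> b"
  shows "\<bar>(\<integral>y. ln (cmod (z - of_real y)) * e y \<partial>lborel) - (\<integral>y. ln (cmod (w - of_real y)) * e y \<partial>lborel)\<bar>
    \<le> 4 * C * (b - a + 4) * sqrt (cmod (z - w))"
proof -
  note e = bounded_densityD[OF assms(1)]
  note [measurable] = e(1)
  have C: "C \<ge> 0" using e(2)[of a] assms(2) by simp
  let ?f = "\<lambda>z y. indicator {a..b} y * (1 / sqrt \<bar>Re z - y\<bar>)"
  let ?g = "\<lambda>y. 2 * C * sqrt (cmod (z - w)) * (?f z y + ?f w y)"
  note i = inverse_sqrt_integral_Icc[OF assms(2), of "Re z"] inverse_sqrt_integral_Icc[OF assms(2), of "Re w"]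
  have gi: "integrable lborel ?g" using i by auto
  have AE: "AE y in lborel. norm ((ln (cmod (z - of_real y)) - ln (cmod (w - of_real y))) * e y) \<le> ?g y"
    using AE_lborel_singleton[of "Re z"] AE_lborel_singleton[of "Re w"]
  proof eventually_elim
    case (elim y)
    show ?case
    proof (cases "y \<in> {a..b}")
      case True
      define s t where "s = cmod (z - of_real y)" and "t = cmod (w - of_real y)"
      have s: "\<bar>Re z - y\<bar> \<le> s" "\<bar>Re w - y\<bar> \<le> t"
        using abs_Re_le_cmod[of "z - of_real y"] abs_Re_le_cmod[of "w - of_real y"] by (simp_all add: s_def t_def)
      have st: "\<bar>s - t\<bar> \<le> cmod (z - w)"
        using norm_triangle_ineq3[of "z - of_real y" "w - of_real y"] by (simp add: s_def t_def)
      have "\<bar>ln s - ln t\<bar> \<le> 2 * sqrt \<bar>s - t\<bar> * (1 / sqrt s + 1 / sqrt t)"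
        using s elim by (intro abs_ln_diff_le) linarith+
      also have "\<dots> \<le> 2 * sqrt (cmod (z - w)) * (1 / sqrt \<bar>Re z - y\<bar> + 1 / sqrt \<bar>Re w - y\<bar>)"
        using s st elim by (intro mult_mono add_mono divide_left_mono) auto
      finally have "\<bar>ln s - ln t\<bar> * \<bar>e y\<bar> \<le> 2 * sqrt (cmod (z - w)) * (1 / sqrt \<bar>Re z - y\<bar> + 1 / sqrt \<bar>Re w - y\<bar>) * C"
        using e(2)[of y] True by (intro mult_mono) auto
      also have "\<dots> = ?g y" using True by simp
      finally show ?thesis by (simp only: abs_mult s_def t_def real_norm_def)
    qed (simp add: e(3))
  qed
  have "(\<integral>y. ln (cmod (z - of_real y)) * e y \<partial>lborel) - (\<integral>y. ln (cmod (w - of_real y)) * e y \<partial>lborel)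
     = (\<integral>y. (ln (cmod (z - of_real y)) - ln (cmod (w - of_real y))) * e y \<partial>lborel)"
    by (simp add: left_diff_distrib log_potential_integrable[OF assms])
  also have "norm \<dots> \<le> (\<integral>y. norm ((ln (cmod (z - of_real y)) - ln (cmod (w - of_real y))) * e y) \<partial>lborel)"
    by (rule integral_norm_bound)
  also have "\<dots> \<le> (\<integral>y. ?g y \<partial>lborel)"
  proof (rule integral_mono_AE[OF _ gi AE])
    show "integrable lborel (\<lambda>y. norm ((ln (cmod (z - of_real y)) - ln (cmod (w - of_real y))) * e y))"
      using log_potential_integrable[OF assms] by (simp add: left_diff_distrib)
  qed
  also have "\<dots> = 2 * C * sqrt (cmod (z - w)) * ((\<integral>y. ?f z y \<partial>lborel) + (\<integral>y. ?f w y \<partial>lborel))"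
    using i by simp
  also have "\<dots> \<le> 2 * C * sqrt (cmod (z - w)) * ((b - a + 4) + (b - a + 4))"
    using i C by (intro mult_left_mono add_mono) auto
  finally show ?thesis by (simp add: algebra_simps)
qed

section \<open>Koksma's inequality\<close>

text \<open>Half-open intervals partition exactly, so masses of adjacent intervals add without
  discarding null sets.\<close>

definition mass :: "(real \<Rightarrow> real) \<Rightarrow> real \<Rightarrow> real \<Rightarrow> real" where
  "mass f s t = (\<integral>y. indicator {s<..t} y * f y \<partial>lborel)"

lemma integrable_indicator_mult:
  fixes f :: "'a \<Rightarrow> real"
  assumes "integrable M f" "S \<in> sets M"
  shows "integrable M (\<lambda>y. indicator S y * f y)"
  using integrable_mult_indicator[OF assms(2,1)] by simp

lemma mass_add:
  assumes "integrable lborel f" "r \<le> s" "s \<le> t"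
  shows "mass f r t = mass f r s + mass f s t"
proof -
  have "mass f r t = (\<integral>y. indicator {r<..s} y * f y + indicator {s<..t} y * f y \<partial>lborel)"
    unfolding mass_def using assms(2,3) by (intro Bochner_Integration.integral_cong) (auto simp: indicator_def)
  then show ?thesis
    unfolding mass_def by (simp add: Bochner_Integration.integral_add integrable_indicator_mult assms(1))
qed

lemma mass_mono:
  assumes "integrable lborel f" "integrable lborel g" "\<And>y. y \<in> {s<..<t} \<Longrightarrow> f y \<le> g y"
  shows "mass f s t \<le> mass g s t"
  unfolding mass_def
proof (intro integral_mono_AE integrable_indicator_mult assms(1,2))
  show "AE y in lborel. indicator {s<..t} y * f y \<le> indicator {s<..t} y * g y"
    using AE_lborel_singleton[of t] by eventually_elim (auto simp: indicator_def assms(3))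
qed auto

lemma mass_nonneg:
  assumes "\<And>y. y \<in> {s<..t} \<Longrightarrow> 0 \<le> f y"
  shows "0 \<le> mass f s t"
  unfolding mass_def by (intro integral_nonneg_AE AE_I2) (auto simp: indicator_def assms)

lemma mass_cmult: "mass (\<lambda>y. c * f y) s t = c * mass f s t"
  by (simp add: mass_def mult.left_commute[of _ c])

lemma mass_refl [simp]: "mass f s s = 0"
  by (simp add: mass_def)

lemma mass_const: "s \<le> t \<Longrightarrow> mass (\<lambda>_. c) s t = c * (t - s)"
  by (simp add: mass_def)

lemma mass_cong:
  assumes "\<And>y. y \<in> {s<..t} \<Longrightarrow> f y = g y"
  shows "mass f s t = mass g s t"
  unfolding mass_def by (intro Bochner_Integration.integral_cong) (auto simp: indicator_def assms)

lemma mass_mono_bounds: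
  assumes "integrable lborel f" "s \<le> t" "\<And>y. y \<in> {s<..<t} \<Longrightarrow> m \<le> f y \<and> f y \<le> M"
  shows "m * (t - s) \<le> mass f s t" "mass f s t \<le> M * (t - s)"
proof -
  have eq: "mass (\<lambda>y. indicator {s<..t} y * c) s t = c * (t - s)" for c :: real
    using mass_const[OF assms(2), of c] by (subst mass_cong[of s t _ "\<lambda>_. c"]) auto
  have i: "integrable lborel (\<lambda>y. indicator {s<..t} y * c)" for c :: real
    by (intro integrable_mult_left integrable_real_indicator) (use assms(2) in auto)
  have "mass (\<lambda>y. indicator {s<..t} y * m) s t \<le> mass f s t"
    "mass f s t \<le> mass (\<lambda>y. indicator {s<..t} y * M) s t"
    by (intro mass_mono assms(1) i; use assms(3) in auto)+
  then show "m * (t - s) \<le> mass f s t" "mass f s t \<le> M * (t - s)"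
    by (simp_all add: eq)
qed

text \<open>Here \<open>A i\<close> is the number of sampling points before \<open>r i\<close>, so \<open>A - B\<close> is the discrepancy.\<close>

lemma koksma_monotone:
  fixes f g :: "real \<Rightarrow> real" and r x A :: "nat \<Rightarrow> real" and K a :: real
  defines "B \<equiv> \<lambda>i. K * mass f a (r i)"
  assumes f: "integrable lborel f" "\<And>y. 0 \<le> f y" and K: "K \<ge> 0"
    and g: "mono_on {r m..r n} g" "g \<in> borel_measurable borel" "\<And>y. y \<in> {r m..r n} \<Longrightarrow> \<bar>g y\<bar> \<le> L"
    and r: "\<And>i. m \<le> i \<Longrightarrow> i < n \<Longrightarrow> r i \<le> x i \<and> x i \<le> r (Suc i)" "a \<le> r m"
    and AB: "\<And>i. m \<le> i \<Longrightarrow> i \<le> n \<Longrightarrow> \<bar>A i - B i\<bar> \<le> 1"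
    and A: "\<And>i. m \<le> i \<Longrightarrow> i < n \<Longrightarrow> \<bar>A (Suc i) - A i\<bar> \<le> 1"
    and B: "\<And>i. m \<le> i \<Longrightarrow> i < n \<Longrightarrow> B (Suc i) - B i \<le> 1"
    and mn: "m \<le> n"
  shows "\<bar>(\<Sum>i=m..<n. (A (Suc i) - A i) * g (x i)) - K * mass (\<lambda>y. g y * f y) (r m) (r n)\<bar> \<le> 8 * L"
proof -
  have r_mono: "r i \<le> r j" if "m \<le> i" "i \<le> j" "j \<le> n" for i j
    using that(2,1,3)
  proof (induction j rule: dec_induct)
    case (step j)
    then show ?case using r(1)[of j] by force
  qed simp
  have gmono: "g y \<le> g z" if "r m \<le> y" "y \<le> z" "z \<le> r n" for y z
    using mono_onD[OF g(1), of y z] that by auto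
  have gf: "integrable lborel (\<lambda>y. indicator {s<..t} y * (g y * f y))" if "r m \<le> s" "t \<le> r n" for s t
  proof (rule Bochner_Integration.integrable_bound[of _ "\<lambda>y. L * f y"])
    show "AE y in lborel. norm (indicator {s<..t} y * (g y * f y)) \<le> norm (L * f y)"
    proof (rule AE_I2)
      fix y
      show "norm (indicator {s<..t} y * (g y * f y)) \<le> norm (L * f y)"
      proof (cases "y \<in> {s<..t}")
        case True
        then have "\<bar>g y\<bar> \<le> L" using that by (intro g(3)) auto
        then have "\<bar>g y\<bar> \<le> \<bar>L\<bar>" by simp
        then show ?thesis using True f(2)[of y] by (simp add: abs_mult mult_right_mono)
      qed simp
    qed
  qed (use f g(2) in \<open>auto\<close>)
  let ?S = "\<lambda>k. (\<Sum>i=m..<k. (A (Suc i) - A i) * g (x i)) - K * mass (\<lambda>y. g y * f y) (r m) (r k)"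
  let ?D = "\<lambda>i. A i - B i"
  \<comment> \<open>Summation by parts as an invariant: with the boundary terms of the discrepancy
    included, passing to the next cell adds only three terms, each bounded by the increment of
    \<open>g\<close> over that cell. They come from the position of \<open>x k\<close> in the cell,
    from the variation of \<open>g\<close> under the integral, and from the discrepancy. By
    monotonicity the increments telescope.\<close>
  have "\<bar>?S k - ?D k * g (r k) + ?D m * g (r m)\<bar> \<le> 3 * (g (r k) - g (r m))" if "m \<le> k" "k \<le> n" for k
    using that
  proof (induction k rule: dec_induct)
    case base
    then show ?case by simp
  next
    case (step k)
    define \<Delta> where "\<Delta> = g (r (Suc k)) - g (r k)"
    define I where "I = K * mass (\<lambda>y. g y * f y) (r k) (r (Suc k))"
    define \<alpha> where "\<alpha> = A (Suc k) - A k"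
    define \<beta> where "\<beta> = B (Suc k) - B k"
    define \<xi> where "\<xi> = g (x k) - g (r k)"
    have k: "m \<le> k" "k < n" using step by auto
    have rk: "r m \<le> r k" "r k \<le> x k" "x k \<le> r (Suc k)" "r (Suc k) \<le> r n"
      using r(1)[OF k] r_mono[of m k] r_mono[of "Suc k" n] k by auto
    have \<beta>: "\<beta> = K * mass f (r k) (r (Suc k))"
      unfolding \<beta>_def B_def using rk r(2) by (subst mass_add[OF f(1), of a "r k" "r (Suc k)"]) (auto simp: algebra_simps)
    have \<beta>01: "0 \<le> \<beta>" "\<beta> \<le> 1"
      using \<beta> K B[OF k] by (simp_all add: mass_nonneg f(2) \<beta>_def[symmetric])
    have \<Delta>0: "0 \<le> \<Delta>" using rk by (simp add: \<Delta>_def gmono)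
    have \<xi>: "0 \<le> \<xi>" "\<xi> \<le> \<Delta>" using rk by (simp_all add: \<Delta>_def \<xi>_def gmono)
    have \<alpha>: "\<bar>\<alpha>\<bar> \<le> 1" using A[OF k] by (simp add: \<alpha>_def)
    have D: "\<bar>?D (Suc k)\<bar> \<le> 1" using AB[of "Suc k"] k by simp
    have "mass (\<lambda>y. g (r k) * f y) (r k) (r (Suc k)) \<le> mass (\<lambda>y. g y * f y) (r k) (r (Suc k))"
      unfolding mass_def
    proof (rule integral_mono)
      show "integrable lborel (\<lambda>y. indicat_real {r k<..r (Suc k)} y * (g (r k) * f y))"
        by (intro integrable_indicator_mult) (auto simp: f)
      show "integrable lborel (\<lambda>y. indicat_real {r k<..r (Suc k)} y * (g y * f y))"
        by (rule gf) (use rk in auto)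
    qed (use rk in \<open>auto simp: indicator_def intro!: mult_right_mono gmono f(2)\<close>)
    from mult_left_mono[OF this K] have I1: "\<beta> * g (r k) \<le> I"
      unfolding I_def \<beta> mass_cmult by (simp add: mult_ac)
    have "mass (\<lambda>y. g y * f y) (r k) (r (Suc k)) \<le> mass (\<lambda>y. g (r (Suc k)) * f y) (r k) (r (Suc k))"
      unfolding mass_def
    proof (rule integral_mono)
      show "integrable lborel (\<lambda>y. indicat_real {r k<..r (Suc k)} y * (g (r (Suc k)) * f y))"
        by (intro integrable_indicator_mult) (auto simp: f)
      show "integrable lborel (\<lambda>y. indicat_real {r k<..r (Suc k)} y * (g y * f y))"
        by (rule gf) (use rk in auto)
    qed (use rk in \<open>auto simp: indicator_def intro!: mult_right_mono gmono f(2)\<close>)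
    from mult_left_mono[OF this K] have I2: "I \<le> \<beta> * g (r (Suc k))"
      unfolding I_def \<beta> mass_cmult by (simp add: mult_ac)
    have mS: "mass (\<lambda>y. g y * f y) (r m) (r (Suc k)) =
      mass (\<lambda>y. g y * f y) (r m) (r k) + mass (\<lambda>y. g y * f y) (r k) (r (Suc k))"
    proof -
      have "mass (\<lambda>y. g y * f y) (r m) (r (Suc k)) = (\<integral>y. indicator {r m<..r k} y * (g y * f y)
        + indicator {r k<..r (Suc k)} y * (g y * f y) \<partial>lborel)"
        unfolding mass_def using rk by (intro Bochner_Integration.integral_cong) (auto simp: indicator_def)
      also have "\<dots> = mass (\<lambda>y. g y * f y) (r m) (r k) + mass (\<lambda>y. g y * f y) (r k) (r (Suc k))"
        unfolding mass_def using rk by (intro Bochner_Integration.integral_add gf) auto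
      finally show ?thesis .
    qed
    let ?P = "\<lambda>k. ?S k - ?D k * g (r k) + ?D m * g (r m)"
    have "?P (Suc k) - ?P k = \<alpha> * g (x k) - I - ?D (Suc k) * g (r (Suc k)) + ?D k * g (r k)"
      using k by (simp add: mS \<alpha>_def I_def distrib_left)
    also have "\<dots> = \<alpha> * \<xi> - (I - \<beta> * g (r k)) - ?D (Suc k) * \<Delta>"
      by (simp add: \<alpha>_def \<beta>_def \<xi>_def \<Delta>_def algebra_simps)
    finally have e: "?P (Suc k) - ?P k = \<alpha> * \<xi> - (I - \<beta> * g (r k)) - ?D (Suc k) * \<Delta>" .
    have "\<bar>\<alpha> * \<xi>\<bar> \<le> 1 * \<Delta>" unfolding abs_mult using \<alpha> \<xi> by (intro mult_mono) auto
    moreover have "\<bar>?D (Suc k) * \<Delta>\<bar> \<le> 1 * \<Delta>" unfolding abs_mult using D \<Delta>0 by (intro mult_mono) auto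
    moreover have "I - \<beta> * g (r k) \<le> \<Delta>"
    proof -
      have "I - \<beta> * g (r k) \<le> \<beta> * \<Delta>" using I2 by (simp add: \<Delta>_def algebra_simps)
      also have "\<dots> \<le> 1 * \<Delta>" using \<beta>01 \<Delta>0 by (intro mult_right_mono) auto
      finally show ?thesis by simp
    qed
    ultimately have "\<bar>?P (Suc k) - ?P k\<bar> \<le> 3 * \<Delta>" unfolding e using I1 by linarith
    moreover have "\<bar>?P k\<bar> \<le> 3 * (g (r k) - g (r m))" using step by simp
    ultimately show ?case by (simp add: \<Delta>_def)
  qed
  from this[of n] have "\<bar>?S n - ?D n * g (r n) + ?D m * g (r m)\<bar> \<le> 3 * (g (r n) - g (r m))"
    using mn by simp
  moreover have "\<bar>g (r n)\<bar> \<le> L" "\<bar>g (r m)\<bar> \<le> L" using r_mono[of m n] mn by (auto intro!: g(3))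
  moreover from this have "\<bar>?D n * g (r n)\<bar> \<le> 1 * L" "\<bar>?D m * g (r m)\<bar> \<le> 1 * L"
    unfolding abs_mult using AB[of n] AB[of m] mn by (intro mult_mono; simp)+
  \<comment> \<open>The total increment of \<open>g\<close> is at most \<open>2 * L\<close>, which
    accounts for 6; the two boundary terms account for the remaining 2.\<close>
  moreover have "\<bar>S\<bar> \<le> 8 * L" if "\<bar>S - p + q\<bar> \<le> 3 * (u - v)" "\<bar>u\<bar> \<le> L" "\<bar>v\<bar> \<le> L"
    "\<bar>p\<bar> \<le> 1 * L" "\<bar>q\<bar> \<le> 1 * L" for S p q u v using that unfolding abs_le_iff by auto
  ultimately show ?thesis by blast
qed

section \<open>Nodes and their cells\<close>

lemma real_analytic_on_imp_continuous_on:
  assumes "real_analytic_on S f"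
  shows "continuous_on S f"
proof -
  obtain U g where U: "open U" "complex_of_real ` S \<subseteq> U" "g holomorphic_on U"
    "\<And>x. x \<in> S \<Longrightarrow> g (complex_of_real x) = complex_of_real (f x)"
    using assms unfolding real_analytic_on_def by blast
  have "continuous_on S (\<lambda>x. Re (g (complex_of_real x)))"
    using U(2) by (intro continuous_intros continuous_on_compose2[OF holomorphic_on_imp_continuous_on[OF U(3)]]) auto
  then show ?thesis by (rule continuous_on_eq) (simp add: U(4))
qed

text \<open>The interval is open because the density of the equilibrium measure is controlled only
  there; its values at the end points are arbitrary.\<close>

definition zero_ext :: "real \<Rightarrow> real \<Rightarrow> (real \<Rightarrow> real) \<Rightarrow> real \<Rightarrow> real" where
  "zero_ext a b f y = indicator {a<..<b} y * f y"

lemma zero_ext_simps [simp]: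
  "y \<in> {a<..<b} \<Longrightarrow> zero_ext a b f y = f y" "y \<notin> {a<..<b} \<Longrightarrow> zero_ext a b f y = 0"
  by (auto simp: zero_ext_def)

lemma bounded_density_zero_ext:
  assumes "continuous_on {a<..<b} f" "\<And>y. y \<in> {a<..<b} \<Longrightarrow> \<bar>f y\<bar> \<le> C" "0 \<le> C"
  shows "bounded_density a b C (zero_ext a b f)"
proof -
  have "(\<lambda>y. indicator {a<..<b} y *\<^sub>R f y) \<in> borel_measurable borel"
    by (intro borel_measurable_continuous_on_indicator assms) auto
  moreover have "(\<lambda>y. indicator {a<..<b} y *\<^sub>R f y) = zero_ext a b f"
    by (auto simp: zero_ext_def)
  ultimately show ?thesis
    using assms(2,3) by (auto simp: bounded_density_def zero_ext_def indicator_def)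
qed

lemma LBINT_eq_mass_zero_ext:
  assumes "continuous_on {a..b} f" "t \<in> {a..b}"
  shows "(LBINT y:{a..t}. f y) = mass (zero_ext a b f) a t"
  unfolding mass_def set_lebesgue_integral_def
proof (rule Bochner_Integration.integral_cong_AE)
  show "(\<lambda>y. indicator {a..t} y *\<^sub>R f y) \<in> borel_measurable lborel"
    using borel_measurable_continuous_on_indicator[of "{a..t}" f] continuous_on_subset[OF assms(1), of "{a..t}"]
      assms(2) by simp
  have "(\<lambda>y. indicator {a<..<b} y *\<^sub>R f y) \<in> borel_measurable borel"
    by (intro borel_measurable_continuous_on_indicator continuous_on_subset[OF assms(1)]) auto
  then have [measurable]: "zero_ext a b f \<in> borel_measurable borel" by (simp add: zero_ext_def [abs_def])
  show "(\<lambda>y. indicator {a<..t} y * zero_ext a b f y) \<in> borel_measurable lborel"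
    by measurable
  show "AE y in lborel. indicator {a..t} y *\<^sub>R f y = indicator {a<..t} y * zero_ext a b f y"
    using AE_lborel_singleton[of a] AE_lborel_singleton[of b]
    by eventually_elim (use assms(2) in \<open>auto simp: zero_ext_def indicator_def\<close>)
qed

locale node_system =
  fixes a b :: real and \<rho> :: "real \<Rightarrow> real" and x :: "nat \<Rightarrow> nat \<Rightarrow> real"
  assumes node_density: "node_density a b \<rho>" and nodes: "nodes a b \<rho> x"
begin

abbreviation rho :: "real \<Rightarrow> real" where "rho \<equiv> zero_ext a b \<rho>"

lemma ab: "a < b" and \<rho>_pos: "y \<in> {a..b} \<Longrightarrow> 0 < \<rho> y"
  using node_density by (auto simp: node_density_def)

lemma \<rho>_cont: "continuous_on {a..b} \<rho>"
  using node_density by (auto simp: node_density_def intro: real_analytic_on_imp_continuous_on)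

definition \<rho>min :: real where "\<rho>min = (SOME m. 0 < m \<and> (\<forall>y\<in>{a..b}. m \<le> \<rho> y))"
definition \<rho>max :: real where "\<rho>max = (SOME M. 0 < M \<and> (\<forall>y\<in>{a..b}. \<rho> y \<le> M))"

lemma \<rho>min: "0 < \<rho>min" "y \<in> {a..b} \<Longrightarrow> \<rho>min \<le> \<rho> y"
proof -
  obtain y0 where "y0 \<in> {a..b}" "\<And>y. y \<in> {a..b} \<Longrightarrow> \<rho> y0 \<le> \<rho> y"
    using continuous_attains_inf[OF _ _ \<rho>_cont] ab by auto
  then have "\<exists>m. 0 < m \<and> (\<forall>y\<in>{a..b}. m \<le> \<rho> y)" using \<rho>_pos by blast
  from someI_ex[OF this] show "0 < \<rho>min" "y \<in> {a..b} \<Longrightarrow> \<rho>min \<le> \<rho> y" by (auto simp: \<rho>min_def)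
qed

lemma \<rho>max: "0 < \<rho>max" "y \<in> {a..b} \<Longrightarrow> \<rho> y \<le> \<rho>max"
proof -
  obtain y0 where "y0 \<in> {a..b}" "\<And>y. y \<in> {a..b} \<Longrightarrow> \<rho> y \<le> \<rho> y0"
    using continuous_attains_sup[OF _ _ \<rho>_cont] ab by auto
  then have "\<exists>M. 0 < M \<and> (\<forall>y\<in>{a..b}. \<rho> y \<le> M)" using \<rho>_pos by blast
  from someI_ex[OF this] show "0 < \<rho>max" "y \<in> {a..b} \<Longrightarrow> \<rho> y \<le> \<rho>max" by (auto simp: \<rho>max_def)
qed

lemma rho_bounded_density: "bounded_density a b \<rho>max rho"
proof (rule bounded_density_zero_ext)
  show "continuous_on {a<..<b} \<rho>" by (rule continuous_on_subset[OF \<rho>_cont]) auto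
  show "\<bar>\<rho> y\<bar> \<le> \<rho>max" if "y \<in> {a<..<b}" for y
    using that \<rho>max(2)[of y] \<rho>_pos[of y] by auto
qed (use \<rho>max in simp)

lemmas rho_integrable = bounded_density_integrable[OF rho_bounded_density]

lemma rho_nonneg: "0 \<le> rho y"
  using \<rho>_pos[of y] by (cases "y \<in> {a<..<b}") auto

lemma mass_rho_bounds:
  assumes "a \<le> s" "s \<le> t" "t \<le> b"
  shows "\<rho>min * (t - s) \<le> mass rho s t" "mass rho s t \<le> \<rho>max * (t - s)"
  by (rule mass_mono_bounds[where m = \<rho>min and M = \<rho>max and f = rho, OF rho_integrable assms(2)];
      use assms \<rho>min(2) \<rho>max(2) in auto)+

lemma mass_rho_less_cancel:
  assumes "mass rho a s < mass rho a t" "a \<le> s" "a \<le> t"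
  shows "s < t"
proof (rule ccontr)
  assume "\<not> s < t"
  then have "mass rho a s = mass rho a t + mass rho t s"
    using assms by (intro mass_add rho_integrable) auto
  then show False using mass_nonneg[of t s rho] rho_nonneg assms by auto
qed

lemma mass_rho_total: "mass rho a b = 1"
  using node_density ab LBINT_eq_mass_zero_ext[OF \<rho>_cont, of b] by (simp add: node_density_def)

lemma node_in: "j < N \<Longrightarrow> a < x N j" "j < N \<Longrightarrow> x N j < b"
  using nodes by (auto simp: nodes_def)

lemma node_mass: "j < N \<Longrightarrow> mass rho a (x N j) = (2 * real j + 1) / (2 * real N)"
  using nodes node_in[of j N] LBINT_eq_mass_zero_ext[OF \<rho>_cont, of "x N j"]
  by (simp add: nodes_def less_imp_le)

lemma node_inj: "inj_on (x N) {..<N}"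
  using nodes by (auto simp: nodes_def intro: strict_mono_on_imp_inj_on)

text \<open>The quantiles of \<rho>. The mass of \<rho> before \<open>x N i\<close> is halfway
  between \<open>i / N\<close> and \<open>(i + 1) / N\<close>, so each node is the median of its own
  cell.\<close>

definition cell :: "nat \<Rightarrow> nat \<Rightarrow> real" where
  "cell N i = (SOME t. t \<in> {a..b} \<and> mass rho a t = real i / real N)"

lemma cell:
  assumes "i \<le> N" "0 < N"
  shows "a \<le> cell N i" "cell N i \<le> b" "mass rho a (cell N i) = real i / real N"
proof -
  have "\<rho>max-lipschitz_on {a..b} (mass rho a)"
  proof (rule lipschitz_on_leI)
    fix s t assume "s \<in> {a..b}" "t \<in> {a..b}" "s \<le> t"
    then show "dist (mass rho a s) (mass rho a t) \<le> \<rho>max * dist s t"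
      using mass_rho_bounds[of s t] mass_add[OF rho_integrable, of a s t] mass_nonneg[of s t rho] rho_nonneg
      by (auto simp: dist_real_def)
  qed (use \<rho>max in simp)
  then have "continuous_on {a..b} (mass rho a)" by (rule lipschitz_on_continuous_on)
  then have "\<exists>t\<ge>a. t \<le> b \<and> mass rho a t = real i / real N"
    using assms ab by (intro IVT') (auto simp: mass_rho_total)
  then have "\<exists>t. t \<in> {a..b} \<and> mass rho a t = real i / real N" by auto
  from someI_ex[OF this] show "a \<le> cell N i" "cell N i \<le> b" "mass rho a (cell N i) = real i / real N"
    by (auto simp: cell_def)
qed

text \<open>The node halves the mass \<open>1 / N\<close> of its cell; the bounds
  \<open>\<rho>min\<close> and \<open>\<rho>max\<close> convert these masses into lengths.\<close>

lemma cell_diff: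
  assumes "i < N"
  shows "cell N i \<le> cell N (Suc i)" "mass rho (cell N i) (cell N (Suc i)) = 1 / real N"
    "cell N (Suc i) - cell N i \<le> 1 / (real N * \<rho>min)"
    "1 / (2 * real N * \<rho>max) \<le> x N i - cell N i" "1 / (2 * real N * \<rho>max) \<le> cell N (Suc i) - x N i"
proof -
  have N: "0 < N" using assms by simp
  define l where "l = cell N i"
  define u where "u = cell N (Suc i)"
  define c where "c = x N i"
  have l: "a \<le> l" "l \<le> b" "mass rho a l = real i / N"
    using cell[of i N] assms N by (simp_all add: l_def)
  have u: "a \<le> u" "u \<le> b" "mass rho a u = (real i + 1) / N"
    using cell[of "Suc i" N] assms N by (simp_all add: u_def add.commute)
  have c: "a < c" "c < b" "mass rho a c = (real i + 1 / 2) / N"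
    using node_in[OF assms] node_mass[OF assms] N by (simp_all add: c_def field_simps)
  have 1: "l < c" "c < u"
    using l u c N by (auto intro: mass_rho_less_cancel[of l c] mass_rho_less_cancel[of c u] simp: divide_strict_right_mono)
  have m1: "mass rho l c = 1 / 2 / N" "mass rho c u = 1 / 2 / N"
    using mass_add[OF rho_integrable, of a l c] mass_add[OF rho_integrable, of a c u] 1 l u c
    by (simp_all add: diff_divide_distrib add_divide_distrib)
  have m: "mass rho l u = 1 / real N"
    using mass_add[OF rho_integrable, of l c u] m1 1 by simp
  have 2: "1 / 2 / N \<le> \<rho>max * (c - l)" "1 / 2 / N \<le> \<rho>max * (u - c)" "\<rho>min * (u - l) \<le> 1 / N"
    using mass_rho_bounds(2)[of l c] mass_rho_bounds(2)[of c u] mass_rho_bounds(1)[of l u] 1 l u c m m1 by auto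
  show "cell N i \<le> cell N (Suc i)" "mass rho (cell N i) (cell N (Suc i)) = 1 / real N"
    using 1 m by (simp_all add: l_def u_def)
  show "cell N (Suc i) - cell N i \<le> 1 / (real N * \<rho>min)"
    using 2(3) \<rho>min(1) N unfolding l_def[symmetric] u_def[symmetric] by (simp add: field_simps)
  show "1 / (2 * real N * \<rho>max) \<le> x N i - cell N i" "1 / (2 * real N * \<rho>max) \<le> cell N (Suc i) - x N i"
    using 2(1,2) \<rho>max(1) N unfolding l_def[symmetric] u_def[symmetric] c_def[symmetric]
    by (simp_all add: field_simps)
qed

lemma cell_mono:
  assumes "i \<le> j" "j \<le> N"
  shows "cell N i \<le> cell N j"
  using assms
proof (induction j rule: dec_induct)
  case (step j)
  then show ?case using cell_diff(1)[of j N] by simp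
qed simp

text \<open>The cells are picked by choice, so the end points have to be identified: since \<rho> is
  at least \<open>\<rho>min > 0\<close>, the quantiles for mass 0 and mass 1 are unique.\<close>

lemma cell_ends:
  assumes "0 < N"
  shows "cell N 0 = a" "cell N N = b"
proof -
  have "\<rho>min * (cell N 0 - a) \<le> 0" "\<rho>min * (b - cell N N) \<le> 0"
    using mass_rho_bounds(1)[of a "cell N 0"] mass_rho_bounds(1)[of "cell N N" b] cell[of 0 N] cell[of N N] assms
      mass_add[OF rho_integrable, of a "cell N N" b] by (auto simp: mass_rho_total)
  then have "cell N 0 - a \<le> 0" "b - cell N N \<le> 0" using \<rho>min(1) by (simp_all add: mult_le_0_iff)
  then show "cell N 0 = a" "cell N N = b" using cell(1)[of 0 N] cell(2)[of N N] assms by auto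
qed

end

section \<open>Logarithmic sums over nodes compared with logarithmic potentials\<close>

lemma log_potential_integrable_real:
  assumes "bounded_density a b C e" "a \<le> b"
  shows "integrable lborel (\<lambda>y. ln \<bar>t - y\<bar> * e y)"
  using log_potential_integrable[OF assms, of "of_real t"] by (simp flip: of_real_diff)

text \<open>Controls the contribution of the cell around the singularity, where the logarithm is
  unbounded and Koksma's inequality says nothing. The two summands come from the two summands of
  \<open>abs_ln_le\<close>.\<close>

lemma log_kernel_local_integral:
  fixes h t :: real
  assumes "h > 0"
  shows "integrable lborel (\<lambda>y. indicator {t-h<..<t+h} y * \<bar>ln \<bar>t - y\<bar>\<bar>)" (is "integrable _ ?f")
    "(\<integral>y. indicator {t-h<..<t+h} y * \<bar>ln \<bar>t - y\<bar>\<bar> \<partial>lborel) \<le> 2 * h\<^sup>2 + 8 * sqrt h"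
proof -
  let ?g = "\<lambda>y. h * indicator {t-h<..<t+h} y + 2 * (indicator {t-h<..<t+h} y * (1 / sqrt \<bar>t - y\<bar>))"
  have 1: "has_bochner_integral lborel (indicat_real {t-h<..<t+h}) (2 * h)"
    using has_bochner_integral_real_indicator[of "{t-h<..<t+h}" lborel] assms by simp
  have g: "has_bochner_integral lborel ?g (h * (2 * h) + 2 * (4 * sqrt h))"
    by (intro has_bochner_integral_add has_bochner_integral_mult_right 1 inverse_sqrt_integral assms)
  have le: "?f y \<le> ?g y" for y
  proof (cases "y \<in> {t-h<..<t+h} \<and> y \<noteq> t")
    case True
    then have "\<bar>ln \<bar>t - y\<bar>\<bar> \<le> \<bar>t - y\<bar> + 2 / sqrt \<bar>t - y\<bar>" by (intro abs_ln_le) auto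
    moreover have "\<bar>t - y\<bar> \<le> h" using True by auto
    ultimately show ?thesis using True by auto
  qed (use assms in \<open>auto simp: indicator_def\<close>)
  show i: "integrable lborel ?f"
    by (rule Bochner_Integration.integrable_bound[OF integrable.intros[OF g]])
      (use le in \<open>auto intro!: AE_I2 order.trans[OF _ abs_ge_self]\<close>)
  have "integral\<^sup>L lborel ?f \<le> integral\<^sup>L lborel ?g"
    by (intro integral_mono i integrable.intros[OF g] le)
  then show "integral\<^sup>L lborel ?f \<le> 2 * h\<^sup>2 + 8 * sqrt h"
    unfolding has_bochner_integral_integral_eq[OF g] by (simp add: power2_eq_square)
qed

context node_system
begin

text \<open>The 16 is the constant 8 of Koksma's inequality on each of the two sides of the node,
  and the bracket bounds the logarithm outside the cell. The second summand is \<open>N\<close>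
  times the integral over the cell, of order sqrt N.\<close>

definition sampling_error :: "nat \<Rightarrow> real" where
  "sampling_error N = 16 * (\<bar>ln (b - a)\<bar> + \<bar>ln (1 / (2 * real N * \<rho>max))\<bar>) +
     real N * \<rho>max * (2 * (1 / (real N * \<rho>min))\<^sup>2 + 8 * sqrt (1 / (real N * \<rho>min)))"

lemma sampling_error_small:
  assumes "\<epsilon> > 0"
  shows "\<forall>\<^sub>F N in sequentially. sampling_error N \<le> \<epsilon> * real N"
proof -
  have "(\<lambda>N. (16 * (C + \<bar>ln (1 / (2 * real N * M))\<bar>) +
     real N * M * (2 * (1 / (real N * m))\<^sup>2 + 8 * sqrt (1 / (real N * m)))) / real N) \<longlonglongrightarrow> 0"
    if "m > 0" "M > 0" for m M C :: real
    using that by real_asymp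
  from this[OF \<rho>min(1) \<rho>max(1)] have "(\<lambda>N. sampling_error N / real N) \<longlonglongrightarrow> 0"
    unfolding sampling_error_def .
  then have "\<forall>\<^sub>F N in sequentially. sampling_error N / real N < \<epsilon>"
    using assms by (rule order_tendstoD)
  then show ?thesis
    using eventually_gt_at_top[of 0] by eventually_elim (auto simp: field_simps)
qed

lemma abs_ln_node_dist:
  assumes "N > 0" "1 / (2 * real N * \<rho>max) \<le> t" "t \<le> b - a"
  shows "\<bar>ln t\<bar> \<le> \<bar>ln (b - a)\<bar> + \<bar>ln (1 / (2 * real N * \<rho>max))\<bar>"
proof -
  have p: "0 < 1 / (2 * real N * \<rho>max)" using assms(1) \<rho>max(1) by simp
  have "ln (1 / (2 * real N * \<rho>max)) \<le> ln t" "ln t \<le> ln (b - a)"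
    using assms p by (subst ln_le_cancel_iff; linarith)+
  then show ?thesis by linarith
qed

text \<open>The logarithm is monotone on either side of the cell of \<open>x N n\<close> and bounded
  there by a multiple of log N, so Koksma's inequality applies on both sides; the cell itself has no
  term in the sum and its integral is small. The counting function \<open>A\<close> is kept abstract
  because the estimate is needed both for all nodes and for the chosen ones.\<close>

lemma log_sum_discretization:
  fixes A :: "nat \<Rightarrow> real" and f :: "real \<Rightarrow> real"
  assumes f: "f \<in> borel_measurable borel" "\<And>y. 0 \<le> f y" "\<And>y. f y \<le> rho y"
    and A: "\<And>i. i \<le> N \<Longrightarrow> \<bar>A i - real N * mass f a (cell N i)\<bar> \<le> 1"
      "\<And>i. i < N \<Longrightarrow> \<bar>A (Suc i) - A i\<bar> \<le> 1"
    and n: "n < N"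
  shows "\<bar>(\<Sum>i\<in>{..<N} - {n}. (A (Suc i) - A i) * ln \<bar>x N n - x N i\<bar>) -
      real N * (\<integral>y. ln \<bar>x N n - y\<bar> * f y \<partial>lborel)\<bar> \<le> sampling_error N"
proof -
  define \<delta> where "\<delta> = 1 / (2 * real N * \<rho>max)"
  define L where "L = \<bar>ln (b - a)\<bar> + \<bar>ln \<delta>\<bar>"
  define c where "c = x N n"
  define g where "g y = ln \<bar>c - y\<bar>" for y
  define r where "r = cell N"
  let ?K = "real N"
  have N: "N > 0" using n by simp
  have \<delta>: "\<delta> > 0" using N \<rho>max by (simp add: \<delta>_def)
  have c: "a < c" "c < b" "r n + \<delta> \<le> c" "c + \<delta> \<le> r (Suc n)"
    using node_in[OF n] cell_diff(4,5)[OF n] by (auto simp: c_def r_def \<delta>_def)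
  have r: "r 0 = a" "r N = b" "\<And>i j. i \<le> j \<Longrightarrow> j \<le> N \<Longrightarrow> r i \<le> r j"
    using cell_ends[OF N] cell_mono by (auto simp: r_def)
  have fbd: "bounded_density a b \<rho>max f"
    unfolding bounded_density_def using f bounded_densityD(2)[OF rho_bounded_density]
    by (smt (verit) abs_of_nonneg)
  note fi = bounded_density_integrable[OF fbd]
  have gf: "integrable lborel (\<lambda>y. g y * f y)"
    unfolding g_def using fbd ab by (intro log_potential_integrable_real) auto
  have gm: "g \<in> borel_measurable borel" by (simp add: g_def [abs_def])
  have f0: "f y = 0" if "y \<notin> {a<..<b}" for y
    using f(2,3)[of y] that by simp
  have xi: "r i \<le> x N i" "x N i \<le> r (Suc i)" if "i < N" for i
  proof -
    have "\<delta> \<le> x N i - r i" "\<delta> \<le> r (Suc i) - x N i"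
      using cell_diff(4,5)[OF that] by (simp_all add: r_def \<delta>_def)
    then show "r i \<le> x N i" "x N i \<le> r (Suc i)" using \<delta> by linarith+
  qed
  have inc: "?K * mass f a (r (Suc i)) - ?K * mass f a (r i) \<le> 1" if "i < N" for i
  proof -
    have "a \<le> r i" "r i \<le> r (Suc i)" using r(3)[of 0 i] r(3)[of i "Suc i"] r(1) that by auto
    then have "mass f a (r (Suc i)) = mass f a (r i) + mass f (r i) (r (Suc i))"
      by (rule mass_add[OF fi])
    moreover have "mass f (r i) (r (Suc i)) \<le> mass rho (r i) (r (Suc i))"
      by (intro mass_mono fi rho_integrable f)
    moreover have "\<dots> = 1 / ?K" using cell_diff(2)[OF that] by (simp add: r_def)
    ultimately show ?thesis using N by (simp add: field_simps)
  qed
  have gL: "\<bar>g y\<bar> \<le> L" if "y \<in> {a..b}" "\<delta> \<le> \<bar>c - y\<bar>" for y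
    unfolding L_def g_def \<delta>_def using that c by (intro abs_ln_node_dist N) (auto simp: \<delta>_def)
  have right: "\<bar>(\<Sum>i=Suc n..<N. (A (Suc i) - A i) * g (x N i)) -
      ?K * mass (\<lambda>y. g y * f y) (r (Suc n)) (r N)\<bar> \<le> 8 * L"
  proof (rule koksma_monotone[where a = a])
    show "mono_on {r (Suc n)..r N} g"
      using c \<delta> by (intro mono_onI) (auto simp: g_def)
    show "\<bar>g y\<bar> \<le> L" if "y \<in> {r (Suc n)..r N}" for y
      using that c r \<delta> by (intro gL) auto
    show "a \<le> r (Suc n)" using c \<delta> by simp
  qed (use A xi inc fi f gm n in \<open>auto simp: r_def\<close>)
  \<comment> \<open>To the left of the node the logarithm decreases, hence the change of
    sign.\<close>
  have left: "\<bar>(\<Sum>i=0..<n. (A (Suc i) - A i) * (- g (x N i))) -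
      ?K * mass (\<lambda>y. - g y * f y) (r 0) (r n)\<bar> \<le> 8 * L"
  proof (rule koksma_monotone[where a = a])
    show "mono_on {r 0..r n} (\<lambda>y. - g y)"
      using c \<delta> by (intro mono_onI) (auto simp: g_def)
    show "\<bar>- g y\<bar> \<le> L" if "y \<in> {r 0..r n}" for y
      using that c r \<delta> gL[of y] by auto
  qed (use A xi inc fi f gm n r in \<open>auto simp: r_def\<close>)
  have nm: "mass (\<lambda>y. - g y * f y) (r 0) (r n) = - mass (\<lambda>y. g y * f y) (r 0) (r n)"
    using mass_cmult[of "-1" "\<lambda>y. g y * f y"] by simp
  have left: "\<bar>(\<Sum>i=0..<n. (A (Suc i) - A i) * g (x N i)) -
      ?K * mass (\<lambda>y. g y * f y) (r 0) (r n)\<bar> \<le> 8 * L"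
    using left unfolding nm by (simp add: sum_negf)
  \<comment> \<open>An upper bound for the length of the cell, so that the interval of radius
    \<open>h\<close> about the node contains it.\<close>
  define h where "h = 1 / (?K * \<rho>min)"
  have h: "h > 0" "r (Suc n) - r n \<le> h" using N \<rho>min(1) cell_diff(3)[OF n] by (auto simp: h_def r_def)
  have mid: "\<bar>mass (\<lambda>y. g y * f y) (r n) (r (Suc n))\<bar> \<le> \<rho>max * (2 * h\<^sup>2 + 8 * sqrt h)"
  proof -
    have "\<bar>mass (\<lambda>y. g y * f y) (r n) (r (Suc n))\<bar> \<le> (\<integral>y. \<bar>indicator {r n<..r (Suc n)} y * (g y * f y)\<bar> \<partial>lborel)"
      unfolding mass_def by (rule integral_abs_bound)
    also have "\<dots> \<le> (\<integral>y. \<rho>max * (indicator {c-h<..<c+h} y * \<bar>ln \<bar>c - y\<bar>\<bar>) \<partial>lborel)"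
    proof (rule integral_mono)
      show "integrable lborel (\<lambda>y. \<bar>indicator {r n<..r (Suc n)} y * (g y * f y)\<bar>)"
        by (intro integrable_abs integrable_indicator_mult gf) auto
      show "integrable lborel (\<lambda>y. \<rho>max * (indicator {c-h<..<c+h} y * \<bar>ln \<bar>c - y\<bar>\<bar>))"
        by (intro integrable_mult_right log_kernel_local_integral h)
      fix y
      have "\<bar>f y\<bar> \<le> \<rho>max" using bounded_densityD(2)[OF fbd, of y] \<rho>max(1)
        by (cases "y \<in> {a..b}") auto
      then have "\<bar>g y\<bar> * \<bar>f y\<bar> \<le> \<bar>g y\<bar> * \<rho>max" by (intro mult_left_mono) auto
      moreover have "y \<in> {c-h<..<c+h}" if "y \<in> {r n<..r (Suc n)}" using that c h \<delta> by auto
      ultimately show "\<bar>indicator {r n<..r (Suc n)} y * (g y * f y)\<bar> \<le> \<rho>max * (indicator {c-h<..<c+h} y * \<bar>ln \<bar>c - y\<bar>\<bar>)"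
        using \<rho>max(1) by (cases "y \<in> {r n<..r (Suc n)}") (auto simp: g_def abs_mult mult.commute)
    qed
    also have "\<dots> = \<rho>max * (\<integral>y. indicator {c-h<..<c+h} y * \<bar>ln \<bar>c - y\<bar>\<bar> \<partial>lborel)" by simp
    also have "\<dots> \<le> \<rho>max * (2 * h\<^sup>2 + 8 * sqrt h)"
      using \<rho>max(1) by (intro mult_left_mono log_kernel_local_integral h) auto
    finally show ?thesis .
  qed
  have "(\<integral>y. g y * f y \<partial>lborel) = mass (\<lambda>y. g y * f y) (r 0) (r N)"
    unfolding mass_def
  proof (intro Bochner_Integration.integral_cong refl)
    fix y show "g y * f y = indicator {r 0<..r N} y * (g y * f y)"
      using f0[of y] by (cases "y \<in> {a<..<b}") (auto simp: r)
  qed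
  also have "\<dots> = mass (\<lambda>y. g y * f y) (r 0) (r n) + mass (\<lambda>y. g y * f y) (r n) (r N)"
    by (intro mass_add gf r(3)) (use n in auto)
  also have "mass (\<lambda>y. g y * f y) (r n) (r N) = mass (\<lambda>y. g y * f y) (r n) (r (Suc n)) + mass (\<lambda>y. g y * f y) (r (Suc n)) (r N)"
    by (intro mass_add gf r(3)) (use n in auto)
  finally have tot: "(\<integral>y. g y * f y \<partial>lborel) = mass (\<lambda>y. g y * f y) (r 0) (r n) +
      (mass (\<lambda>y. g y * f y) (r n) (r (Suc n)) + mass (\<lambda>y. g y * f y) (r (Suc n)) (r N))" .
  have "{..<N} - {n} = {0..<n} \<union> {Suc n..<N}" using n by auto
  then have sums: "(\<Sum>i\<in>{..<N} - {n}. (A (Suc i) - A i) * g (x N i)) =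
     (\<Sum>i=0..<n. (A (Suc i) - A i) * g (x N i)) + (\<Sum>i=Suc n..<N. (A (Suc i) - A i) * g (x N i))"
    by (simp add: sum.union_disjoint)
  have fin: "\<bar>(S1 + S2) - ?K * (I1 + (I2 + I3))\<bar> \<le> 16 * L + ?K * Q"
    if "\<bar>S1 - ?K * I1\<bar> \<le> 8 * L" "\<bar>S2 - ?K * I3\<bar> \<le> 8 * L" "\<bar>I2\<bar> \<le> Q" for S1 S2 I1 I2 I3 Q :: real
  proof -
    have "\<bar>?K * I2\<bar> \<le> ?K * Q" unfolding abs_mult using that(3) by (simp add: mult_left_mono)
    then show ?thesis using that(1,2) unfolding distrib_left by linarith
  qed
  have "\<bar>(\<Sum>i\<in>{..<N} - {n}. (A (Suc i) - A i) * g (x N i)) - ?K * (\<integral>y. g y * f y \<partial>lborel)\<bar>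
     \<le> 16 * L + ?K * (\<rho>max * (2 * h\<^sup>2 + 8 * sqrt h))"
    unfolding tot sums by (rule fin[OF left right mid])
  also have "\<dots> = sampling_error N"
    by (simp add: sampling_error_def L_def \<delta>_def h_def mult.assoc)
  finally show ?thesis by (simp add: g_def c_def)
qed

end

section \<open>Logarithmic potentials and energy\<close>

definition log_pot :: "(real \<Rightarrow> real) \<Rightarrow> real \<Rightarrow> real" where
  "log_pot e t = (\<integral>y. ln \<bar>t - y\<bar> * e y \<partial>lborel)"

lemma log_pot_holder:
  assumes "bounded_density a b C e" "a \<le> b"
  shows "\<bar>log_pot e s - log_pot e t\<bar> \<le> 4 * C * (b - a + 4) * sqrt \<bar>s - t\<bar>"
  using log_potential_holder[OF assms, of "of_real s" "of_real t"]
  by (simp add: log_pot_def flip: of_real_diff)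

lemma continuous_on_of_holder:
  fixes f :: "'a::metric_space \<Rightarrow> 'b::metric_space"
  assumes "\<And>s t. dist (f s) (f t) \<le> K * sqrt (dist s t)"
  shows "continuous_on S f"
  unfolding continuous_on_def
proof
  fix t assume "t \<in> S"
  have "((\<lambda>s. K * sqrt (dist s t)) \<longlongrightarrow> K * sqrt (dist t t)) (at t within S)"
    by (intro tendsto_intros)
  then have lim: "((\<lambda>s. K * sqrt (dist s t)) \<longlongrightarrow> 0) (at t within S)" by simp
  have "((\<lambda>s. dist (f s) (f t)) \<longlongrightarrow> 0) (at t within S)"
    by (rule tendsto_sandwich[OF _ _ tendsto_const lim]) (simp_all add: assms)
  then show "(f \<longlongrightarrow> f t) (at t within S)" by (rule tendsto_dist_iff[THEN iffD2])
qed

lemma log_pot_continuous: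
  assumes "bounded_density a b C e" "a \<le> b"
  shows "continuous_on S (log_pot e)"
  by (rule continuous_on_of_holder[where K = "4 * C * (b - a + 4)"])
    (use log_pot_holder[OF assms] in \<open>simp add: dist_real_def\<close>)

lemma bounded_density_add:
  assumes "bounded_density a b C e" "bounded_density a b C' e'"
  shows "bounded_density a b (C + C') (\<lambda>y. e y + e' y)"
  unfolding bounded_density_def
proof (intro conjI allI)
  show "(\<lambda>y. e y + e' y) \<in> borel_measurable borel"
    using bounded_densityD(1)[OF assms(1)] bounded_densityD(1)[OF assms(2)] by simp
  show "\<bar>e y + e' y\<bar> \<le> (C + C') * indicator {a..b} y" for y
    using bounded_densityD(2)[OF assms(1), of y] bounded_densityD(2)[OF assms(2), of y]
      abs_triangle_ineq[of "e y" "e' y"] unfolding distrib_right by linarith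
qed

lemma bounded_density_cmult:
  assumes "bounded_density a b C e"
  shows "bounded_density a b (\<bar>t\<bar> * C) (\<lambda>y. t * e y)"
  unfolding bounded_density_def
proof (intro conjI allI)
  show "(\<lambda>y. t * e y) \<in> borel_measurable borel" using bounded_densityD(1)[OF assms] by simp
  show "\<bar>t * e y\<bar> \<le> \<bar>t\<bar> * C * indicator {a..b} y" for y
    unfolding abs_mult mult.assoc by (intro mult_left_mono bounded_densityD(2)[OF assms]) auto
qed

lemma log_pot_linear:
  assumes "bounded_density a b C e" "bounded_density a b C' h" "a \<le> b"
  shows "log_pot (\<lambda>y. e y + t * h y) s = log_pot e s + t * log_pot h s"
proof -
  note i = log_potential_integrable_real[OF assms(1,3), of s] log_potential_integrable_real[OF assms(2,3), of s]
  have "log_pot (\<lambda>y. e y + t * h y) s = (\<integral>y. ln \<bar>s - y\<bar> * e y + t * (ln \<bar>s - y\<bar> * h y) \<partial>lborel)"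
    unfolding log_pot_def by (intro Bochner_Integration.integral_cong) (auto simp: algebra_simps)
  also have "\<dots> = log_pot e s + t * log_pot h s"
    unfolding log_pot_def using i by simp
  finally show ?thesis .
qed

text \<open>Nothing is known about \<open>g\<close> outside \<open>[a, b]\<close>, so measurability
  is obtained for its truncation, which the support of \<open>e\<close> makes harmless.\<close>

lemma integrable_continuous_mult_density:
  fixes g :: "real \<Rightarrow> real"
  assumes "continuous_on {a..b} g" "bounded_density a b C e"
  shows "integrable lborel (\<lambda>y. g y * e y)"
proof -
  note e = bounded_densityD[OF assms(2)]
  have "bounded (g ` {a..b})" by (intro compact_imp_bounded compact_continuous_image assms) auto
  then obtain K where "\<forall>y\<in>{a..b}. \<bar>g y\<bar> \<le> K" unfolding bounded_iff by auto
  then have K: "\<bar>g y\<bar> \<le> K" if "y \<in> {a..b}" for y using that by blast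
  have m: "(\<lambda>y. indicator {a..b} y *\<^sub>R g y) \<in> borel_measurable borel"
    by (intro borel_measurable_continuous_on_indicator assms) auto
  have "integrable lborel (\<lambda>y. (indicator {a..b} y *\<^sub>R g y) * e y)"
  proof (rule Bochner_Integration.integrable_bound)
    show "integrable lborel (\<lambda>y. K * \<bar>e y\<bar>)"
      using bounded_density_integrable[OF assms(2)] by auto
    show "AE y in lborel. norm ((indicator {a..b} y *\<^sub>R g y) * e y) \<le> norm (K * \<bar>e y\<bar>)"
    proof (rule AE_I2)
      fix y show "norm ((indicator {a..b} y *\<^sub>R g y) * e y) \<le> norm (K * \<bar>e y\<bar>)"
      proof (cases "y \<in> {a..b}")
        case True
        then have "\<bar>g y\<bar> \<le> \<bar>K\<bar>" using K[of y] by linarith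
        then show ?thesis using True by (simp add: abs_mult mult_right_mono)
      qed simp
    qed
  qed (use m e(1) in measurable)
  moreover have "(indicator {a..b} y *\<^sub>R g y) * e y = g y * e y" for y
    using e(3)[of y] by (cases "y \<in> {a..b}") auto
  ultimately show ?thesis by (simp only:)
qed

text \<open>The absolute value stands inside the integral and the bound is uniform in
  \<open>t\<close>: this is the absolute integrability that Fubini's theorem asks for in
  \<open>log_pot_symmetric\<close>.\<close>

lemma abs_log_pot_bound:
  assumes "bounded_density a b C e" "a \<le> b" "t \<in> {a..b}"
  shows "(\<integral>y. \<bar>ln \<bar>t - y\<bar> * e y\<bar> \<partial>lborel) \<le> C * (2 * (\<bar>a\<bar> + \<bar>b\<bar>) * (b - a) + 2 * (b - a + 4))"
proof -
  note e = bounded_densityD[OF assms(1)]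
  have C: "C \<ge> 0" using e(2)[of a] assms(2) by simp
  let ?q = "\<lambda>y. indicator {a..b} y * (1 / sqrt \<bar>t - y\<bar>)"
  let ?g = "\<lambda>y. C * (2 * (\<bar>a\<bar> + \<bar>b\<bar>) * indicator {a..b} y + 2 * ?q y)"
  note q = inverse_sqrt_integral_Icc[OF assms(2), of t]
  have g: "integrable lborel ?g"
    by (intro integrable_mult_right Bochner_Integration.integrable_add integrable_indicator_Icc q)
  have "(\<integral>y. \<bar>ln \<bar>t - y\<bar> * e y\<bar> \<partial>lborel) \<le> (\<integral>y. ?g y \<partial>lborel)"
  proof (rule integral_mono_AE[OF _ g])
    show "integrable lborel (\<lambda>y. \<bar>ln \<bar>t - y\<bar> * e y\<bar>)"
      using log_potential_integrable_real[OF assms(1,2)] by (rule integrable_abs)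
    show "AE y in lborel. \<bar>ln \<bar>t - y\<bar> * e y\<bar> \<le> ?g y"
      using AE_lborel_singleton[of t]
    proof eventually_elim
      case (elim y)
      show ?case
      proof (cases "y \<in> {a..b}")
        case True
        have "\<bar>ln \<bar>t - y\<bar>\<bar> \<le> 2 * (\<bar>a\<bar> + \<bar>b\<bar>) + 2 * (1 / sqrt \<bar>t - y\<bar>)"
        proof -
          have "\<bar>t\<bar> \<le> \<bar>a\<bar> + \<bar>b\<bar>" using assms(3) by auto
          moreover have "\<bar>ln \<bar>t - y\<bar>\<bar> \<le> \<bar>t\<bar> + \<bar>a\<bar> + \<bar>b\<bar> + 2 * (1 / sqrt \<bar>t - y\<bar>)"
            using log_kernel_bound[of y "of_real t" a b] elim True by (simp flip: of_real_diff)
          moreover have "p \<le> 2 * (q + r) + w" if "u \<le> q + r" "p \<le> u + q + r + w" for p q r u w :: real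
            using that unfolding distrib_left by linarith
          ultimately show ?thesis by blast
        qed
        then have "\<bar>ln \<bar>t - y\<bar>\<bar> * \<bar>e y\<bar> \<le> (2 * (\<bar>a\<bar> + \<bar>b\<bar>) + 2 * (1 / sqrt \<bar>t - y\<bar>)) * C"
          using e(2)[of y] True by (intro mult_mono) auto
        then show ?thesis using True by (simp add: abs_mult mult.commute)
      qed (simp add: e(3))
    qed
  qed
  also have "\<dots> = C * (2 * (\<bar>a\<bar> + \<bar>b\<bar>) * (b - a) + 2 * integral\<^sup>L lborel ?q)"
  proof -
    have "integral\<^sup>L lborel ?g = C * (2 * (\<bar>a\<bar> + \<bar>b\<bar>) * integral\<^sup>L lborel (indicat_real {a..b}) + 2 * integral\<^sup>L lborel ?q)"
      using q(1) integrable_indicator_Icc[of a b]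
      by (simp only: integral_mult_right_zero Bochner_Integration.integral_add integrable_mult_right)
    then show ?thesis using assms(2) by simp
  qed
  also have "\<dots> \<le> C * (2 * (\<bar>a\<bar> + \<bar>b\<bar>) * (b - a) + 2 * (b - a + 4))"
    using q(2) C by (intro mult_left_mono) auto
  finally show ?thesis .
qed

lemma log_pot_symmetric:
  assumes "bounded_density a b C e" "bounded_density a b C' h" "a \<le> b"
  shows "(\<integral>s. log_pot e s * h s \<partial>lborel) = (\<integral>s. log_pot h s * e s \<partial>lborel)"
proof -
  note [measurable] = bounded_densityD(1)[OF assms(1)] bounded_densityD(1)[OF assms(2)]
  note h = bounded_densityD[OF assms(2)]
  let ?f = "\<lambda>s y. ln \<bar>s - y\<bar> * e y * h s"
  define K where "K = C * (2 * (\<bar>a\<bar> + \<bar>b\<bar>) * (b - a) + 2 * (b - a + 4))"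
  have int: "integrable (lborel \<Otimes>\<^sub>M lborel) (case_prod ?f)"
  proof (rule lborel_pair.Fubini_integrable)
    show "(case_prod ?f) \<in> borel_measurable (lborel \<Otimes>\<^sub>M lborel)" by measurable
    have eq: "(\<integral>y. norm (?f s y) \<partial>lborel) = (\<integral>y. \<bar>ln \<bar>s - y\<bar> * e y\<bar> \<partial>lborel) * \<bar>h s\<bar>" for s
      by (simp add: abs_mult)
    show "integrable lborel (\<lambda>s. \<integral>y. norm (case_prod ?f (s, y)) \<partial>lborel)"
    proof (rule Bochner_Integration.integrable_bound)
      show "integrable lborel (\<lambda>s. K * \<bar>h s\<bar>)"
        using bounded_density_integrable[OF assms(2)] by auto
      show "AE s in lborel. norm (\<integral>y. norm (case_prod ?f (s, y)) \<partial>lborel) \<le> norm (K * \<bar>h s\<bar>)"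
      proof (rule AE_I2)
        fix s
        show "norm (\<integral>y. norm (case_prod ?f (s, y)) \<partial>lborel) \<le> norm (K * \<bar>h s\<bar>)"
        proof (cases "s \<in> {a..b}")
          case True
          have "0 \<le> (\<integral>y. \<bar>ln \<bar>s - y\<bar> * e y\<bar> \<partial>lborel)" by (intro integral_nonneg_AE) auto
          then have "norm (\<integral>y. norm (case_prod ?f (s, y)) \<partial>lborel) = (\<integral>y. \<bar>ln \<bar>s - y\<bar> * e y\<bar> \<partial>lborel) * \<bar>h s\<bar>"
            unfolding prod.case eq by (simp only: real_norm_def abs_mult abs_of_nonneg abs_idempotent)
          also have "\<dots> \<le> K * \<bar>h s\<bar>"
            using abs_log_pot_bound[OF assms(1,3) True] unfolding K_def by (rule mult_right_mono) simp
          also have "\<dots> \<le> norm (K * \<bar>h s\<bar>)" by simp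
          finally show ?thesis .
        qed (simp add: h(3))
      qed
    qed measurable
    show "AE s in lborel. integrable lborel (\<lambda>y. case_prod ?f (s, y))"
      using log_potential_integrable_real[OF assms(1,3)] by auto
  qed
  have "(\<integral>s. log_pot e s * h s \<partial>lborel) = (\<integral>s. (\<integral>y. ?f s y \<partial>lborel) \<partial>lborel)"
    by (simp add: log_pot_def)
  also have "\<dots> = (\<integral>y. (\<integral>s. ?f s y \<partial>lborel) \<partial>lborel)"
    using lborel_pair.Fubini_integral[OF int] by simp
  also have "\<dots> = (\<integral>y. (\<integral>s. ln \<bar>y - s\<bar> * h s \<partial>lborel) * e y \<partial>lborel)"
  proof (intro Bochner_Integration.integral_cong refl)
    fix y
    have "(\<integral>s. ?f s y \<partial>lborel) = (\<integral>s. ln \<bar>y - s\<bar> * h s * e y \<partial>lborel)"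
      by (intro Bochner_Integration.integral_cong) (auto simp: abs_minus_commute mult_ac)
    then show "(\<integral>s. ?f s y \<partial>lborel) = (\<integral>s. ln \<bar>y - s\<bar> * h s \<partial>lborel) * e y" by simp
  qed
  finally show ?thesis by (simp add: log_pot_def)
qed

section \<open>Measures on the interval with a Lebesgue density\<close>

definition density_measure :: "real \<Rightarrow> real \<Rightarrow> (real \<Rightarrow> real) \<Rightarrow> real measure" where
  "density_measure a b e = density (restrict_space lborel {a..b}) (\<lambda>x. ennreal (e x))"

lemma sets_density_measure: "sets (density_measure a b e) = sets (restrict_space borel {a..b})"
  by (simp add: density_measure_def sets_restrict_space)

lemma space_density_measure: "space (density_measure a b e) = {a..b}"
  by (simp add: density_measure_def space_restrict_space)

lemma measurable_restrict_lborel: "g \<in> borel_measurable borel \<Longrightarrow> g \<in> borel_measurable (restrict_space lborel S)"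
  by (rule measurable_restrict_space1) simp

lemma integral_density_measure:
  fixes g e :: "real \<Rightarrow> real"
  assumes "e \<in> borel_measurable borel" "\<And>y. 0 \<le> e y" "\<And>y. y \<notin> {a..b} \<Longrightarrow> e y = 0"
    "g \<in> borel_measurable (restrict_space borel {a..b})"
  shows "integral\<^sup>L (density_measure a b e) g = (\<integral>y. g y * e y \<partial>lborel)"
proof -
  have "g \<in> borel_measurable (restrict_space lborel {a..b})"
    using assms(4) by (simp add: measurable_def space_restrict_space sets_restrict_space)
  then have "integral\<^sup>L (density_measure a b e) g = (\<integral>y. e y *\<^sub>R g y \<partial>restrict_space lborel {a..b})"
    unfolding density_measure_def
    using measurable_restrict_lborel[OF assms(1)] by (intro integral_density) (auto simp: assms(2))
  also have "\<dots> = (\<integral>y. indicator {a..b} y *\<^sub>R (e y *\<^sub>R g y) \<partial>lborel)"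
    by (rule integral_restrict_space) auto
  also have "\<dots> = (\<integral>y. g y * e y \<partial>lborel)"
  proof (intro Bochner_Integration.integral_cong refl)
    fix y show "indicator {a..b} y *\<^sub>R (e y *\<^sub>R g y) = g y * e y"
      using assms(3)[of y] by (cases "y \<in> {a..b}") auto
  qed
  finally show ?thesis .
qed

lemma measure_density_measure:
  assumes "e \<in> borel_measurable borel" "\<And>y. 0 \<le> e y" "\<And>y. y \<notin> {a..b} \<Longrightarrow> e y = 0"
    "B \<in> sets (restrict_space borel {a..b})"
  shows "measure (density_measure a b e) B = (\<integral>y. indicator B y * e y \<partial>lborel)"
proof -
  have "B \<subseteq> {a..b}" using sets.sets_into_space[OF assms(4)] by (simp add: space_restrict_space)
  then have "measure (density_measure a b e) B = integral\<^sup>L (density_measure a b e) (indicator B)"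
    by (simp add: space_density_measure Int_absorb2)
  also have "\<dots> = (\<integral>y. indicator B y * e y \<partial>lborel)"
    using assms by (intro integral_density_measure borel_measurable_indicator) auto
  finally show ?thesis .
qed

lemma emeasure_density_measure_total:
  assumes "e \<in> borel_measurable borel" "\<And>y. 0 \<le> e y" "\<And>y. y \<notin> {a..b} \<Longrightarrow> e y = 0" "integrable lborel e"
  shows "emeasure (density_measure a b e) {a..b} = ennreal (\<integral>y. e y \<partial>lborel)"
proof -
  have "emeasure (density_measure a b e) {a..b} = (\<integral>\<^sup>+y. ennreal (e y) * indicator {a..b} y \<partial>restrict_space lborel {a..b})"
    unfolding density_measure_def using measurable_restrict_lborel[OF assms(1)]
    by (intro emeasure_density) (auto simp: sets_restrict_space)
  also have "\<dots> = (\<integral>\<^sup>+y. ennreal (e y) * indicator {a..b} y * indicator {a..b} y \<partial>lborel)"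
    by (intro nn_integral_restrict_space) auto
  also have "\<dots> = (\<integral>\<^sup>+y. ennreal (e y) \<partial>lborel)"
    by (intro nn_integral_cong) (auto simp: indicator_def assms(3))
  also have "\<dots> = ennreal (\<integral>y. e y \<partial>lborel)"
    by (intro nn_integral_eq_integral assms) (auto simp: assms(2))
  finally show ?thesis .
qed

lemma continuous_nbhd_greater:
  fixes f :: "real \<Rightarrow> real"
  assumes "continuous_on {a<..<b} f" "y \<in> {a<..<b}" "m < f y"
  obtains r where "r > 0" "\<And>z. \<bar>z - y\<bar> \<le> r \<Longrightarrow> z \<in> {a<..<b} \<and> m < f z"
proof -
  have "open ({a<..<b} \<inter> f -` {m<..})"
    using assms(1) by (intro continuous_open_preimage) auto
  moreover have "y \<in> {a<..<b} \<inter> f -` {m<..}" using assms by auto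
  ultimately obtain r where "r > 0" "cball y r \<subseteq> {a<..<b} \<inter> f -` {m<..}"
    using open_contains_cball by meson
  then show ?thesis
    by (intro that[of r]) (auto simp: subset_eq dist_real_def abs_minus_commute)
qed

section \<open>The equilibrium measure and the expansion of the energy around it\<close>

locale equilibrium_system = node_system a b \<rho> x
  for a b :: real and \<rho> x +
  fixes c :: real and G :: "complex set" and V :: "complex \<Rightarrow> complex" and \<mu> :: "real measure"
    and d :: "real \<Rightarrow> real"
  assumes c: "0 < c" "c < 1"
    and G: "open G" "complex_of_real ` {a..b} \<subseteq> G" "real_analytic_in G V"
    and equilibrium: "equilibrium_measure a b \<rho> V c \<mu>"
    and density: "continuous_density a b \<mu> d"
begin

abbreviation dens :: "real \<Rightarrow> real" where "dens \<equiv> zero_ext a b d"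
abbreviation phi :: "real \<Rightarrow> real" where "phi \<equiv> external_field a b \<rho> V"
definition dE :: "real \<Rightarrow> real" where "dE s = phi s - 2 * c * log_pot dens s"
definition J :: "(real \<Rightarrow> real) \<Rightarrow> real" where
  "J e = (\<integral>s. phi s * e s \<partial>lborel) - c * (\<integral>s. log_pot e s * e s \<partial>lborel)"

lemma d_cont: "continuous_on {a<..<b} d" and d_nonneg: "y \<in> {a<..<b} \<Longrightarrow> 0 \<le> d y"
  using density by (auto simp: continuous_density_def)

lemma dens_measurable [measurable]: "dens \<in> borel_measurable borel"
proof -
  have "(\<lambda>y. indicator {a<..<b} y *\<^sub>R d y) \<in> borel_measurable borel"
    by (intro borel_measurable_continuous_on_indicator d_cont) auto
  then show ?thesis by (simp add: zero_ext_def [abs_def])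
qed

lemma dens_nonneg: "0 \<le> dens y"
  using d_nonneg[of y] by (cases "y \<in> {a<..<b}") auto

lemma dens_outside: "y \<notin> {a..b} \<Longrightarrow> dens y = 0"
  by (rule zero_ext_simps) auto

lemma \<mu>_eq: "\<mu> = density_measure a b dens"
proof -
  \<comment> \<open>Comparing the two densities almost everywhere presupposes that \<open>d\<close>
    itself is measurable on the closed interval; on it, \<open>d\<close> is the zero extension with
    the two end values added back.\<close>
  have "(\<lambda>y. dens y + d a * indicator {a} y + d b * indicator {b} y) \<in> borel_measurable borel"
    by measurable
  then have m: "(\<lambda>y. dens y + d a * indicator {a} y + d b * indicator {b} y) \<in> borel_measurable (restrict_space lborel {a..b})"
    by (rule measurable_restrict_lborel)
  have "d \<in> borel_measurable (restrict_space lborel {a..b})"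
    by (rule measurable_cong[THEN iffD1, OF _ m]) (use ab in \<open>auto simp: space_restrict_space zero_ext_def indicator_def\<close>)
  then have dm: "(\<lambda>y. ennreal (d y)) \<in> borel_measurable (restrict_space lborel {a..b})"
    by simp
  have "AE y in restrict_space lborel {a..b}. ennreal (d y) = ennreal (dens y)"
    unfolding AE_restrict_space_iff[of "{a..b}" lborel, simplified]
    using AE_lborel_singleton[of a] AE_lborel_singleton[of b] by eventually_elim auto
  then have "density (restrict_space lborel {a..b}) (\<lambda>y. ennreal (d y)) = density_measure a b dens"
    unfolding density_measure_def using dm measurable_restrict_lborel[OF dens_measurable]
    by (intro density_cong) auto
  then show ?thesis using density by (simp add: continuous_density_def)
qed

lemma sets_Icc: "B \<in> sets (restrict_space borel {a..b}) \<Longrightarrow> B \<in> sets borel \<and> B \<subseteq> {a..b}"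
  by (auto simp: sets_restrict_space)

lemma LBINT_rho:
  assumes "B \<in> sets (restrict_space borel {a..b})"
  shows "(LBINT y:B. \<rho> y) = (\<integral>y. indicator B y * rho y \<partial>lborel)"
  unfolding set_lebesgue_integral_def
proof (rule Bochner_Integration.integral_cong_AE)
  have B: "B \<in> sets borel" "B \<subseteq> {a..b}" using sets_Icc[OF assms] by auto
  have [measurable]: "(\<lambda>y. indicator {a..b} y *\<^sub>R \<rho> y) \<in> borel_measurable borel"
    by (intro borel_measurable_continuous_on_indicator \<rho>_cont) auto
  have "(\<lambda>y. indicator B y * (indicator {a..b} y *\<^sub>R \<rho> y)) \<in> borel_measurable borel"
    using B(1) by measurable
  also have "(\<lambda>y. indicator B y * (indicator {a..b} y *\<^sub>R \<rho> y)) = (\<lambda>y. indicator B y *\<^sub>R \<rho> y)"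
    using B(2) by (intro ext) (auto simp: indicator_def)
  finally show "(\<lambda>y. indicator B y *\<^sub>R \<rho> y) \<in> borel_measurable lborel" by simp
  show "(\<lambda>y. indicator B y * rho y) \<in> borel_measurable lborel"
    using B(1) bounded_densityD(1)[OF rho_bounded_density] by measurable
  show "AE y in lborel. indicator B y *\<^sub>R \<rho> y = indicator B y * rho y"
    using AE_lborel_singleton[of a] AE_lborel_singleton[of b]
    by eventually_elim (use B(2) in \<open>auto simp: zero_ext_def indicator_def\<close>)
qed

text \<open>The constraint is given for masses of Borel sets only. A violation at one point would
  persist with a margin \<eta> on a whole interval, by continuity, and the mass of that interval
  would exceed its bound.\<close>

lemma d_le: "d y \<le> \<rho> y / c" if y: "y \<in> {a<..<b}"
proof (rule ccontr)
  assume "\<not> d y \<le> \<rho> y / c"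
  define \<eta> where "\<eta> = (d y - \<rho> y / c) / 2"
  have \<eta>: "\<eta> > 0" "\<eta> < d y - \<rho> y / c" using \<open>\<not> d y \<le> \<rho> y / c\<close> by (auto simp: \<eta>_def)
  have "continuous_on {a<..<b} (\<lambda>y. d y - \<rho> y / c)"
    by (intro continuous_intros d_cont continuous_on_subset[OF \<rho>_cont]) (use c in auto)
  from continuous_nbhd_greater[OF this y, of \<eta>] \<eta>(2)
  obtain r where r: "r > 0" "\<And>z. \<bar>z - y\<bar> \<le> r \<Longrightarrow> z \<in> {a<..<b} \<and> \<eta> < d z - \<rho> z / c"
    by blast
  define B where "B = {y - r..y + r}"
  have B: "z \<in> {a<..<b} \<and> \<eta> < d z - \<rho> z / c" if "z \<in> B" for z
    using r(2)[of z] that by (auto simp: B_def)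
  have BS: "B \<in> sets (restrict_space borel {a..b})"
    unfolding sets_restrict_space using B by (intro image_eqI[of _ _ B]) (auto simp: B_def)
  have "set_integrable lborel {y-r..y+r} d"
    by (intro borel_integrable_atLeastAtMost' continuous_on_subset[OF d_cont]) (use B in \<open>auto simp: B_def\<close>)
  then have dB: "integrable lborel (\<lambda>z. indicator B z * d z)"
    by (simp add: set_integrable_def B_def)
  have rB: "integrable lborel (\<lambda>z. indicator B z * rho z)"
    by (intro integrable_indicator_mult rho_integrable) (simp add: B_def)
  have iB0: "integrable lborel (indicat_real B)" by (simp add: B_def integrable_indicator_Icc)
  then have iB: "integrable lborel (\<lambda>z. \<eta> * indicator B z)" by (rule integrable_mult_right)
  have "measure \<mu> B \<le> (1 / c) * (LBINT z:B. \<rho> z)"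
    using equilibrium BS unfolding equilibrium_measure_def admissible_def by auto
  then have 1: "measure \<mu> B \<le> (1 / c) * (\<integral>z. indicator B z * rho z \<partial>lborel)"
    by (simp add: LBINT_rho[OF BS])
  have "measure \<mu> B = (\<integral>z. indicator B z * dens z \<partial>lborel)"
    unfolding \<mu>_eq by (rule measure_density_measure[OF _ _ _ BS]) (auto simp: dens_nonneg)
  also have "\<dots> = (\<integral>z. indicator B z * d z \<partial>lborel)"
    using B by (intro Bochner_Integration.integral_cong refl) (auto simp: indicator_def zero_ext_def)
  also have "\<dots> \<ge> (\<integral>z. (1 / c) * (indicator B z * rho z) + \<eta> * indicator B z \<partial>lborel)"
  proof (intro integral_mono Bochner_Integration.integrable_add integrable_mult_right rB iB0 dB)
    fix z show "(1 / c) * (indicator B z * rho z) + \<eta> * indicator B z \<le> indicator B z * d z"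
      using B[of z] by (cases "z \<in> B") (auto simp: zero_ext_def)
  qed
  also have "(\<integral>z. (1 / c) * (indicator B z * rho z) + \<eta> * indicator B z \<partial>lborel)
      = (1 / c) * (\<integral>z. indicator B z * rho z \<partial>lborel) + \<eta> * (2 * r)"
    using rB iB r(1) by (subst Bochner_Integration.integral_add) (auto simp: B_def)
  finally have "(1 / c) * (\<integral>z. indicator B z * rho z \<partial>lborel) + \<eta> * (2 * r) \<le> measure \<mu> B" .
  with 1 \<eta> r(1) show False by (smt (verit) mult_pos_pos)
qed

lemma dens_le: "dens y \<le> rho y / c"
  using d_le[of y] by (cases "y \<in> {a<..<b}") auto

lemma bounded_density_of_le:
  assumes "e \<in> borel_measurable borel" "\<And>y. 0 \<le> e y" "\<And>y. e y \<le> rho y / c"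
  shows "bounded_density a b (\<rho>max / c) e"
  unfolding bounded_density_def
proof (intro conjI allI assms(1))
  fix y
  have "rho y / c \<le> \<rho>max * indicator {a..b} y / c"
    using bounded_densityD(2)[OF rho_bounded_density, of y] c by (intro divide_right_mono) auto
  then show "\<bar>e y\<bar> \<le> \<rho>max / c * indicator {a..b} y" using assms(2,3)[of y] by simp
qed

lemmas dens_bounded = bounded_density_of_le[OF dens_measurable dens_nonneg dens_le]
lemmas dens_integrable = bounded_density_integrable[OF dens_bounded]

lemma dens_total: "(\<integral>y. dens y \<partial>lborel) = 1"
proof -
  have "emeasure \<mu> {a..b} = 1"
    using equilibrium by (simp add: equilibrium_measure_def admissible_def)
  then have "ennreal (\<integral>y. dens y \<partial>lborel) = 1"
    unfolding \<mu>_eq using emeasure_density_measure_total[OF dens_measurable dens_nonneg dens_outside dens_integrable]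
    by simp
  then show ?thesis by (simp add: ennreal_eq_1)
qed

lemma phi_eq: "phi t = Re (V (complex_of_real t)) + log_pot rho t"
proof -
  have "(LBINT y:{a..b}. ln \<bar>t - y\<bar> * \<rho> y) = log_pot rho t"
    unfolding log_pot_def set_lebesgue_integral_def
  proof (rule Bochner_Integration.integral_cong_AE)
    have [measurable]: "(\<lambda>y. indicator {a..b} y *\<^sub>R \<rho> y) \<in> borel_measurable borel"
      by (intro borel_measurable_continuous_on_indicator \<rho>_cont) auto
    have "(\<lambda>y. ln \<bar>t - y\<bar> * (indicator {a..b} y *\<^sub>R \<rho> y)) \<in> borel_measurable borel"
      by measurable
    then show "(\<lambda>y. indicator {a..b} y *\<^sub>R (ln \<bar>t - y\<bar> * \<rho> y)) \<in> borel_measurable lborel"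
      by (simp add: mult.left_commute)
    show "(\<lambda>y. ln \<bar>t - y\<bar> * rho y) \<in> borel_measurable lborel"
      using bounded_densityD(1)[OF rho_bounded_density] by measurable
    show "AE y in lborel. indicator {a..b} y *\<^sub>R (ln \<bar>t - y\<bar> * \<rho> y) = ln \<bar>t - y\<bar> * rho y"
      using AE_lborel_singleton[of a] AE_lborel_singleton[of b]
      by eventually_elim (auto simp: zero_ext_def indicator_def)
  qed
  then show ?thesis by (simp add: external_field_def)
qed

lemma V_cont: "continuous_on {a..b} (\<lambda>t. V (complex_of_real t))"
proof -
  have "continuous_on G V" using G by (auto simp: real_analytic_in_def holomorphic_on_imp_continuous_on)
  then have "continuous_on (complex_of_real ` {a..b}) V" using G(2) by (rule continuous_on_subset)
  from continuous_on_compose[OF _ this] show ?thesis by (simp add: o_def continuous_on_of_real)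
qed

lemma phi_cont: "continuous_on {a..b} phi"
  unfolding phi_eq using ab
  by (intro continuous_intros continuous_on_Re V_cont log_pot_continuous[OF rho_bounded_density]) auto

lemma dE_cont: "continuous_on {a..b} dE"
  unfolding dE_def using ab
  by (intro continuous_intros phi_cont log_pot_continuous[OF dens_bounded]) auto

lemma variational_derivative_eq: "variational_derivative a b \<rho> V c \<mu> t = dE t"
proof -
  have "(\<lambda>y. ln \<bar>t - y\<bar>) \<in> borel_measurable (restrict_space borel {a..b})"
    by (intro measurable_restrict_space1) measurable
  then have "(\<integral>y. ln \<bar>t - y\<bar> \<partial>\<mu>) = log_pot dens t"
    unfolding \<mu>_eq log_pot_def by (intro integral_density_measure dens_measurable dens_nonneg dens_outside)
  then show ?thesis by (simp add: variational_derivative_def dE_def)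
qed

text \<open>The energy uses the logarithm of the reciprocal distance, opposite in sign to
  \<open>log_pot\<close>; hence the minus sign in \<open>J\<close>.\<close>

lemma energy_density_measure:
  assumes "bounded_density a b C e" "\<And>y. 0 \<le> e y"
  shows "energy a b \<rho> V c (density_measure a b e) = J e"
proof -
  note e = bounded_densityD[OF assms(1)]
  have I: "integral\<^sup>L (density_measure a b e) g = (\<integral>y. g y * e y \<partial>lborel)"
    if "g \<in> borel_measurable (restrict_space borel {a..b})" for g :: "real \<Rightarrow> real"
    by (intro integral_density_measure e(1) assms(2) e(3) that)
  have 1: "(\<integral>y. ln (1 / \<bar>s - y\<bar>) \<partial>density_measure a b e) = - log_pot e s" for s
  proof -
    have "(\<lambda>y. ln (1 / \<bar>s - y\<bar>)) \<in> borel_measurable (restrict_space borel {a..b})"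
      by (intro measurable_restrict_space1) measurable
    then have "(\<integral>y. ln (1 / \<bar>s - y\<bar>) \<partial>density_measure a b e) = (\<integral>y. ln (1 / \<bar>s - y\<bar>) * e y \<partial>lborel)"
      by (rule I)
    also have "\<dots> = (\<integral>y. - (ln \<bar>s - y\<bar> * e y) \<partial>lborel)"
      by (intro Bochner_Integration.integral_cong refl) (simp add: ln_div)
    finally show ?thesis by (simp add: log_pot_def)
  qed
  have "continuous_on {a..b} (\<lambda>s. - log_pot e s)"
    using ab by (intro continuous_intros log_pot_continuous[OF assms(1)]) auto
  then have 2: "(\<integral>s. - log_pot e s \<partial>density_measure a b e) = (\<integral>s. - log_pot e s * e s \<partial>lborel)"
    by (intro I borel_measurable_continuous_on_restrict)
  have 3: "(\<integral>s. phi s \<partial>density_measure a b e) = (\<integral>s. phi s * e s \<partial>lborel)"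
    by (intro I borel_measurable_continuous_on_restrict phi_cont)
  show ?thesis unfolding energy_def 1 2 3 J_def by simp
qed

text \<open>A pointwise bound on the density integrates to the constraint on every Borel set, so
  such an \<open>e\<close> is an admissible competitor. Competitors with a density are all that the
  variation below requires.\<close>

lemma J_minimal:
  assumes "e \<in> borel_measurable borel" "\<And>y. 0 \<le> e y" "\<And>y. e y \<le> rho y / c" "(\<integral>y. e y \<partial>lborel) = 1"
  shows "J dens \<le> J e"
proof -
  note e = bounded_density_of_le[OF assms(1-3)]
  note ei = bounded_density_integrable[OF e]
  have "admissible a b \<rho> c (density_measure a b e)"
    unfolding admissible_def
  proof (intro conjI ballI)
    show "sets (density_measure a b e) = sets (restrict_space borel {a..b})"
      by (rule sets_density_measure)
    show "emeasure (density_measure a b e) {a..b} = 1"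
      using emeasure_density_measure_total[OF assms(1,2) bounded_densityD(3)[OF e] ei] assms(4) by simp
    fix B assume "B \<in> sets (density_measure a b e)"
    then have B: "B \<in> sets (restrict_space borel {a..b})" by (simp add: sets_density_measure)
    then have B': "B \<in> sets borel" using sets_Icc by auto
    have "measure (density_measure a b e) B = (\<integral>y. indicator B y * e y \<partial>lborel)"
      by (rule measure_density_measure[OF assms(1,2) bounded_densityD(3)[OF e] B])
    also have "\<dots> \<le> (\<integral>y. (1 / c) * (indicator B y * rho y) \<partial>lborel)"
      using B' assms(3)
      by (intro integral_mono integrable_mult_right integrable_indicator_mult ei rho_integrable)
        (auto simp: indicator_def)
    finally show "measure (density_measure a b e) B \<le> (1 / c) * (LBINT y:B. \<rho> y)"
      by (simp add: LBINT_rho[OF B])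
  qed
  then have "energy a b \<rho> V c \<mu> \<le> energy a b \<rho> V c (density_measure a b e)"
    using equilibrium by (simp add: equilibrium_measure_def)
  then show ?thesis
    unfolding \<mu>_eq energy_density_measure[OF dens_bounded dens_nonneg] energy_density_measure[OF e assms(2)] .
qed

text \<open>The energy is quadratic in the density, so the expansion is exact and there is no
  remainder to estimate. The two cross terms agree by \<open>log_pot_symmetric\<close>, which is the
  origin of the factor 2 in \<open>dE\<close>.\<close>

lemma J_perturb:
  assumes h: "bounded_density a b C h"
  shows "J (\<lambda>y. dens y + t * h y) =
    J dens + t * (\<integral>s. dE s * h s \<partial>lborel) - c * t\<^sup>2 * (\<integral>s. log_pot h s * h s \<partial>lborel)"
proof -
  have ab': "a \<le> b" using ab by simp
  note U = log_pot_continuous[OF dens_bounded ab', of "{a..b}"] log_pot_continuous[OF h ab', of "{a..b}"]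
  note i = integrable_continuous_mult_density[OF U(1) dens_bounded] integrable_continuous_mult_density[OF U(1) h]
    integrable_continuous_mult_density[OF U(2) dens_bounded] integrable_continuous_mult_density[OF U(2) h]
    integrable_continuous_mult_density[OF phi_cont h] integrable_continuous_mult_density[OF phi_cont dens_bounded]
  have "(\<integral>s. log_pot (\<lambda>y. dens y + t * h y) s * (dens s + t * h s) \<partial>lborel) =
    (\<integral>s. (log_pot dens s * dens s + t * (log_pot dens s * h s)) +
       (t * (log_pot h s * dens s) + t\<^sup>2 * (log_pot h s * h s)) \<partial>lborel)"
    unfolding log_pot_linear[OF dens_bounded h ab']
    by (intro Bochner_Integration.integral_cong) (auto simp: algebra_simps power2_eq_square)
  also have "\<dots> = (\<integral>s. log_pot dens s * dens s \<partial>lborel) + t * (\<integral>s. log_pot dens s * h s \<partial>lborel) +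
       (t * (\<integral>s. log_pot h s * dens s \<partial>lborel) + t\<^sup>2 * (\<integral>s. log_pot h s * h s \<partial>lborel))"
    using i by simp
  also have "(\<integral>s. log_pot h s * dens s \<partial>lborel) = (\<integral>s. log_pot dens s * h s \<partial>lborel)"
    by (rule log_pot_symmetric[OF h dens_bounded ab'])
  finally have 1: "(\<integral>s. log_pot (\<lambda>y. dens y + t * h y) s * (dens s + t * h s) \<partial>lborel) =
     (\<integral>s. log_pot dens s * dens s \<partial>lborel) + 2 * t * (\<integral>s. log_pot dens s * h s \<partial>lborel) +
      t\<^sup>2 * (\<integral>s. log_pot h s * h s \<partial>lborel)" by simp
  have 2: "(\<integral>s. phi s * (dens s + t * h s) \<partial>lborel) =
     (\<integral>s. phi s * dens s \<partial>lborel) + t * (\<integral>s. phi s * h s \<partial>lborel)"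
    using i by (simp add: distrib_left mult.left_commute[of _ t])
  have "(\<integral>s. dE s * h s \<partial>lborel) = (\<integral>s. phi s * h s - 2 * c * (log_pot dens s * h s) \<partial>lborel)"
    unfolding dE_def by (simp add: left_diff_distrib mult.assoc)
  also have "\<dots> = (\<integral>s. phi s * h s \<partial>lborel) - 2 * c * (\<integral>s. log_pot dens s * h s \<partial>lborel)"
    using i by simp
  finally have 3: "(\<integral>s. dE s * h s \<partial>lborel) =
      (\<integral>s. phi s * h s \<partial>lborel) - 2 * c * (\<integral>s. log_pot dens s * h s \<partial>lborel)" .
  show ?thesis unfolding J_def 1 2 3 by (simp add: algebra_simps)
qed

end

section \<open>The Euler--Lagrange inequality\<close>

lemma open_bounded_connected_real:
  fixes I :: "real set"
  assumes "open I" "connected I" "I \<noteq> {}" "I \<subseteq> {a<..<b}"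
  obtains u v where "a \<le> u" "u < v" "v \<le> b" "I = {u<..<v}"
proof -
  have bdd: "bdd_below I" "bdd_above I"
    using assms(4) by (auto intro!: bdd_belowI[of _ a] bdd_aboveI[of _ b])
  have *: "\<exists>y1\<in>I. \<exists>y2\<in>I. y1 < y \<and> y < y2" if y: "y \<in> I" for y
  proof -
    obtain e where "e > 0" "cball y e \<subseteq> I" using assms(1) y open_contains_cball by meson
    then have "y - e \<in> I" "y + e \<in> I" by (auto simp: subset_eq dist_real_def)
    then show ?thesis using \<open>e > 0\<close> by (intro bexI[of _ "y - e"] bexI[of _ "y + e"]) auto
  qed
  have "I = {Inf I<..<Sup I}"
  proof (intro equalityI subsetI)
    fix y assume "y \<in> I"
    then obtain y1 y2 where "y1 \<in> I" "y2 \<in> I" "y1 < y" "y < y2" using * by blast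
    then show "y \<in> {Inf I<..<Sup I}"
      using cInf_lower[OF _ bdd(1), of y1] cSup_upper[OF _ bdd(2), of y2] by auto
  next
    fix y assume y: "y \<in> {Inf I<..<Sup I}"
    obtain y1 where y1: "y1 \<in> I" "y1 < y" using cInf_lessD[OF assms(3), of y] y by auto
    obtain y2 where y2: "y2 \<in> I" "y < y2" using less_cSupD[OF assms(3), of y] y by auto
    show "y \<in> I" using connected_contains_Icc[OF assms(2) y1(1) y2(1)] y1 y2 by auto
  qed
  moreover have "a \<le> Inf I" "Sup I \<le> b"
    using assms(3,4) by (auto intro!: cInf_greatest cSup_least)
  moreover have "Inf I < Sup I" using calculation(1) assms(3) by auto
  ultimately show ?thesis by (intro that[of "Inf I" "Sup I"]) auto
qed

context equilibrium_system
begin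

text \<open>If the inequality failed, moving a little mass from a neighbourhood of
  \<open>x0\<close>, where some is present, to one of \<open>x1\<close>, where there is room below
  the constraint, would lower the energy to first order.\<close>

lemma euler_lagrange:
  assumes x0: "x0 \<in> {a<..<b}" "0 < d x0" and x1: "x1 \<in> {a<..<b}" "d x1 < \<rho> x1 / c"
  shows "dE x0 \<le> dE x1"
proof (rule ccontr)
  assume "\<not> dE x0 \<le> dE x1"
  then obtain m1 where "dE x1 < m1" "m1 < dE x0" using dense[of "dE x1" "dE x0"] by auto
  then obtain m2 where m: "dE x1 < m1" "m1 < m2" "m2 < dE x0" using dense[of m1 "dE x0"] by auto
  have dEc: "continuous_on {a<..<b} dE" by (rule continuous_on_subset[OF dE_cont]) auto
  have \<rho>c: "continuous_on {a<..<b} \<rho>" by (rule continuous_on_subset[OF \<rho>_cont]) auto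
  define t1 where "t1 = d x0 / 2"
  obtain t2 where t2: "0 < t2" "t2 < \<rho> x1 / c - d x1"
    using dense[of 0 "\<rho> x1 / c - d x1"] x1(2) by auto
  obtain r1 where r1: "r1 > 0" "\<And>z. \<bar>z - x0\<bar> \<le> r1 \<Longrightarrow> z \<in> {a<..<b} \<and> m2 < dE z"
    using continuous_nbhd_greater[OF dEc x0(1) m(3)] by blast
  have "continuous_on {a<..<b} (\<lambda>y. - dE y)" by (intro continuous_intros dEc)
  from continuous_nbhd_greater[OF this x1(1), of "- m1"]
  obtain r2 where r2: "r2 > 0" "\<And>z. \<bar>z - x1\<bar> \<le> r2 \<Longrightarrow> z \<in> {a<..<b} \<and> - m1 < - dE z"
    using m(1) by auto
  obtain r3 where r3: "r3 > 0" "\<And>z. \<bar>z - x0\<bar> \<le> r3 \<Longrightarrow> z \<in> {a<..<b} \<and> t1 < d z"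
    using continuous_nbhd_greater[OF d_cont x0(1), of t1] x0(2) by (auto simp: t1_def)
  have "continuous_on {a<..<b} (\<lambda>y. \<rho> y / c - d y)"
    by (intro continuous_intros d_cont \<rho>c) (use c in auto)
  from continuous_nbhd_greater[OF this x1(1), of t2]
  obtain r4 where r4: "r4 > 0" "\<And>z. \<bar>z - x1\<bar> \<le> r4 \<Longrightarrow> z \<in> {a<..<b} \<and> t2 < \<rho> z / c - d z"
    using t2 by blast
  \<comment> \<open>One radius for both neighbourhoods: they get equal length, so the perturbation
    \<open>h\<close> below has integral 0 and preserves the total mass.\<close>
  define r where "r = Min {r1, r2, r3, r4}"
  have r: "r > 0" "r \<le> r1" "r \<le> r2" "r \<le> r3" "r \<le> r4" using r1 r2 r3 r4 by (auto simp: r_def)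
  define t0 where "t0 = min t1 t2"
  have t0: "t0 > 0" "t0 \<le> t1" "t0 \<le> t2" using x0 t2 by (auto simp: t0_def t1_def)
  define B0 where "B0 = {x0 - r..x0 + r}"
  define B1 where "B1 = {x1 - r..x1 + r}"
  have B0: "z \<in> {a<..<b}" "m2 < dE z" "t0 < d z" if "z \<in> B0" for z
  proof -
    have "\<bar>z - x0\<bar> \<le> r" using that by (auto simp: B0_def)
    then have "\<bar>z - x0\<bar> \<le> r1" "\<bar>z - x0\<bar> \<le> r3" using r by linarith+
    from r1(2)[OF this(1)] r3(2)[OF this(2)] t0
    show "z \<in> {a<..<b}" "m2 < dE z" "t0 < d z" by auto
  qed
  have B1: "z \<in> {a<..<b}" "dE z < m1" "t0 < \<rho> z / c - d z" if "z \<in> B1" for z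
  proof -
    have "\<bar>z - x1\<bar> \<le> r" using that by (auto simp: B1_def)
    then have "\<bar>z - x1\<bar> \<le> r2" "\<bar>z - x1\<bar> \<le> r4" using r by linarith+
    from r2(2)[OF this(1)] r4(2)[OF this(2)] t0
    show "z \<in> {a<..<b}" "dE z < m1" "t0 < \<rho> z / c - d z" by auto
  qed
  have bdI: "bounded_density a b 1 (indicat_real B)" if "B \<in> sets borel" "B \<subseteq> {a..b}" for B
    using that by (auto simp: bounded_density_def indicator_def)
  have "B0 \<subseteq> {a<..<b}" "B1 \<subseteq> {a<..<b}" using B0(1) B1(1) by blast+
  then have "B0 \<subseteq> {a..b}" "B1 \<subseteq> {a..b}" by fastforce+
  then have bd: "bounded_density a b 1 (indicat_real B0)" "bounded_density a b 1 (indicat_real B1)"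
    by (auto intro!: bdI simp: B0_def B1_def)
  have intB: "(\<integral>z. indicat_real B0 z \<partial>lborel) = 2 * r" "(\<integral>z. indicat_real B1 z \<partial>lborel) = 2 * r"
    using r(1) by (simp_all add: B0_def B1_def)
  note ib = bounded_density_integrable[OF bd(1)] bounded_density_integrable[OF bd(2)]
  define h where "h y = indicat_real B1 y + (-1) * indicat_real B0 y" for y
  have h: "bounded_density a b (1 + \<bar>-1\<bar> * 1) h"
    unfolding h_def by (intro bounded_density_add bounded_density_cmult bd)
  define Q where "Q = (\<integral>s. dE s * h s \<partial>lborel)"
  define W where "W = (\<integral>s. log_pot h s * h s \<partial>lborel)"
  note iE = integrable_continuous_mult_density[OF dE_cont bd(1)] integrable_continuous_mult_density[OF dE_cont bd(2)]
  have "Q = (\<integral>s. dE s * indicat_real B1 s - dE s * indicat_real B0 s \<partial>lborel)"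
    unfolding Q_def h_def by (intro Bochner_Integration.integral_cong) (auto simp: algebra_simps)
  also have "\<dots> = (\<integral>s. dE s * indicat_real B1 s \<partial>lborel) - (\<integral>s. dE s * indicat_real B0 s \<partial>lborel)"
    by (intro Bochner_Integration.integral_diff iE)
  finally have Q1: "Q = (\<integral>s. dE s * indicat_real B1 s \<partial>lborel) - (\<integral>s. dE s * indicat_real B0 s \<partial>lborel)" .
  have "(\<integral>s. dE s * indicat_real B1 s \<partial>lborel) \<le> (\<integral>s. m1 * indicat_real B1 s \<partial>lborel)"
    by (intro integral_mono integrable_mult_right ib iE)
      (use B1(2) in \<open>auto simp: indicator_def intro: less_imp_le\<close>)
  moreover have "(\<integral>s. m2 * indicat_real B0 s \<partial>lborel) \<le> (\<integral>s. dE s * indicat_real B0 s \<partial>lborel)"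
    by (intro integral_mono integrable_mult_right ib iE)
      (use B0(2) in \<open>auto simp: indicator_def intro: less_imp_le\<close>)
  ultimately have "Q \<le> m1 * (2 * r) - m2 * (2 * r)" unfolding Q1 integral_mult_right_zero intB by linarith
  also have "\<dots> < 0" using m(2) r(1) by simp
  finally have Q: "Q < 0" .
  \<comment> \<open>The bound \<open>t0\<close> keeps the perturbed density between 0 and the
    constraint. The other bound makes the quadratic term at most half of the linear one in size; the
    added 1 avoids division by 0.\<close>
  define t where "t = min t0 (- Q / (2 * c * (\<bar>W\<bar> + 1)))"
  have t: "t > 0" "t \<le> t0" "t \<le> - Q / (2 * c * (\<bar>W\<bar> + 1))"
  proof -
    have "0 < - Q / (2 * c * (\<bar>W\<bar> + 1))" using Q c by (intro divide_pos_pos mult_pos_pos) auto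
    then show "t > 0" "t \<le> t0" "t \<le> - Q / (2 * c * (\<bar>W\<bar> + 1))" using t0 by (auto simp: t_def)
  qed
  have "J dens \<le> J (\<lambda>y. dens y + t * h y)"
  proof (rule J_minimal)
    show "(\<lambda>y. dens y + t * h y) \<in> borel_measurable borel"
      using bounded_densityD(1)[OF h] by measurable
    show "0 \<le> dens y + t * h y" for y
      using B0[of y] B1[of y] t dens_nonneg[of y] by (auto simp: h_def indicator_def)
    show "dens y + t * h y \<le> rho y / c" for y
      using B0[of y] B1[of y] t dens_le[of y] by (auto simp: h_def indicator_def)
    show "(\<integral>y. dens y + t * h y \<partial>lborel) = 1"
    proof -
      have "(\<integral>y. h y \<partial>lborel) = (\<integral>y. indicat_real B1 y \<partial>lborel) + (-1) * (\<integral>y. indicat_real B0 y \<partial>lborel)"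
        unfolding h_def using ib by (subst Bochner_Integration.integral_add) auto
      then have "(\<integral>y. h y \<partial>lborel) = 0" unfolding intB by simp
      then show ?thesis using dens_integrable bounded_density_integrable[OF h] by (simp add: dens_total)
    qed
  qed
  then have "0 \<le> t * Q - c * t\<^sup>2 * W"
    unfolding J_perturb[OF h] Q_def W_def by simp
  also have "\<dots> = t * (Q - c * t * W)" by (simp add: algebra_simps power2_eq_square)
  finally have "0 \<le> Q - c * t * W" using t(1) by (simp add: zero_le_mult_iff)
  moreover have "- (c * t * W) \<le> c * t * (\<bar>W\<bar> + 1)"
  proof -
    have "c * t * (- W) \<le> c * t * (\<bar>W\<bar> + 1)" using c t by (intro mult_left_mono) auto
    then show ?thesis by simp
  qed
  moreover have "c * t * (\<bar>W\<bar> + 1) \<le> - Q / 2"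
  proof -
    have "t * (2 * c * (\<bar>W\<bar> + 1)) \<le> - Q"
      using t(3) c by (subst (asm) pos_le_divide_eq) auto
    moreover have "t * (2 * c * (\<bar>W\<bar> + 1)) = 2 * (c * t * (\<bar>W\<bar> + 1))" by (simp only: mult_ac)
    moreover have "X \<le> - Q / 2" if "2 * X \<le> - Q" for X using that by simp
    ultimately show ?thesis by metis
  qed
  ultimately show False using Q by linarith
qed

text \<open>Otherwise \<open>c * d y / \<rho> y\<close> is continuous with values in
  \<open>{0, 1}\<close> on a connected set, hence constant, and the total mass would be 0 or
  \<open>1 / c\<close>, never 1.\<close>

lemma exists_unsaturated_point: "\<exists>y\<in>{a<..<b}. 0 < d y \<and> d y < \<rho> y / c"
proof (rule ccontr)
  assume "\<not> ?thesis"
  then have *: "d y = 0 \<or> d y = \<rho> y / c" if "y \<in> {a<..<b}" for y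
    using d_nonneg[OF that] d_le[OF that] that by force
  define q where "q y = c * d y / \<rho> y" for y
  have q: "q y = 0 \<longleftrightarrow> d y = 0" "q y = 1 \<longleftrightarrow> d y = \<rho> y / c" if "y \<in> {a<..<b}" for y
    using \<rho>_pos[of y] c that by (auto simp: q_def field_simps)
  have q01: "q y = 0 \<or> q y = 1" if "y \<in> {a<..<b}" for y using *[OF that] q[OF that] by auto
  have "continuous_on {a<..<b} q"
    unfolding q_def using \<rho>_pos
    by (intro continuous_intros d_cont continuous_on_subset[OF \<rho>_cont]) (auto simp: less_imp_neq[symmetric])
  then have conn: "connected (q ` {a<..<b})" by (intro connected_continuous_image) auto
  consider "\<forall>y\<in>{a<..<b}. q y = 0" | "\<forall>y\<in>{a<..<b}. q y = 1"
  proof (cases "\<exists>y1\<in>{a<..<b}. \<exists>y2\<in>{a<..<b}. q y1 = 0 \<and> q y2 = 1")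
    case True
    then obtain y1 y2 where "y1 \<in> {a<..<b}" "y2 \<in> {a<..<b}" "q y1 = 0" "q y2 = 1" by blast
    then have "{0..1} \<subseteq> q ` {a<..<b}"
      by (intro connected_contains_Icc[OF conn]) force+
    then have "1 / 2 \<in> q ` {a<..<b}" by auto
    then show ?thesis using q01 by force
  qed (use q01 that in blast)
  then show False
  proof cases
    case 1
    then have "dens = (\<lambda>_. 0)" using q by (intro ext) (auto simp: zero_ext_def indicator_def)
    then show False using dens_total by simp
  next
    case 2
    then have "dens = (\<lambda>y. rho y / c)" using q by (intro ext) (auto simp: zero_ext_def indicator_def)
    moreover have "(\<integral>y. rho y \<partial>lborel) = 1"
    proof -
      have "(\<integral>y. rho y \<partial>lborel) = mass rho a b"
        unfolding mass_def by (intro Bochner_Integration.integral_cong) (auto simp: zero_ext_def indicator_def)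
      then show ?thesis by (simp add: mass_rho_total)
    qed
    ultimately show False using dens_total c by simp
  qed
qed

end

section \<open>Analyticity of the density on bands\<close>

text \<open>\<open>Ln (- \<i> * w)\<close>, unlike \<open>Ln w\<close>, has its branch cut on the negative imaginary axis, so it is
  continuous up to the real axis from above, as Schwarz reflection requires.\<close>

lemma upper_Ln_cont:
  assumes "0 \<le> Im w" "w \<noteq> 0"
  shows "isCont (\<lambda>w. Ln (- \<i> * w)) w"
proof -
  have "- \<i> * w \<notin> \<real>\<^sub>\<le>\<^sub>0"
    using assms by (auto simp: complex_nonpos_Reals_iff complex_eq_iff)
  then show ?thesis by (intro continuous_intros) auto
qed

lemma upper_Ln_deriv:
  assumes "0 < Im w"
  shows "((\<lambda>w. Ln (- \<i> * (w - of_real t))) has_field_derivative 1 / (w - of_real t)) (at w)"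
proof -
  have "- \<i> * (w - of_real t) \<notin> \<real>\<^sub>\<le>\<^sub>0" "w - of_real t \<noteq> 0"
    using assms by (auto simp: complex_nonpos_Reals_iff complex_eq_iff)
  then show ?thesis
    by (auto intro!: derivative_eq_intros simp: field_simps)
qed

lemma Re_upper_Ln: "w \<noteq> 0 \<Longrightarrow> Re (Ln (- \<i> * w)) = ln (cmod w)"
  by (simp add: norm_mult)

lemma Im_upper_Ln_le: "w \<noteq> 0 \<Longrightarrow> \<bar>Im (Ln (- \<i> * w))\<bar> \<le> pi"
  using mpi_less_Im_Ln[of "- \<i> * w"] Im_Ln_le_pi[of "- \<i> * w"] by auto

lemma Im_upper_Ln_real:
  fixes t :: real
  assumes "t \<noteq> 0"
  shows "Im (Ln (- \<i> * of_real t)) = - (pi / 2) * sgn t"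
proof (cases "t > 0")
  case True
  then have "Ln (of_real t * (- \<i>)) = of_real (ln t) + Ln (- \<i>)"
    using Ln_times_of_real[of t "- \<i>"] by (simp add: Ln_of_real)
  then show ?thesis using True by (simp add: mult.commute)
next
  case False
  then have "Ln (of_real (-t) * \<i>) = of_real (ln (-t)) + Ln \<i>"
    using assms Ln_times_of_real[of "-t" "\<i>"] by (simp add: Ln_of_real del: of_real_minus)
  then show ?thesis using False assms by (simp add: mult.commute)
qed

text \<open>In the upper half-plane this is a primitive of the Cauchy transform of \<open>s\<close>.
  Its real part is the logarithmic potential; its imaginary part on the real axis records the
  distribution function.\<close>

definition log_trans :: "(real \<Rightarrow> real) \<Rightarrow> complex \<Rightarrow> complex" where
  "log_trans s z = (\<integral>y. of_real (s y) * Ln (- \<i> * (z - of_real y)) \<partial>lborel)"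

lemma AE_ne_complex: "AE y in lborel. z - complex_of_real y \<noteq> 0"
  using AE_lborel_singleton[of "Re z"] by eventually_elim auto

lemma bounded_density_Im_integrable:
  assumes "bounded_density a b C s"
  shows "integrable lborel (\<lambda>y. Im (Ln (- \<i> * (z - of_real y))) * s y)"
proof (rule Bochner_Integration.integrable_bound)
  note [measurable] = bounded_densityD(1)[OF assms]
  show "integrable lborel (\<lambda>y. pi * s y)" using bounded_density_integrable[OF assms] by simp
  show "(\<lambda>y. Im (Ln (- \<i> * (z - of_real y))) * s y) \<in> borel_measurable lborel" by measurable
  show "AE y in lborel. norm (Im (Ln (- \<i> * (z - of_real y))) * s y) \<le> norm (pi * s y)"
    using AE_ne_complex[of z]
    by eventually_elim (use Im_upper_Ln_le in \<open>auto simp: abs_mult intro!: mult_right_mono simp del: mult_minus_left\<close>)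
qed

lemma log_trans_integrable:
  assumes "bounded_density a b C s" "a \<le> b"
  shows "integrable lborel (\<lambda>y. of_real (s y) * Ln (- \<i> * (z - of_real y)))"
proof -
  note [measurable] = bounded_densityD(1)[OF assms(1)]
  have "integrable lborel (\<lambda>y. of_real (ln (cmod (z - of_real y)) * s y)
     + \<i> * of_real (Im (Ln (- \<i> * (z - of_real y))) * s y))"
    using log_potential_integrable[OF assms] bounded_density_Im_integrable[OF assms(1)]
    by (intro Bochner_Integration.integrable_add integrable_mult_right integrable_of_real) auto
  then show ?thesis
  proof (rule integrable_cong_AE_imp)
    show "(\<lambda>y. of_real (s y) * Ln (- \<i> * (z - of_real y))) \<in> borel_measurable lborel" by measurable
    show "AE y in lborel. of_real (ln (cmod (z - of_real y)) * s y)
     + \<i> * of_real (Im (Ln (- \<i> * (z - of_real y))) * s y) = of_real (s y) * Ln (- \<i> * (z - of_real y))"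
      using AE_ne_complex[of z]
    proof eventually_elim
      case (elim y)
      define L where "L = Ln (- \<i> * (z - of_real y))"
      have "Re L = ln (cmod (z - of_real y))" unfolding L_def by (rule Re_upper_Ln[OF elim])
      then show ?case unfolding L_def[symmetric] by (simp add: complex_eq_iff)
    qed
  qed
qed

lemma Re_log_trans:
  assumes "bounded_density a b C s" "a \<le> b"
  shows "Re (log_trans s z) = (\<integral>y. ln (cmod (z - of_real y)) * s y \<partial>lborel)"
proof -
  note [measurable] = bounded_densityD(1)[OF assms(1)]
  have "Re (log_trans s z) = (\<integral>y. Re (of_real (s y) * Ln (- \<i> * (z - of_real y))) \<partial>lborel)"
    unfolding log_trans_def by (rule integral_Re[OF log_trans_integrable[OF assms], symmetric])
  also have "\<dots> = (\<integral>y. ln (cmod (z - of_real y)) * s y \<partial>lborel)"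
  proof (rule Bochner_Integration.integral_cong_AE)
    show "AE y in lborel. Re (of_real (s y) * Ln (- \<i> * (z - of_real y))) = ln (cmod (z - of_real y)) * s y"
      using AE_ne_complex[of z] by eventually_elim (use Re_upper_Ln in \<open>simp del: mult_minus_left\<close>)
  qed measurable
  finally show ?thesis .
qed

lemma Im_log_trans:
  assumes "bounded_density a b C s" "a \<le> b"
  shows "Im (log_trans s z) = (\<integral>y. Im (Ln (- \<i> * (z - of_real y))) * s y \<partial>lborel)"
proof -
  have "Im (log_trans s z) = (\<integral>y. Im (of_real (s y) * Ln (- \<i> * (z - of_real y))) \<partial>lborel)"
    unfolding log_trans_def by (rule integral_Im[OF log_trans_integrable[OF assms], symmetric])
  also have "\<dots> = (\<integral>y. Im (Ln (- \<i> * (z - of_real y))) * s y \<partial>lborel)"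
    by (intro Bochner_Integration.integral_cong) (simp_all del: mult_minus_left add: mult.commute)
  finally show ?thesis .
qed

text \<open>Real and imaginary part need different arguments. The real part is unbounded under the
  integral but covered by the Hoelder estimate; the imaginary part has no modulus of continuity at
  hand but is bounded by \<open>pi\<close>, so dominated convergence applies.\<close>

lemma log_trans_continuous:
  assumes "bounded_density a b C s" "a \<le> b"
  shows "continuous_on {z. 0 \<le> Im z} (log_trans s)"
proof -
  note [measurable] = bounded_densityD(1)[OF assms(1)]
  have "continuous_on {z. 0 \<le> Im z} (\<lambda>z. \<integral>y. ln (cmod (z - of_real y)) * s y \<partial>lborel)"
    by (rule continuous_on_of_holder[where K = "4 * C * (b - a + 4)"])
      (use log_potential_holder[OF assms] in \<open>simp add: dist_real_def dist_norm\<close>)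
  moreover have "continuous_on {z. 0 \<le> Im z} (\<lambda>z. \<integral>y. Im (Ln (- \<i> * (z - of_real y))) * s y \<partial>lborel)"
    unfolding continuous_on_sequentially
  proof (intro allI ballI impI; elim conjE)
    fix X z assume z: "z \<in> {z. 0 \<le> Im z}" and X: "\<forall>n. X n \<in> {z. 0 \<le> Im z}" "X \<longlonglongrightarrow> z"
    have "(\<lambda>n. \<integral>y. Im (Ln (- \<i> * (X n - of_real y))) * s y \<partial>lborel) \<longlonglongrightarrow>
        (\<integral>y. Im (Ln (- \<i> * (z - of_real y))) * s y \<partial>lborel)"
    proof (rule integral_dominated_convergence[where w = "\<lambda>y. pi * \<bar>s y\<bar>"])
      show "integrable lborel (\<lambda>y. pi * \<bar>s y\<bar>)" using bounded_density_integrable[OF assms(1)] by simp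
      show "AE y in lborel. (\<lambda>n. Im (Ln (- \<i> * (X n - of_real y))) * s y) \<longlonglongrightarrow>
          Im (Ln (- \<i> * (z - of_real y))) * s y"
        using AE_ne_complex[of z]
      proof eventually_elim
        case (elim y)
        have "isCont (\<lambda>w. Ln (- \<i> * w)) (z - of_real y)" using z elim by (intro upper_Ln_cont) auto
        moreover have "(\<lambda>n. X n - of_real y) \<longlonglongrightarrow> z - of_real y" by (intro tendsto_intros X)
        ultimately have "(\<lambda>n. Ln (- \<i> * (X n - of_real y))) \<longlonglongrightarrow> Ln (- \<i> * (z - of_real y))"
          by (rule isCont_tendsto_compose)
        then show ?case by (intro tendsto_mult tendsto_const tendsto_Im)
      qed
      show "AE y in lborel. norm (Im (Ln (- \<i> * (X n - of_real y))) * s y) \<le> pi * \<bar>s y\<bar>" for n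
        using AE_ne_complex[of "X n"]
        by eventually_elim (use Im_upper_Ln_le in \<open>auto simp: abs_mult intro!: mult_right_mono simp del: mult_minus_left\<close>)
    qed measurable
    then show "((\<lambda>z. \<integral>y. Im (Ln (- \<i> * (z - of_real y))) * s y \<partial>lborel) \<circ> X) \<longlonglongrightarrow>
        (\<integral>y. Im (Ln (- \<i> * (z - of_real y))) * s y \<partial>lborel)" by (simp only: o_def)
  qed
  ultimately have "continuous_on {z. 0 \<le> Im z} (\<lambda>z. Complex (Re (log_trans s z)) (Im (log_trans s z)))"
    unfolding Re_log_trans[OF assms] Im_log_trans[OF assms] by (rule continuous_on_Complex)
  then show ?thesis by simp
qed

lemma log_trans_holomorphic:
  assumes "bounded_density a b C s" "a \<le> b"
  shows "log_trans s holomorphic_on {z. 0 < Im z}"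
proof -
  note [measurable] = bounded_densityD(1)[OF assms(1)]
  have "(log_trans s has_field_derivative (\<integral>y. of_real (s y) * (1 / (z - of_real y)) \<partial>lborel)) (at z)"
    if z: "0 < Im z" for z
    unfolding has_field_derivative_iff tendsto_at_iff_sequentially
  proof (intro allI impI)
    fix X assume X: "\<forall>i. X i \<in> UNIV - {z}" "X \<longlonglongrightarrow> z"
    \<comment> \<open>In the half-plane above half the height of \<open>z\<close>, which is convex,
      the derivative of the logarithm is at most \<open>1 / \<eta>\<close> for every real
      \<open>y\<close>; this dominates the difference quotients.\<close>
    define \<eta> where "\<eta> = Im z / 2"
    have \<eta>: "\<eta> > 0" using z by (simp add: \<eta>_def)
    have "(\<lambda>i. Im (X i)) \<longlonglongrightarrow> Im z" by (intro tendsto_intros X)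
    then have "\<forall>\<^sub>F i in sequentially. \<eta> < Im (X i)" using \<eta> by (intro order_tendstoD(1)) (auto simp: \<eta>_def)
    then obtain M where M: "\<And>i. i \<ge> M \<Longrightarrow> \<eta> < Im (X i)" unfolding eventually_sequentially by auto
    \<comment> \<open>Dominated convergence needs the majorant for every index, so the initial
      segment is cut off; \<open>LIMSEQ_offset\<close> restores it at the end.\<close>
    define Y where "Y i = X (i + M)" for i
    have Y: "\<And>i. \<eta> < Im (Y i)" "\<And>i. Y i \<noteq> z" "Y \<longlonglongrightarrow> z"
      using M X unfolding Y_def by (auto intro: LIMSEQ_ignore_initial_segment)
    let ?D = "\<lambda>i y. of_real (s y) * ((Ln (- \<i> * (Y i - of_real y)) - Ln (- \<i> * (z - of_real y))) / (Y i - z))"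
    have eq: "(log_trans s (Y i) - log_trans s z) / (Y i - z) = (\<integral>y. ?D i y \<partial>lborel)" for i
    proof -
      have "log_trans s (Y i) - log_trans s z =
        (\<integral>y. of_real (s y) * Ln (- \<i> * (Y i - of_real y)) - of_real (s y) * Ln (- \<i> * (z - of_real y)) \<partial>lborel)"
        unfolding log_trans_def by (rule Bochner_Integration.integral_diff[symmetric]) (intro log_trans_integrable[OF assms])+
      then have "(log_trans s (Y i) - log_trans s z) / (Y i - z) =
        (\<integral>y. (of_real (s y) * Ln (- \<i> * (Y i - of_real y)) - of_real (s y) * Ln (- \<i> * (z - of_real y))) / (Y i - z) \<partial>lborel)"
        by (simp only: integral_divide_zero)
      then show ?thesis by (simp only: right_diff_distrib[symmetric] times_divide_eq_right[symmetric])
    qed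
    have "(\<lambda>i. \<integral>y. ?D i y \<partial>lborel) \<longlonglongrightarrow> (\<integral>y. of_real (s y) * (1 / (z - of_real y)) \<partial>lborel)"
    proof (rule integral_dominated_convergence[where w = "\<lambda>y. \<bar>s y\<bar> * (1 / \<eta>)"])
      show "integrable lborel (\<lambda>y. \<bar>s y\<bar> * (1 / \<eta>))" using bounded_density_integrable[OF assms(1)] by simp
      show "AE y in lborel. (\<lambda>i. ?D i y) \<longlonglongrightarrow> of_real (s y) * (1 / (z - of_real y))"
      proof (rule AE_I2)
        fix y
        have "((\<lambda>w. (Ln (- \<i> * (w - of_real y)) - Ln (- \<i> * (z - of_real y))) / (w - z)) \<longlongrightarrow> 1 / (z - of_real y)) (at z)"
          using upper_Ln_deriv[OF z, of y] unfolding has_field_derivative_iff .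
        then have "((\<lambda>w. (Ln (- \<i> * (w - of_real y)) - Ln (- \<i> * (z - of_real y))) / (w - z)) \<circ> Y) \<longlonglongrightarrow> 1 / (z - of_real y)"
          unfolding tendsto_at_iff_sequentially using Y by auto
        then show "(\<lambda>i. ?D i y) \<longlonglongrightarrow> of_real (s y) * (1 / (z - of_real y))"
          unfolding o_def by (intro tendsto_mult tendsto_const)
      qed
      show "AE y in lborel. norm (?D i y) \<le> \<bar>s y\<bar> * (1 / \<eta>)" for i
      proof (rule AE_I2)
        fix y
        have "norm (Ln (- \<i> * (Y i - of_real y)) - Ln (- \<i> * (z - of_real y))) \<le> (1 / \<eta>) * norm (Y i - z)"
        proof (rule field_differentiable_bound[where S = "{w. \<eta> \<le> Im w}" and f' = "\<lambda>w. 1 / (w - of_real y)"])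
          show "convex {w. \<eta> \<le> Im w}" by (rule convex_halfspace_Im_ge)
          fix w assume w: "w \<in> {w. \<eta> \<le> Im w}"
          show "((\<lambda>w. Ln (- \<i> * (w - of_real y))) has_field_derivative 1 / (w - of_real y)) (at w within {w. \<eta> \<le> Im w})"
            by (rule has_field_derivative_at_within[OF upper_Ln_deriv]) (use w \<eta> in auto)
          have "\<eta> \<le> cmod (w - of_real y)" using w abs_Im_le_cmod[of "w - of_real y"] by simp
          then show "norm (1 / (w - of_real y)) \<le> 1 / \<eta>" using \<eta> by (simp add: norm_divide frac_le)
        qed (use Y(1)[of i] z \<eta> in \<open>auto simp: \<eta>_def intro: less_imp_le\<close>)
        then have "norm ((Ln (- \<i> * (Y i - of_real y)) - Ln (- \<i> * (z - of_real y))) / (Y i - z)) \<le> 1 / \<eta>"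
          using Y(2)[of i] by (simp only: norm_divide) (simp add: divide_le_eq del: mult_minus_left)
        then show "norm (?D i y) \<le> \<bar>s y\<bar> * (1 / \<eta>)"
          unfolding norm_mult by (intro mult_mono) auto
      qed
    qed measurable
    then have "(\<lambda>i. (log_trans s (Y i) - log_trans s z) / (Y i - z)) \<longlonglongrightarrow> (\<integral>y. of_real (s y) * (1 / (z - of_real y)) \<partial>lborel)"
      by (simp only: eq)
    then show "((\<lambda>w. (log_trans s w - log_trans s z) / (w - z)) \<circ> X) \<longlonglongrightarrow> (\<integral>y. of_real (s y) * (1 / (z - of_real y)) \<partial>lborel)"
      unfolding Y_def o_def by (rule LIMSEQ_offset)
  qed
  moreover have "open {z. 0 < Im z}" by (rule open_halfspace_Im_gt)
  ultimately show ?thesis by (auto simp: holomorphic_on_open)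
qed

lemma mass_has_real_derivative:
  assumes s: "integrable lborel s" "continuous_on {p..q} s" and ap: "a \<le> p" and t: "p < t" "t < q"
  shows "(mass s a has_real_derivative s t) (at t)"
proof -
  have [measurable]: "s \<in> borel_measurable lborel" using s(1) by auto
  have eq: "mass s a y = mass s a p + integral {p..y} s" if "y \<in> {p..q}" for y
  proof -
    have "set_integrable lborel {p..y} s"
      using that by (intro borel_integrable_atLeastAtMost' continuous_on_subset[OF s(2)]) auto
    from set_borel_integral_eq_integral(2)[OF this]
    have "integral {p..y} s = (LBINT y:{p..y}. s y)" by simp
    also have "\<dots> = mass s p y"
      unfolding mass_def set_lebesgue_integral_def
    proof (rule Bochner_Integration.integral_cong_AE)
      show "AE z in lborel. indicator {p..y} z *\<^sub>R s z = indicator {p<..y} z * s z"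
        using AE_lborel_singleton[of p] by eventually_elim (auto simp: indicator_def)
    qed measurable
    finally show ?thesis using mass_add[OF s(1) ap, of y] that by auto
  qed
  have "((\<lambda>y. integral {p..y} s) has_real_derivative s t) (at t within {p..q})"
    using t by (intro integral_has_real_derivative s(2)) auto
  then have "((\<lambda>y. mass s a p + integral {p..y} s) has_real_derivative s t) (at t within {p..q})"
    by (auto intro!: derivative_eq_intros)
  then have "(mass s a has_real_derivative s t) (at t within {p..q})"
  proof (rule has_field_derivative_transform_within[OF _ zero_less_one])
    show "t \<in> {p..q}" using t by simp
    show "mass s a p + integral {p..y} s = mass s a y" if "y \<in> {p..q}" for y
      by (rule eq[OF that, symmetric])
  qed
  then show ?thesis
    using t at_within_Icc_at[of p t q] by simp
qed

text \<open>With this branch the argument is \<open>- pi / 2\<close> for mass to the left of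
  \<open>t\<close> and \<open>pi / 2\<close> for mass to the right.\<close>

lemma Im_log_trans_real:
  assumes "bounded_density a b C s" "a \<le> b" "t \<in> {a..b}"
  shows "Im (log_trans s (of_real t)) = pi / 2 * (mass s a b - 2 * mass s a t)"
proof -
  note s = bounded_densityD[OF assms(1)] bounded_density_integrable[OF assms(1)]
  note [measurable] = s(1)
  have i: "integrable lborel (\<lambda>y. indicator {a<..t} y * s y)" "integrable lborel (\<lambda>y. indicator {t<..b} y * s y)"
    by (intro integrable_indicator_mult s(4); simp)+
  have "Im (log_trans s (of_real t)) = (\<integral>y. Im (Ln (- \<i> * (of_real t - of_real y))) * s y \<partial>lborel)"
    by (rule Im_log_trans[OF assms(1,2)])
  also have "\<dots> = (\<integral>y. pi / 2 * (indicator {t<..b} y * s y - indicator {a<..t} y * s y) \<partial>lborel)"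
  proof (rule Bochner_Integration.integral_cong_AE)
    show "AE y in lborel. Im (Ln (- \<i> * (of_real t - of_real y))) * s y =
      pi / 2 * (indicator {t<..b} y * s y - indicator {a<..t} y * s y)"
      using AE_lborel_singleton[of t] AE_lborel_singleton[of a]
    proof eventually_elim
      case (elim y)
      have "Im (Ln (- \<i> * (of_real t - of_real y))) = - (pi / 2) * sgn (t - y)"
        using Im_upper_Ln_real[of "t - y"] elim by (simp only: of_real_diff)
      then show ?case using elim s(3)[of y] assms(3)
        by (cases "y \<in> {a..b}"; cases "y < t") (auto simp: indicator_def)
    qed
  qed measurable
  also have "\<dots> = pi / 2 * (mass s t b - mass s a t)"
    using i by (simp add: mass_def)
  also have "mass s t b - mass s a t = mass s a b - 2 * mass s a t"
    using mass_add[OF s(4), of a t b] assms(3) by simp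
  finally show ?thesis .
qed

text \<open>On an interval where \<open>log_pot s + Re V\<close> is constant, the real part of
  \<open>log_trans s + V - const\<close> has zero boundary values from above, so Schwarz reflection continues it
  across the interval; its imaginary part there is a primitive of \<open>- pi * s\<close>.\<close>

lemma density_real_analytic:
  assumes s: "bounded_density a b C s" and ab: "a \<le> b"
    and I: "open I" "I \<subseteq> {a<..<b}" "continuous_on I s"
    and G: "open G" "complex_of_real ` I \<subseteq> G" "real_analytic_in G V"
    and eq: "\<And>t. t \<in> I \<Longrightarrow> Re (V (of_real t)) + log_pot s t = l"
  shows "real_analytic_on I s"
proof -
  \<comment> \<open>Schwarz reflection asks for real boundary values; the factor \<open>\<i>\<close>
    turns a vanishing real part into a vanishing imaginary part.\<close>
  define f where "f z = \<i> * (log_trans s z + V z - of_real l)" for z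
  \<comment> \<open>The domain must be symmetric under conjugation, which \<open>G\<close> need not
    be.\<close>
  define S where "S = {z. Re z \<in> I} \<inter> (G \<inter> cnj -` G)"
  have openRe: "open {z. Re z \<in> I}"
    using open_vimage[OF I(1), of Re] by (simp add: vimage_def continuous_intros)
  have openS: "open S"
    unfolding S_def using G(1) by (intro open_Int openRe open_vimage continuous_intros) auto
  have S_real: "complex_of_real ` I \<subseteq> S" using G(2) by (auto simp: S_def)
  have holV: "V holomorphic_on G" and realV: "\<And>t::real. of_real t \<in> G \<Longrightarrow> V (of_real t) \<in> \<real>"
    using G(3) by (auto simp: real_analytic_in_def)
  have Fval: "f (of_real t) = of_real (pi / 2 * (2 * mass s a t - mass s a b))" if "t \<in> I" for t
  proof -
    have tab: "t \<in> {a..b}" using that I(2) by auto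
    have "V (of_real t) \<in> \<real>" using that G(2) by (intro realV) auto
    then have 1: "Im (V (of_real t)) = 0" by (simp add: complex_is_Real_iff)
    have "Re (log_trans s (of_real t)) = log_pot s t"
      using Re_log_trans[OF s ab, of "of_real t"] by (simp add: log_pot_def flip: of_real_diff)
    then have 2: "Re (log_trans s (of_real t)) + Re (V (of_real t)) = l" using eq[OF that] by simp
    show ?thesis
      unfolding f_def using 1 2 Im_log_trans_real[OF s ab tab]
      by (simp add: complex_eq_iff algebra_simps)
  qed
  define H where "H z = (if 0 \<le> Im z then f z else cnj (f (cnj z)))" for z
  have "H holomorphic_on S"
    unfolding H_def
  proof (rule Schwarz_reflection[OF openS])
    show "cnj ` S \<subseteq> S" by (auto simp: S_def)
    show "f holomorphic_on S \<inter> {z. 0 < Im z}"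
      unfolding f_def
      by (intro holomorphic_intros holomorphic_on_subset[OF log_trans_holomorphic[OF s ab]]
          holomorphic_on_subset[OF holV]) (auto simp: S_def)
    show "continuous_on (S \<inter> {z. 0 \<le> Im z}) f"
      unfolding f_def
      by (intro continuous_intros continuous_on_subset[OF log_trans_continuous[OF s ab]]
          continuous_on_subset[OF holomorphic_on_imp_continuous_on[OF holV]]) (auto simp: S_def)
    fix z assume "z \<in> S" "z \<in> \<real>"
    then obtain t where "z = of_real t" "t \<in> I" by (auto simp: S_def elim!: Reals_cases)
    then show "f z \<in> \<real>" by (simp only: Fval Reals_of_real)
  qed
  then have holH: "H holomorphic_on S" .
  \<comment> \<open>On the axis \<open>H\<close> is an affine function of the distribution function
    of \<open>s\<close>, so differentiating along the axis recovers the density from the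
    continuation.\<close>
  have dH: "deriv H (of_real t) = of_real (pi * s t)" if t: "t \<in> I" for t
  proof -
    obtain e where e: "e > 0" "cball t e \<subseteq> I" using I(1) t open_contains_cball by meson
    then have sub: "{t - e..t + e} \<subseteq> I" by (auto simp: cball_eq_atLeastAtMost)
    have "t - e \<in> I" using e(1) by (intro subsetD[OF sub]) auto
    then have "a \<le> t - e" using I(2) by auto
    then have m: "(mass s a has_real_derivative s t) (at t)"
      using e(1) by (intro mass_has_real_derivative[of s "t - e" "t + e"]
        bounded_density_integrable[OF s] continuous_on_subset[OF I(3) sub]) auto
    have "((\<lambda>t. pi / 2 * (2 * mass s a t - mass s a b)) has_real_derivative pi * s t) (at t)"
      by (auto intro!: derivative_eq_intros m)
    then have "((\<lambda>t. complex_of_real (pi / 2 * (2 * mass s a t - mass s a b))) has_vector_derivative of_real (pi * s t)) (at t)"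
      unfolding has_real_derivative_iff_has_vector_derivative by (rule bounded_linear.has_vector_derivative[OF bounded_linear_of_real])
    then have 1: "((\<lambda>t. H (of_real t)) has_vector_derivative of_real (pi * s t)) (at t)"
    proof (rule has_vector_derivative_transform_within_open[OF _ I(1) t])
      show "of_real (pi / 2 * (2 * mass s a y - mass s a b)) = H (of_real y)" if "y \<in> I" for y
        using Fval[OF that] by (simp add: H_def)
    qed
    have "(H has_field_derivative deriv H (of_real t)) (at (of_real t))"
      using S_real t by (intro holomorphic_derivI[OF holH openS]) auto
    then have 2: "((\<lambda>t. H (of_real t)) has_vector_derivative deriv H (of_real t)) (at t)"
      by (rule has_vector_derivative_real_field)
    show ?thesis by (rule vector_derivative_unique_at[OF 2 1])
  qed
  show ?thesis
    unfolding real_analytic_on_def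
  proof (intro exI conjI ballI)
    show "open S" by (rule openS)
    show "complex_of_real ` I \<subseteq> S" by (rule S_real)
    show "(\<lambda>z. deriv H z / of_real pi) holomorphic_on S"
      by (intro holomorphic_intros holomorphic_deriv holH openS) auto
    show "deriv H (of_real t) / of_real pi = of_real (s t)" if "t \<in> I" for t
      using dH[OF that] by simp
  qed
qed

lemma real_analytic_on_diff_cmult:
  assumes "real_analytic_on S f" "real_analytic_on S g"
  shows "real_analytic_on S (\<lambda>x. k * (f x - g x))"
proof -
  obtain U f' where U: "open U" "complex_of_real ` S \<subseteq> U" "f' holomorphic_on U"
    "\<forall>x\<in>S. f' (complex_of_real x) = complex_of_real (f x)"
    using assms(1) unfolding real_analytic_on_def by blast
  obtain W g' where W: "open W" "complex_of_real ` S \<subseteq> W" "g' holomorphic_on W"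
    "\<forall>x\<in>S. g' (complex_of_real x) = complex_of_real (g x)"
    using assms(2) unfolding real_analytic_on_def by blast
  show ?thesis
    unfolding real_analytic_on_def
  proof (intro exI conjI)
    show "open (U \<inter> W)" using U W by auto
    show "complex_of_real ` S \<subseteq> U \<inter> W" using U W by auto
    show "(\<lambda>z. of_real k * (f' z - g' z)) holomorphic_on U \<inter> W"
      by (intro holomorphic_intros holomorphic_on_subset[OF U(3)] holomorphic_on_subset[OF W(3)]) auto
    show "\<forall>x\<in>S. of_real k * (f' (of_real x) - g' (of_real x)) = complex_of_real (k * (f x - g x))"
      using U W by simp
  qed
qed

lemma real_analytic_on_subset:
  assumes "real_analytic_on S f" "T \<subseteq> S"
  shows "real_analytic_on T f"
proof -
  obtain U g where U: "open U" "complex_of_real ` S \<subseteq> U" "g holomorphic_on U"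
    "\<forall>x\<in>S. g (complex_of_real x) = complex_of_real (f x)"
    using assms(1) unfolding real_analytic_on_def by blast
  then show ?thesis
    unfolding real_analytic_on_def using assms(2) by (intro exI[of _ U] exI[of _ g]) auto
qed

lemma real_analytic_on_cong:
  assumes "real_analytic_on S f" "\<And>x. x \<in> S \<Longrightarrow> f x = g x"
  shows "real_analytic_on S g"
  using assms(1) unfolding real_analytic_on_def by (simp add: assms(2) cong: ball_cong)

context equilibrium_system
begin

text \<open>The band is the connected component of \<open>x0\<close> in the set where both
  constraints are slack. There \<open>euler_lagrange\<close> holds in both directions, so
  \<open>dE\<close> is constant, and constancy of \<open>dE\<close> gives analyticity. Maximality
  follows since any larger interval of this kind is a connected subset of the same set.\<close>

lemma band_component:
  assumes x0: "x0 \<in> {a<..<b}" "0 < d x0" "d x0 < \<rho> x0 / c"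
  shows "\<exists>I. x0 \<in> I \<and> is_band a b \<rho> c d I"
proof -
  define S where "S = {y\<in>{a<..<b}. 0 < d y \<and> d y < \<rho> y / c}"
  have "open ({a<..<b} \<inter> (\<lambda>y. min (d y) (\<rho> y / c - d y)) -` {0<..})"
    by (intro continuous_open_preimage continuous_intros d_cont continuous_on_subset[OF \<rho>_cont]) (use c in auto)
  also have "{a<..<b} \<inter> (\<lambda>y. min (d y) (\<rho> y / c - d y)) -` {0<..} = S"
    by (auto simp: S_def)
  finally have openS: "open S" .
  define I where "I = connected_component_set S x0"
  have x0S: "x0 \<in> S" using x0 by (simp add: S_def)
  have I: "open I" "connected I" "x0 \<in> I" "I \<subseteq> S" "I \<subseteq> {a<..<b}"
    using openS x0S connected_component_subset[of S x0]
    by (auto simp: I_def S_def intro: open_connected_component)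
  obtain u v where uv: "a \<le> u" "u < v" "v \<le> b" "I = {u<..<v}"
    using open_bounded_connected_real[OF I(1,2) _ I(5)] I(3) by auto
  have IS: "y \<in> {a<..<b}" "0 < d y" "d y < \<rho> y / c" if "y \<in> I" for y
    using I(4) that by (auto simp: S_def)
  have const: "dE y = dE x0" if "y \<in> I" for y
    using euler_lagrange[of x0 y] euler_lagrange[of y x0] IS[OF that] x0 by simp
  \<comment> \<open>The potentials of \<rho> and \<mu> in \<open>dE\<close> merge into the potential
    of one signed density, and \<open>d\<close> is recovered from it because \<rho> is
    analytic.\<close>
  define s where "s y = rho y + (- 2 * c) * dens y" for y
  have s: "bounded_density a b (\<rho>max + \<bar>- 2 * c\<bar> * (\<rho>max / c)) s"
    unfolding s_def by (intro bounded_density_add bounded_density_cmult rho_bounded_density dens_bounded)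
  have sI: "s y = \<rho> y - 2 * c * d y" if "y \<in> I" for y
    using IS(1)[OF that] by (simp add: s_def)
  have "continuous_on I (\<lambda>y. \<rho> y - 2 * c * d y)"
    by (intro continuous_intros continuous_on_subset[OF d_cont I(5)] continuous_on_subset[OF \<rho>_cont])
      (use I(5) in auto)
  then have "continuous_on I s" by (rule continuous_on_eq) (simp add: sI)
  then have "real_analytic_on I s"
  proof (rule density_real_analytic[OF s less_imp_le[OF ab] I(1,5) _ G(1) _ G(3)])
    show "complex_of_real ` I \<subseteq> G" using G(2) I(5) by force
    fix t assume "t \<in> I"
    then have "dE x0 = phi t - 2 * c * log_pot dens t" using const by (simp add: dE_def)
    also have "\<dots> = Re (V (of_real t)) + log_pot s t"
      unfolding phi_eq s_def log_pot_linear[OF rho_bounded_density dens_bounded less_imp_le[OF ab]] by simp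
    finally show "Re (V (of_real t)) + log_pot s t = dE x0" ..
  qed
  moreover have "real_analytic_on I \<rho>"
    by (rule real_analytic_on_subset[of "{a..b}"]) (use node_density I(5) in \<open>auto simp: node_density_def\<close>)
  ultimately have "real_analytic_on I (\<lambda>y. 1 / (2 * c) * (\<rho> y - s y))"
    by (intro real_analytic_on_diff_cmult)
  then have "real_analytic_on I d"
  proof (rule real_analytic_on_cong)
    fix y assume "y \<in> I"
    then have "\<rho> y - s y = 2 * c * d y" by (simp add: sI)
    then show "1 / (2 * c) * (\<rho> y - s y) = d y" using c by simp
  qed
  then have "is_band a b \<rho> c d I"
    unfolding is_band_def maximal_open_subinterval_def
  proof (intro conjI allI impI ballI; (elim conjE)?)
    show "open_subinterval a b I" unfolding open_subinterval_def using uv by blast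
    fix J assume J: "open_subinterval a b J" "\<forall>x\<in>J. 0 < d x \<and> d x < \<rho> x / c" "I \<subseteq> J"
    then obtain p q where pq: "a \<le> p" "q \<le> b" "J = {p<..<q}" unfolding open_subinterval_def by blast
    then have "J \<subseteq> S" using J(2) by (auto simp: S_def)
    then have "J \<subseteq> I" unfolding I_def
      using J(3) I(3) pq(3) by (intro connected_component_maximal) auto
    then show "J = I" using J(3) by simp
  qed (use IS in auto)
  then show ?thesis using I(3) by blast
qed

text \<open>One band point, where \<open>dE\<close> equals \<open>l\<close>, is enough: mass is
  present there, so \<open>euler_lagrange\<close> compares it with every point that has
  room.\<close>

lemma multiplier_le_dE:
  assumes "lagrange_multiplier a b \<rho> V c \<mu> d l" "y \<in> {a<..<b}" "d y < \<rho> y / c"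
  shows "l \<le> dE y"
proof -
  obtain x0 where x0: "x0 \<in> {a<..<b}" "0 < d x0" "d x0 < \<rho> x0 / c"
    using exists_unsaturated_point by blast
  obtain I where "x0 \<in> I" "is_band a b \<rho> c d I" using band_component[OF x0] by blast
  then have "dE x0 = l"
    using assms(1) unfolding lagrange_multiplier_def variational_derivative_eq by blast
  then show ?thesis using euler_lagrange[OF x0(1,2) assms(2,3)] by simp
qed

end

section \<open>The trial polynomial\<close>

text \<open>In a difference of two values \<gamma> cancels, and after multiplication by
  \<open>N\<close> the remaining correction is \<eta> over \<open>N\<close>, which is bounded. Only
  such differences occur, since the weights enter through quotients.\<close>

lemma potentials_bounded_error:
  assumes "potentials a b G V VN \<gamma> \<eta>"
  shows "\<exists>H\<ge>0. \<forall>\<^sub>F N in sequentially. \<forall>t s. complex_of_real t \<in> G \<longrightarrow> complex_of_real s \<in> G \<longrightarrow>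
    \<bar>real N * (Re (VN N (of_real t)) - Re (VN N (of_real s))) - real N * (Re (V (of_real t)) - Re (V (of_real s)))\<bar> \<le> H"
proof -
  have ev: "\<forall>\<^sub>F N in sequentially. \<forall>z\<in>G. VN N z = V z + of_real \<gamma> / of_nat N + \<eta> N z / (of_nat N)\<^sup>2"
    using assms by (auto simp: potentials_def elim: eventually_mono)
  have "limsup (\<lambda>N. SUP z\<in>G. ereal (cmod (\<eta> N z))) < \<infinity>" using assms by (simp add: potentials_def)
  then obtain B where B: "limsup (\<lambda>N. SUP z\<in>G. ereal (cmod (\<eta> N z))) < ereal B" using ereal_dense2 by blast
  have "\<forall>\<^sub>F N in sequentially. \<forall>z\<in>G. cmod (\<eta> N z) \<le> \<bar>B\<bar>"
    using Limsup_lessD[OF B]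
  proof eventually_elim
    case (elim N)
    show ?case
    proof
      fix z assume "z \<in> G"
      then have "ereal (cmod (\<eta> N z)) \<le> (SUP z\<in>G. ereal (cmod (\<eta> N z)))" by (rule SUP_upper)
      with elim have "ereal (cmod (\<eta> N z)) < ereal B" by (rule order.strict_trans1[rotated])
      then show "cmod (\<eta> N z) \<le> \<bar>B\<bar>" by simp
    qed
  qed
  then have "\<forall>\<^sub>F N in sequentially. \<forall>t s. complex_of_real t \<in> G \<longrightarrow> complex_of_real s \<in> G \<longrightarrow>
    \<bar>real N * (Re (VN N (of_real t)) - Re (VN N (of_real s))) - real N * (Re (V (of_real t)) - Re (V (of_real s)))\<bar> \<le> 2 * \<bar>B\<bar>"
    using ev eventually_gt_at_top[of 0]
  proof eventually_elim
    case (elim N)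
    show ?case
    proof (intro allI impI)
      fix t s assume ts: "complex_of_real t \<in> G" "complex_of_real s \<in> G"
      have *: "real N * Re (VN N z) = real N * Re (V z) + \<gamma> + Re (\<eta> N z) / real N" if "z \<in> G" for z
      proof -
        have "of_nat N * VN N z = of_nat N * V z + of_real \<gamma> + \<eta> N z / of_nat N"
          using elim(2,3) that by (simp add: field_simps power2_eq_square)
        then have "Re (of_nat N * VN N z) = Re (of_nat N * V z + of_real \<gamma> + \<eta> N z / of_nat N)" by simp
        then show ?thesis by (simp add: Re_divide_of_nat)
      qed
      have **: "\<bar>Re (\<eta> N z) / real N\<bar> \<le> \<bar>B\<bar>" if "z \<in> G" for z
      proof -
        have "\<bar>Re (\<eta> N z)\<bar> / real N \<le> \<bar>B\<bar> / 1"
          using elim(1,3) that abs_Re_le_cmod[of "\<eta> N z"] by (intro frac_le) force+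
        then show ?thesis by simp
      qed
      have gen: "\<bar>(v1 + g + e1) - (v2 + g + e2) - (v1 - v2)\<bar> \<le> 2 * h" if "\<bar>e1\<bar> \<le> h" "\<bar>e2\<bar> \<le> h" for v1 v2 g e1 e2 h :: real
        using that by linarith
      show "\<bar>real N * (Re (VN N (of_real t)) - Re (VN N (of_real s))) - real N * (Re (V (of_real t)) - Re (V (of_real s)))\<bar> \<le> 2 * \<bar>B\<bar>"
        unfolding right_diff_distrib *[OF ts(1)] *[OF ts(2)] by (rule gen[OF **[OF ts(1)] **[OF ts(2)]])
    qed
  qed
  then show ?thesis by (intro exI[of _ "2 * \<bar>B\<bar>"]) auto
qed

section \<open>Weights and distances at the nodes\<close>

context node_system
begin

lemma weight_node:
  assumes "n < N"
  shows "weight x VN N (x N n) > 0"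
    "ln (weight x VN N (x N n)) = - real N * Re (VN N (of_real (x N n))) - (\<Sum>i\<in>{..<N}-{n}. ln \<bar>x N n - x N i\<bar>)"
proof -
  have img: "node_set x N - {x N n} = x N ` ({..<N} - {n})"
    unfolding node_set_def using node_inj[of N] assms by (auto simp: inj_on_def)
  have inj: "inj_on (x N) ({..<N} - {n})" by (rule inj_on_subset[OF node_inj]) auto
  have ne: "x N n \<noteq> x N i" if "i \<in> {..<N} - {n}" for i
    using node_inj[of N] assms that by (auto simp: inj_on_def)
  have w: "weight x VN N (x N n) = exp (- real N * Re (VN N (of_real (x N n)))) * (\<Prod>i\<in>{..<N}-{n}. inverse \<bar>x N n - x N i\<bar>)"
    unfolding weight_def img by (simp add: prod.reindex[OF inj])
  have pos: "0 < (\<Prod>i\<in>{..<N}-{n}. inverse \<bar>x N n - x N i\<bar>)"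
    using ne by (intro prod_pos) auto
  show "weight x VN N (x N n) > 0" unfolding w using pos by simp
  have "ln (\<Prod>i\<in>{..<N}-{n}. inverse \<bar>x N n - x N i\<bar>) = (\<Sum>i\<in>{..<N}-{n}. ln (inverse \<bar>x N n - x N i\<bar>))"
    using ne by (intro ln_prod) auto
  also have "\<dots> = (\<Sum>i\<in>{..<N}-{n}. - ln \<bar>x N n - x N i\<bar>)"
    using ne by (intro sum.cong refl) (simp add: ln_inverse)
  finally show "ln (weight x VN N (x N n)) = - real N * Re (VN N (of_real (x N n))) - (\<Sum>i\<in>{..<N}-{n}. ln \<bar>x N n - x N i\<bar>)"
    unfolding w ln_mult_pos[OF exp_gt_zero pos] ln_exp by (simp add: sum_negf)
qed

text \<open>The trial polynomial has no factor at \<open>x N j\<close>, whereas the discretised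
  potential includes the corresponding term. This is the price of restoring it.\<close>

lemma node_distance:
  assumes "n < N" "j < N" "n \<noteq> j"
  shows "- ln \<bar>x N n - x N j\<bar> \<le> sampling_error N"
proof -
  have *: "1 / (2 * real N * \<rho>max) \<le> x N j' - x N n'" if "n' < j'" "j' < N" for n' j'
  proof -
    have "0 \<le> 1 / (2 * real N * \<rho>max)" using \<rho>max by simp
    then show ?thesis
      using cell_diff(5)[of n' N] cell_diff(4)[of j' N] cell_mono[of "Suc n'" j' N] that by linarith
  qed
  have "1 / (2 * real N * \<rho>max) \<le> \<bar>x N n - x N j\<bar>"
    using *[of n j] *[of j n] assms by (cases "n < j") auto
  moreover have "\<bar>x N n - x N j\<bar> \<le> b - a" using node_in[of n N] node_in[of j N] assms by auto
  ultimately have "\<bar>ln \<bar>x N n - x N j\<bar>\<bar> \<le> \<bar>ln (b - a)\<bar> + \<bar>ln (1 / (2 * real N * \<rho>max))\<bar>"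
    using assms by (intro abs_ln_node_dist) auto
  moreover have "0 \<le> real N * \<rho>max * (2 * (1 / (real N * \<rho>min))\<^sup>2 + 8 * sqrt (1 / (real N * \<rho>min)))"
    using \<rho>max(1) \<rho>min(1) by (intro mult_nonneg_nonneg add_nonneg_nonneg) auto
  moreover have "- p \<le> 16 * (q + r) + w" if "\<bar>p\<bar> \<le> \<bar>q\<bar> + \<bar>r\<bar>" "0 \<le> w" "q = \<bar>q'\<bar>" "r = \<bar>r'\<bar>" for p q r w q' r' :: real
    using that by auto
  ultimately show ?thesis unfolding sampling_error_def by simp
qed

end

section \<open>The chosen nodes and the exponent of the trial vector\<close>

context equilibrium_system
begin

definition filling :: "nat \<Rightarrow> nat \<Rightarrow> real" where
  "filling N i = of_int \<lfloor>real N * mass (\<lambda>y. c * dens y) a (cell N i)\<rfloor>"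

definition chosen :: "nat \<Rightarrow> nat set" where
  "chosen N = {i. i < N \<and> filling N (Suc i) - filling N i = 1}"

lemma cdens_le: "c * dens y \<le> rho y"
  using dens_le[of y] c by (simp add: field_simps)

lemma cdens_nonneg: "0 \<le> c * dens y"
  using dens_nonneg c by simp

lemma cdens_integrable: "integrable lborel (\<lambda>y. c * dens y)"
  using dens_integrable by simp

lemma filling_error: "\<bar>filling N i - real N * mass (\<lambda>y. c * dens y) a (cell N i)\<bar> \<le> 1"
  unfolding filling_def by linarith

text \<open>Each cell has \<rho>-mass \<open>1 / N\<close> and \<open>c * dens\<close> is at most
  \<open>rho\<close>, so the argument of the floor grows by at most 1 and the floor by 0 or 1. In a
  saturated cell it grows by exactly 1, so the floor has to jump.\<close>

lemma filling_increment:
  assumes "i < N"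
  shows "filling N (Suc i) - filling N i = (if i \<in> chosen N then 1 else 0)"
    and "(\<And>y. y \<in> {cell N i<..<cell N (Suc i)} \<Longrightarrow> d y = \<rho> y / c) \<Longrightarrow> i \<in> chosen N"
proof -
  let ?f = "\<lambda>y. c * dens y"
  have N: "0 < N" using assms by simp
  note le = cell_diff(1)[OF assms]
  have cl: "a \<le> cell N i" "cell N (Suc i) \<le> b" using cell(1)[of i N] cell(2)[of "Suc i" N] assms N by auto
  define t where "t = real N * mass ?f a (cell N i)"
  define \<delta> where "\<delta> = real N * mass ?f (cell N i) (cell N (Suc i))"
  have sum: "real N * mass ?f a (cell N (Suc i)) = t + \<delta>"
    unfolding t_def \<delta>_def using mass_add[OF cdens_integrable cl(1) le] by (simp add: distrib_left)
  have \<delta>0: "0 \<le> \<delta>" unfolding \<delta>_def by (intro mult_nonneg_nonneg mass_nonneg cdens_nonneg) auto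
  have "mass ?f (cell N i) (cell N (Suc i)) \<le> mass rho (cell N i) (cell N (Suc i))"
    by (intro mass_mono cdens_integrable rho_integrable cdens_le)
  then have \<delta>1: "\<delta> \<le> 1" unfolding \<delta>_def cell_diff(2)[OF assms] using N by (simp add: field_simps)
  have fl: "\<lfloor>t + \<delta>\<rfloor> = \<lfloor>t\<rfloor> \<or> \<lfloor>t + \<delta>\<rfloor> = \<lfloor>t\<rfloor> + 1" using \<delta>0 \<delta>1 by linarith
  have ct: "filling N (Suc i) = of_int \<lfloor>t + \<delta>\<rfloor>" "filling N i = of_int \<lfloor>t\<rfloor>"
    unfolding filling_def sum by (simp_all add: t_def)
  show "filling N (Suc i) - filling N i = (if i \<in> chosen N then 1 else 0)"
    using fl assms by (auto simp: chosen_def ct)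
  assume sat: "\<And>y. y \<in> {cell N i<..<cell N (Suc i)} \<Longrightarrow> d y = \<rho> y / c"
  have "mass rho (cell N i) (cell N (Suc i)) \<le> mass ?f (cell N i) (cell N (Suc i))"
  proof (intro mass_mono cdens_integrable rho_integrable)
    fix y assume y: "y \<in> {cell N i<..<cell N (Suc i)}"
    then have "y \<in> {a<..<b}" using cl by auto
    then show "rho y \<le> c * dens y" using sat[OF y] c by simp
  qed
  then have "1 \<le> \<delta>" unfolding \<delta>_def cell_diff(2)[OF assms] using N by (simp add: field_simps)
  then have "\<delta> = 1" using \<delta>1 by simp
  then show "i \<in> chosen N" using assms by (simp add: chosen_def ct)
qed

lemma sum_chosen:
  assumes "S \<subseteq> {..<N}"
  shows "(\<Sum>i\<in>S. (filling N (Suc i) - filling N i) * g i) = (\<Sum>i\<in>chosen N \<inter> S. g i)"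
proof -
  have "(\<Sum>i\<in>S. (filling N (Suc i) - filling N i) * g i) = (\<Sum>i\<in>S. if i \<in> chosen N then g i else 0)"
  proof (intro sum.cong refl)
    fix i assume "i \<in> S"
    then have "i < N" using assms by auto
    then show "(filling N (Suc i) - filling N i) * g i = (if i \<in> chosen N then g i else 0)"
      by (simp add: filling_increment(1))
  qed
  also have "\<dots> = (\<Sum>i\<in>chosen N \<inter> S. g i)"
    using finite_subset[OF assms] by (simp add: sum.If_cases Int_commute)
  finally show ?thesis .
qed

lemma chosen_subset: "chosen N \<subseteq> {..<N}"
  by (auto simp: chosen_def)

text \<open>The jumps telescope to the floor of \<open>c * N\<close>, which is exactly
  \<open>k\<close>. The case \<open>N = 0\<close> is separate because the quantiles are meaningless
  there.\<close>

lemma card_chosen: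
  assumes "real k = c * real N"
  shows "card (chosen N) = k"
proof (cases "N = 0")
  case True
  then show ?thesis using assms by (simp add: chosen_def)
next
  case False
  have "mass (\<lambda>y. c * dens y) a b = c * (\<integral>y. dens y \<partial>lborel)"
    unfolding mass_cmult mass_def
    by (intro arg_cong2[of _ _ _ _ "(*)"] refl Bochner_Integration.integral_cong) (auto simp: zero_ext_def indicator_def)
  then have "mass (\<lambda>y. c * dens y) a b = c" by (simp add: dens_total)
  then have "filling N N = of_int \<lfloor>real k\<rfloor>" "filling N 0 = 0"
    using cell_ends[of N] False assms by (simp_all add: filling_def mult.commute)
  moreover have "(\<Sum>i<N. (filling N (Suc i) - filling N i)) = filling N N - filling N 0"
    by (rule sum_lessThan_telescope)
  moreover have "(\<Sum>i<N. (filling N (Suc i) - filling N i)) = real (card (chosen N))"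
    using sum_chosen[of "{..<N}" N "\<lambda>_. 1"] chosen_subset[of N] by (simp add: Int_absorb2)
  ultimately show ?thesis by simp
qed

lemma log_sum_chosen:
  assumes "n < N"
  shows "\<bar>(\<Sum>i\<in>chosen N - {n}. ln \<bar>x N n - x N i\<bar>) - real N * (c * log_pot dens (x N n))\<bar> \<le> sampling_error N"
proof -
  have "\<bar>(\<Sum>i\<in>{..<N} - {n}. (filling N (Suc i) - filling N i) * ln \<bar>x N n - x N i\<bar>) -
      real N * (\<integral>y. ln \<bar>x N n - y\<bar> * (c * dens y) \<partial>lborel)\<bar> \<le> sampling_error N"
    by (rule log_sum_discretization)
      (use assms filling_error filling_increment(1) cdens_le cdens_nonneg dens_measurable in auto)
  moreover have "(\<integral>y. ln \<bar>x N n - y\<bar> * (c * dens y) \<partial>lborel) = c * log_pot dens (x N n)"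
    by (simp add: log_pot_def mult.left_commute[of _ c])
  moreover have "chosen N \<inter> ({..<N} - {n}) = chosen N - {n}" using chosen_subset[of N] by auto
  ultimately show ?thesis by (simp add: sum_chosen)
qed

lemma log_sum_nodes:
  assumes "n < N"
  shows "\<bar>(\<Sum>i\<in>{..<N} - {n}. ln \<bar>x N n - x N i\<bar>) - real N * log_pot rho (x N n)\<bar> \<le> sampling_error N"
proof -
  \<comment> \<open>With all nodes counted the discrepancy at the cell boundaries is 0, by the
    choice of the quantiles.\<close>
  have "\<bar>(\<Sum>i\<in>{..<N} - {n}. (real (Suc i) - real i) * ln \<bar>x N n - x N i\<bar>) -
      real N * (\<integral>y. ln \<bar>x N n - y\<bar> * rho y \<partial>lborel)\<bar> \<le> sampling_error N"
    by (rule log_sum_discretization)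
      (use assms rho_nonneg bounded_densityD(1)[OF rho_bounded_density] cell(3) in auto)
  then show ?thesis by (simp add: log_pot_def)
qed

text \<open>The left side is the logarithm of \<open>\<bar>u n / u j\<bar>\<close> for the trial
  vector \<open>u\<close>. Each of the two sums over all nodes costs half a sampling error, each of
  the two sums over chosen nodes costs one, and so does the missing factor at \<open>x N j\<close>:
  four in total.\<close>

lemma trial_exponent_bound:
  assumes n: "n < N" "n \<notin> chosen N" and j: "j \<in> chosen N"
    and H: "\<bar>real N * (Re (VN N (of_real (x N n))) - Re (VN N (of_real (x N j)))) -
      real N * (Re (V (of_real (x N n))) - Re (V (of_real (x N j))))\<bar> \<le> H"
  shows "(ln (weight x VN N (x N n)) - ln (weight x VN N (x N j))) / 2 +
      (\<Sum>i\<in>chosen N - {j}. ln \<bar>x N n - x N i\<bar>) - (\<Sum>i\<in>chosen N - {j}. ln \<bar>x N j - x N i\<bar>)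
    \<le> - (real N / 2 * (dE (x N n) - dE (x N j))) + 4 * sampling_error N + H"
proof -
  have jN: "j < N" and nj: "n \<noteq> j" using j n chosen_subset[of N] by auto
  have split: "(\<Sum>i\<in>chosen N - {n}. ln \<bar>x N n - x N i\<bar>) =
      ln \<bar>x N n - x N j\<bar> + (\<Sum>i\<in>chosen N - {j}. ln \<bar>x N n - x N i\<bar>)"
    using n j finite_subset[OF chosen_subset, of N] by (simp add: sum.remove[of "chosen N" j])
  have "((- K * an - Rn) - (- K * aj - Rj)) / 2 + Tn - Sj
      \<le> - (K / 2 * ((vn + Pn - 2 * c * Qn) - (vj + Pj - 2 * c * Qj))) + 4 * e + H"
    if "Sn = D + Tn" "\<bar>Sn - K * (c * Qn)\<bar> \<le> e" "\<bar>Sj - K * (c * Qj)\<bar> \<le> e" "\<bar>Rn - K * Pn\<bar> \<le> e"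
      "\<bar>Rj - K * Pj\<bar> \<le> e" "- D \<le> e" "\<bar>K * (an - aj) - K * (vn - vj)\<bar> \<le> H"
    for K an aj Rn Rj Tn Sn Sj vn vj Pn Pj Qn Qj D e :: real
  proof -
    have "- A - Rn + Rj + 2 * Tn - 2 * Sj \<le> - W - pn + pj + 2 * un - 2 * uj + 8 * e + 2 * H"
      if "\<bar>Sn - un\<bar> \<le> e" "\<bar>Sj - uj\<bar> \<le> e" "\<bar>Rn - pn\<bar> \<le> e" "\<bar>Rj - pj\<bar> \<le> e" "\<bar>A - W\<bar> \<le> H"
      for A W pn pj un uj :: real
      using that \<open>Sn = D + Tn\<close> \<open>- D \<le> e\<close> unfolding abs_le_iff by linarith
    from this[OF that(2,3,4,5,7)] show ?thesis by (simp add: field_simps)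
  qed
  from this[OF split log_sum_chosen[OF n(1)] log_sum_chosen[OF jN] log_sum_nodes[OF n(1)] log_sum_nodes[OF jN]
    node_distance[OF n(1) jN nj] H]
  show ?thesis
    unfolding weight_node(2)[OF n(1)] weight_node(2)[OF jN] dE_def phi_eq .
qed

end

section \<open>From the trial polynomial to the kernel\<close>

context node_system
begin

text \<open>The polynomial with zeros at the nodes of \<open>Z\<close> other than \<open>j\<close>
  has degree \<open>k - 1\<close>, so its weighted values lie in the range of the projection. They
  vanish on the rest of \<open>Z\<close>; outside \<open>Z\<close> the hypothesis bounds each ratio
  to the value at \<open>j\<close>, and fewer than \<open>N\<close> such terms are summed.\<close>

lemma kernel_near_identity:
  fixes Z :: "nat set"
  assumes p: "orthonormal_polys x VN p" and Z: "Z \<subseteq> {..<N}" "card Z = k" "j \<in> Z"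
    and bound: "\<And>n. n < N \<Longrightarrow> n \<notin> Z \<Longrightarrow>
      (ln (weight x VN N (x N n)) - ln (weight x VN N (x N j))) / 2 +
      (\<Sum>i\<in>Z - {j}. ln \<bar>x N n - x N i\<bar>) - (\<Sum>i\<in>Z - {j}. ln \<bar>x N j - x N i\<bar>) \<le> - B"
  shows "\<bar>reproducing_kernel x VN p N k (x N j) (x N j) - 1\<bar> \<le> real N * exp (- B)"
    and "\<And>i. i < N \<Longrightarrow> i \<noteq> j \<Longrightarrow> \<bar>reproducing_kernel x VN p N k (x N j) (x N i)\<bar> \<le> sqrt (real N * exp (- B))"
proof -
  let ?w = "\<lambda>i. weight x VN N (x N i)"
  have finZ: "finite Z" using Z(1) finite_subset by blast
  have kN: "k \<le> N" using card_mono[OF _ Z(1)] Z(2) by simp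
  have jN: "j < N" using Z by auto
  have w: "0 < ?w i" if "i < N" for i using weight_node(1)[OF that] .
  have ne: "x N n \<noteq> x N i" if "n < N" "i < N" "n \<noteq> i" for n i
    using node_inj[of N] that by (auto simp: inj_on_def)
  define v where "v n i = sqrt (?w i) * poly (p N n) (x N i)" for n i
  have on: "(\<Sum>i<N. v m i * v n i) = (if m = n then 1 else 0)" if "m < k" "n < k" for m n
  proof -
    have "(\<Sum>i<N. v m i * v n i) = (\<Sum>i<N. poly (p N m) (x N i) * poly (p N n) (x N i) * ?w i)"
    proof (intro sum.cong refl)
      fix i assume "i \<in> {..<N}"
      then have sq: "sqrt (?w i) * sqrt (?w i) = ?w i" using w[of i] by simp
      have "v m i * v n i = poly (p N m) (x N i) * poly (p N n) (x N i) * (sqrt (?w i) * sqrt (?w i))"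
        unfolding v_def by (simp only: mult_ac)
      then show "v m i * v n i = poly (p N m) (x N i) * poly (p N n) (x N i) * ?w i"
        by (simp only: sq)
    qed
    also have "\<dots> = (if m = n then 1 else 0)"
      using p that kN unfolding orthonormal_polys_def by auto
    finally show ?thesis .
  qed
  define q where "q = (\<Prod>i\<in>Z - {j}. [:- x N i, 1:])"
  have q: "poly q t = (\<Prod>i\<in>Z - {j}. (t - x N i))" for t
    by (simp add: q_def poly_prod)
  have k: "0 < k" using Z finZ by (auto simp: card_gt_0_iff)
  have "degree q = (\<Sum>i\<in>Z - {j}. degree [:- x N i, 1:])"
    unfolding q_def by (rule degree_prod_eq_sum_degree) auto
  then have "degree q = k - 1" using Z finZ by simp
  then have "coeff q i = 0" if "i \<ge> k" for i using that k by (intro coeff_eq_0) auto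
  moreover have "degree (p N n) = n \<and> lead_coeff (p N n) \<noteq> 0" if "n < k" for n
    using p that kN unfolding orthonormal_polys_def by (metis less_le_trans less_irrefl)
  ultimately obtain \<alpha> where \<alpha>: "q = (\<Sum>n<k. smult (\<alpha> n) (p N n))"
    using poly_in_span_of_degrees[of k "p N" q] by blast
  define u where "u i = sqrt (?w i) * poly q (x N i)" for i
  have u: "u i = (\<Sum>n<k. \<alpha> n * v n i)" for i
    unfolding u_def v_def \<alpha> by (simp add: poly_sum sum_distrib_left mult_ac)
  have uj: "u j \<noteq> 0"
    unfolding u_def q using w[OF jN] ne[OF jN] Z finZ by (auto simp: prod_zero_iff)
  have lnu: "ln \<bar>u n\<bar> = ln (?w n) / 2 + (\<Sum>i\<in>Z - {j}. ln \<bar>x N n - x N i\<bar>)" "0 < \<bar>u n\<bar>"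
    if n: "n < N" "n \<notin> Z - {j}" for n
  proof -
    have nz: "0 < \<bar>x N n - x N i\<bar>" if "i \<in> Z - {j}" for i using ne[of n i] n Z(1) that by auto
    have eq: "\<bar>u n\<bar> = sqrt (?w n) * (\<Prod>i\<in>Z - {j}. \<bar>x N n - x N i\<bar>)"
      unfolding u_def q using w[OF n(1)] by (simp add: abs_mult abs_prod)
    have pos: "0 < (\<Prod>i\<in>Z - {j}. \<bar>x N n - x N i\<bar>)" by (intro prod_pos nz)
    have sq: "0 < sqrt (?w n)" using w[OF n(1)] by simp
    show "0 < \<bar>u n\<bar>" unfolding eq using pos sq by (rule mult_pos_pos[rotated])
    have "ln (\<Prod>i\<in>Z - {j}. \<bar>x N n - x N i\<bar>) = (\<Sum>i\<in>Z - {j}. ln \<bar>x N n - x N i\<bar>)"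
      using nz finZ by (intro ln_prod) auto
    then show "ln \<bar>u n\<bar> = ln (?w n) / 2 + (\<Sum>i\<in>Z - {j}. ln \<bar>x N n - x N i\<bar>)"
      unfolding eq ln_mult_pos[OF sq pos] using w[OF n(1)] by (simp add: ln_sqrt)
  qed
  have ratio: "\<bar>u n / u j\<bar> \<le> exp (- B)" if n: "n < N" "n \<noteq> j" for n
  proof (cases "n \<in> Z")
    case True
    then have "(\<Prod>i\<in>Z - {j}. (x N n - x N i)) = 0" using finZ n by (intro prod_zero) auto
    then have "u n = 0" unfolding u_def q by simp
    then show ?thesis by simp
  next
    case False
    have un: "n \<notin> Z - {j}" using False by simp
    have "ln (\<bar>u n\<bar> / \<bar>u j\<bar>) = ln \<bar>u n\<bar> - ln \<bar>u j\<bar>"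
      using lnu(2)[OF n(1) un] lnu(2)[OF jN] by (simp add: ln_divide_pos)
    also have "\<dots> \<le> - B"
      using bound[OF n(1) False] lnu(1)[OF n(1) un] lnu(1)[OF jN] by (simp add: diff_divide_distrib)
    finally have "exp (ln (\<bar>u n\<bar> / \<bar>u j\<bar>)) \<le> exp (- B)" by (simp only: exp_le_cancel_iff)
    moreover have "0 < \<bar>u n\<bar> / \<bar>u j\<bar>" using lnu(2)[OF n(1) un] lnu(2)[OF jN] by simp
    ultimately show ?thesis by (simp only: exp_ln abs_divide)
  qed
  have "(\<Sum>n\<in>{..<N} - {j}. \<bar>u n / u j\<bar>) \<le> (\<Sum>n\<in>{..<N} - {j}. exp (- B))"
    by (intro sum_mono ratio) auto
  also have "\<dots> \<le> real N * exp (- B)"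
    using jN by (simp add: mult_right_mono)
  finally have e: "(\<Sum>n\<in>{..<N} - {j}. \<bar>u n / u j\<bar>) \<le> real N * exp (- B)" .
  have kern: "reproducing_kernel x VN p N k (x N j) (x N i) = (\<Sum>n<k. v n j * v n i)" for i
    unfolding reproducing_kernel_def v_def by (simp add: real_sqrt_mult sum_distrib_left mult_ac)
  note P = projection_near_identity[where v = v and u = u and c = \<alpha> and N = N and k = k and j = j, OF on u jN uj e]
  show "\<bar>reproducing_kernel x VN p N k (x N j) (x N j) - 1\<bar> \<le> real N * exp (- B)"
    unfolding kern by (rule P(1))
  show "\<bar>reproducing_kernel x VN p N k (x N j) (x N i)\<bar> \<le> sqrt (real N * exp (- B))"
    if "i < N" "i \<noteq> j" for i
    unfolding kern by (rule P(2)[OF _ _ that])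
qed

end

section \<open>The exponential estimate on compact subsets of a saturated region\<close>

theorem theorem7:
  fixes a b c \<gamma> l :: real
    and \<rho> d :: "real \<Rightarrow> real"
    and x :: "nat \<Rightarrow> nat \<Rightarrow> real"
    and G :: "complex set"
    and V :: "complex \<Rightarrow> complex"
    and VN \<eta> :: "nat \<Rightarrow> complex \<Rightarrow> complex"
    and p :: "nat \<Rightarrow> nat \<Rightarrow> real poly"
    and \<mu> :: "real measure"
    and \<Gamma> F :: "real set"
  assumes "node_density a b \<rho>"
    and "nodes a b \<rho> x"
    and "potentials a b G V VN \<gamma> \<eta>"
    and "orthonormal_polys x VN p"
    and "c \<in> \<rat>" and "0 < c" and "c < 1"
    and "equilibrium_measure a b \<rho> V c \<mu>"
    and "continuous_density a b \<mu> d"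
    and "regular_density a b \<rho> c d"
    and "lagrange_multiplier a b \<rho> V c \<mu> d l"
    and "is_saturated_region a b \<rho> c d \<Gamma>"
    and "compact F" and "F \<subseteq> \<Gamma>"
  shows "\<exists>K>0. \<exists>C. \<forall>\<^sub>F N in sequentially. \<forall>k::nat. real k = c * real N \<longrightarrow>
           (\<forall>y \<in> node_set x N \<inter> F.
              \<bar>reproducing_kernel x VN p N k y y - 1\<bar> \<le> C * exp (- K * real N)) \<and>
           (\<forall>y \<in> node_set x N \<inter> F. \<forall>z \<in> node_set x N \<inter> F. y \<noteq> z \<longrightarrow>
              \<bar>reproducing_kernel x VN p N k y z\<bar> \<le> C * exp (- K * real N) / \<bar>y - z\<bar>)"
proof -
  have G: "open G" "complex_of_real ` {a..b} \<subseteq> G" "real_analytic_in G V"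
    using assms(3) by (auto simp: potentials_def)
  interpret equilibrium_system a b \<rho> x c G V \<mu> d
    by unfold_locales (use assms G in auto)
  obtain u v where uv: "a \<le> u" "u < v" "v \<le> b" "\<Gamma> = {u<..<v}"
    using assms(12) unfolding is_saturated_region_def maximal_open_subinterval_def open_subinterval_def by blast
  have sat: "d y = \<rho> y / c" if "y \<in> \<Gamma>" for y
    using assms(12) that unfolding is_saturated_region_def maximal_open_subinterval_def by blast
  have \<Gamma>ab: "\<Gamma> \<subseteq> {a<..<b}" using uv by auto
  have Fab: "F \<subseteq> {a..b}" using \<Gamma>ab assms(14) by fastforce
  have low: "dE y < l" if "y \<in> F" for y
    using assms(11,12,14) that unfolding lagrange_multiplier_def variational_derivative_eq by blast
  \<comment> \<open>Half of the gap is reserved for the passage from an unsaturated point of a cell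
    to the node of that cell. An empty \<open>F\<close> is separate because the supremum must be
    attained.\<close>
  obtain \<kappa> where \<kappa>: "\<kappa> > 0" "\<And>y. y \<in> F \<Longrightarrow> dE y \<le> l - 2 * \<kappa>"
  proof (cases "F = {}")
    case True
    then show ?thesis by (intro that[of 1]) auto
  next
    case False
    obtain y0 where y0: "y0 \<in> F" "\<And>y. y \<in> F \<Longrightarrow> dE y \<le> dE y0"
      using continuous_attains_sup[OF assms(13) False continuous_on_subset[OF dE_cont Fab]] by blast
    show ?thesis
    proof (rule that[of "(l - dE y0) / 2"])
      show "0 < (l - dE y0) / 2" using low[OF y0(1)] by simp
      have "l - 2 * ((l - dE y0) / 2) = dE y0" by (simp add: field_simps)
      then show "dE y \<le> l - 2 * ((l - dE y0) / 2)" if "y \<in> F" for y using y0(2)[OF that] by simp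
    qed
  qed
  have "uniformly_continuous_on {a..b} dE"
    by (intro compact_uniformly_continuous dE_cont) auto
  then obtain \<delta>1 where \<delta>1: "\<delta>1 > 0"
    "\<And>y z. y \<in> {a..b} \<Longrightarrow> z \<in> {a..b} \<Longrightarrow> dist z y < \<delta>1 \<Longrightarrow> dist (dE z) (dE y) < \<kappa>"
    unfolding uniformly_continuous_on_def using \<kappa>(1) by metis
  \<comment> \<open>Once cells are shorter than \<open>\<delta>2\<close>, the whole cell of a node
    in \<open>F\<close> is saturated, so that node is chosen.\<close>
  obtain \<delta>2 where \<delta>2: "\<delta>2 > 0" "(\<Union>y\<in>F. ball y \<delta>2) \<subseteq> \<Gamma>"
    using compact_subset_open_imp_ball_epsilon_subset[OF assms(13) _ assms(14)] uv(4) by auto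
  obtain H where H: "H \<ge> 0" "\<forall>\<^sub>F N in sequentially. \<forall>t s. complex_of_real t \<in> G \<longrightarrow> complex_of_real s \<in> G \<longrightarrow>
    \<bar>real N * (Re (VN N (of_real t)) - Re (VN N (of_real s))) - real N * (Re (V (of_real t)) - Re (V (of_real s)))\<bar> \<le> H"
    using potentials_bounded_error[OF assms(3)] by blast
  \<comment> \<open>The gap gives the exponent \<open>N * \<kappa> / 2 = 8 * K * N\<close>. The
    sampling errors and \<open>H\<close> take \<open>2 * K * N\<close> each, the factor
    \<open>N\<close> another \<open>2 * K * N\<close>, and the square root for the off-diagonal
    entries halves the remainder to \<open>K * N\<close>.\<close>
  define K where "K = \<kappa> / 16"
  have K: "K > 0" using \<kappa> by (simp add: K_def)
  \<comment> \<open>The off-diagonal entries are exponentially small without the factor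
    \<open>1 / \<bar>y - z\<bar>\<close>; since \<open>\<bar>y - z\<bar>\<close> is at most
    \<open>b - a\<close>, this constant converts the bound into the required form.\<close>
  define C where "C = max 1 (b - a)"
  have se: "\<forall>\<^sub>F N in sequentially. sampling_error N \<le> K / 2 * real N"
    using K by (intro sampling_error_small) auto
  have HN: "\<forall>\<^sub>F N in sequentially. H \<le> 2 * K * real N"
    using K by real_asymp
  have expN: "\<forall>\<^sub>F N in sequentially. real N * exp (- (4 * K * real N)) \<le> exp (- (2 * K * real N))"
    using K by real_asymp
  have cellN: "\<forall>\<^sub>F N in sequentially. 1 / (real N * \<rho>min) < \<delta>" if "\<delta> > 0" for \<delta>
  proof -
    have "(\<lambda>N. 1 / (real N * m)) \<longlonglongrightarrow> 0" if "m > 0" for m using that by real_asymp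
    from order_tendstoD(2)[OF this[OF \<rho>min(1)] that] show ?thesis .
  qed
  show ?thesis
  proof (rule exI[of _ K], rule conjI[OF K], rule exI[of _ C])
    show "\<forall>\<^sub>F N in sequentially. \<forall>k::nat. real k = c * real N \<longrightarrow>
           (\<forall>y \<in> node_set x N \<inter> F.
              \<bar>reproducing_kernel x VN p N k y y - 1\<bar> \<le> C * exp (- K * real N)) \<and>
           (\<forall>y \<in> node_set x N \<inter> F. \<forall>z \<in> node_set x N \<inter> F. y \<noteq> z \<longrightarrow>
              \<bar>reproducing_kernel x VN p N k y z\<bar> \<le> C * exp (- K * real N) / \<bar>y - z\<bar>)"
      using H(2) se HN expN cellN[OF \<delta>1(1)] cellN[OF \<delta>2(1)]
    proof eventually_elim
      case (elim N)
      show ?case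
      proof (intro allI impI)
        fix k :: nat assume k: "real k = c * real N"
        have near: "\<bar>y - x N i\<bar> < \<delta>1" "\<bar>y - x N i\<bar> < \<delta>2" "y \<in> {a<..<b}"
          if "i < N" "y \<in> {cell N i<..<cell N (Suc i)}" for y i
        proof -
          have p: "0 \<le> 1 / (2 * real N * \<rho>max)" using \<rho>max by simp
          have "\<bar>y - x N i\<bar> \<le> cell N (Suc i) - cell N i"
            using cell_diff(4,5)[OF that(1)] p that(2) unfolding greaterThanLessThan_iff by linarith
          then show "\<bar>y - x N i\<bar> < \<delta>1" "\<bar>y - x N i\<bar> < \<delta>2"
            using cell_diff(3)[OF that(1)] elim(5,6) by linarith+
          show "y \<in> {a<..<b}" using cell(1)[of i N] cell(2)[of "Suc i" N] that by auto
        qed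
        have nodeG: "complex_of_real (x N i) \<in> G" if "i < N" for i
          using G(2) node_in[OF that] by force
        have main: "\<bar>reproducing_kernel x VN p N k (x N j) (x N j) - 1\<bar> \<le> exp (- (2 * K * real N))"
          "\<And>i. i < N \<Longrightarrow> i \<noteq> j \<Longrightarrow> \<bar>reproducing_kernel x VN p N k (x N j) (x N i)\<bar> \<le> exp (- (K * real N))"
          if j: "j < N" "x N j \<in> F" for j
        proof -
          have jZ: "j \<in> chosen N"
          proof (rule filling_increment(2)[OF j(1)])
            fix y assume "y \<in> {cell N j<..<cell N (Suc j)}"
            then have "y \<in> ball (x N j) \<delta>2" using near(2)[OF j(1)] by (simp add: dist_real_def abs_minus_commute)
            then have "y \<in> \<Gamma>" using j(2) by (intro subsetD[OF \<delta>2(2)] UN_I[of "x N j"])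
            then show "d y = \<rho> y / c" by (rule sat)
          qed
          have bound: "(ln (weight x VN N (x N n)) - ln (weight x VN N (x N j))) / 2 +
              (\<Sum>i\<in>chosen N - {j}. ln \<bar>x N n - x N i\<bar>) - (\<Sum>i\<in>chosen N - {j}. ln \<bar>x N j - x N i\<bar>) \<le> - (4 * K * real N)"
            if n: "n < N" "n \<notin> chosen N" for n
          proof -
            \<comment> \<open>The node itself may be saturated; only some point of its cell is known
              not to be, and uniform continuity carries the lower bound for \<open>dE\<close> over
              to the node.\<close>
            obtain y where y: "y \<in> {cell N n<..<cell N (Suc n)}" "d y \<noteq> \<rho> y / c"
              using filling_increment(2)[OF n(1)] n(2) by blast
            note yn = near[OF n(1) y(1)]
            have "l \<le> dE y" using d_le[OF yn(3)] y(2) by (intro multiplier_le_dE[OF assms(11) yn(3)]) auto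
            moreover have "dist (dE y) (dE (x N n)) < \<kappa>"
              using yn node_in[OF n(1)] by (intro \<delta>1(2)) (auto simp: dist_real_def)
            ultimately have "l - \<kappa> \<le> dE (x N n)" by (simp add: dist_real_def abs_less_iff)
            then have gap: "\<kappa> \<le> dE (x N n) - dE (x N j)" using \<kappa>(2)[OF j(2)] by simp
            have "real N / 2 * \<kappa> \<le> real N / 2 * (dE (x N n) - dE (x N j))"
              using gap by (intro mult_left_mono) auto
            moreover have "real N / 2 * \<kappa> = 8 * (K * real N)" by (simp add: K_def)
            moreover have "(ln (weight x VN N (x N n)) - ln (weight x VN N (x N j))) / 2 +
              (\<Sum>i\<in>chosen N - {j}. ln \<bar>x N n - x N i\<bar>) - (\<Sum>i\<in>chosen N - {j}. ln \<bar>x N j - x N i\<bar>)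
              \<le> - (real N / 2 * (dE (x N n) - dE (x N j))) + 4 * sampling_error N + H"
              using elim(1) nodeG[OF n(1)] nodeG[OF j(1)] by (intro trial_exponent_bound n jZ) auto
            moreover have "T \<le> - (4 * q)" if "q8 = 8 * q" "q8 \<le> e" "T \<le> - e + 4 * s + h" "4 * s \<le> 2 * q" "h \<le> 2 * q"
              for T q q8 e s h :: real using that by linarith
            moreover have "4 * sampling_error N \<le> 2 * (K * real N)" "H \<le> 2 * (K * real N)"
              using elim(2,3) by simp_all
            ultimately show ?thesis unfolding mult.assoc by blast
          qed
          note kn = kernel_near_identity[OF assms(4) chosen_subset card_chosen[OF k] jZ bound]
          show "\<bar>reproducing_kernel x VN p N k (x N j) (x N j) - 1\<bar> \<le> exp (- (2 * K * real N))"
            using kn(1) elim(4) by linarith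
          fix i assume i: "i < N" "i \<noteq> j"
          have "\<bar>reproducing_kernel x VN p N k (x N j) (x N i)\<bar> \<le> sqrt (real N * exp (- (4 * K * real N)))"
            by (rule kn(2)[OF _ _ i])
          also have "\<dots> \<le> sqrt (exp (- (2 * K * real N)))" using elim(4) by simp
          also have "\<dots> = exp (- (K * real N))"
            by (rule real_sqrt_unique) (simp_all add: power2_eq_square flip: exp_add)
          finally show "\<bar>reproducing_kernel x VN p N k (x N j) (x N i)\<bar> \<le> exp (- (K * real N))" .
        qed
        have C: "exp (- (2 * K * real N)) \<le> C * exp (- K * real N)"
        proof -
          have "exp (- (2 * K * real N)) \<le> 1 * exp (- K * real N)" using K by simp
          also have "\<dots> \<le> C * exp (- K * real N)" by (intro mult_right_mono) (auto simp: C_def)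
          finally show ?thesis .
        qed
        have off: "exp (- (K * real N)) \<le> C * exp (- K * real N) / \<bar>y - z\<bar>"
          if "y \<noteq> z" "y \<in> {a..b}" "z \<in> {a..b}" for y z
        proof -
          have "exp (- (K * real N)) * \<bar>y - z\<bar> \<le> exp (- (K * real N)) * C"
            using that by (intro mult_left_mono) (auto simp: C_def)
          then show ?thesis using that by (simp add: pos_le_divide_eq mult.commute)
        qed
        show "(\<forall>y \<in> node_set x N \<inter> F.
              \<bar>reproducing_kernel x VN p N k y y - 1\<bar> \<le> C * exp (- K * real N)) \<and>
           (\<forall>y \<in> node_set x N \<inter> F. \<forall>z \<in> node_set x N \<inter> F. y \<noteq> z \<longrightarrow>
              \<bar>reproducing_kernel x VN p N k y z\<bar> \<le> C * exp (- K * real N) / \<bar>y - z\<bar>)"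
        proof (intro conjI ballI impI)
          fix y assume "y \<in> node_set x N \<inter> F"
          then obtain j where j: "j < N" "y = x N j" "x N j \<in> F" by (auto simp: node_set_def)
          show "\<bar>reproducing_kernel x VN p N k y y - 1\<bar> \<le> C * exp (- K * real N)"
            unfolding j(2) by (rule order.trans[OF main(1)[OF j(1,3)] C])
          fix z assume "z \<in> node_set x N \<inter> F" and yz: "y \<noteq> z"
          then obtain i where i: "i < N" "z = x N i" "x N i \<in> F" by (auto simp: node_set_def)
          have "i \<noteq> j" using yz i j by auto
          moreover have "y \<in> {a..b}" "z \<in> {a..b}" using i j Fab by auto
          ultimately show "\<bar>reproducing_kernel x VN p N k y z\<bar> \<le> C * exp (- K * real N) / \<bar>y - z\<bar>"
            using order.trans[OF main(2)[OF j(1,3) i(1)] off[OF yz]] i j by simp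
        qed
      qed
    qed
  qed
qed

end
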